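(* For every $\sigma\in(0,1]$ and $\varkappa>0$ there is a constant $C(\sigma,\varkappa)>0$ depending only on $\sigma$ and $\varkappa$ such that for all $n\in\mathbb N$ and $Q\ge1$ the following holds. There is a polynomial (probabilistic, adaptive) algorithm that, for any unknown function $f\in\mathcal R(H(\sigma,Q),B_2^n)$, uses at most $C(\sigma,\varkappa)\,n\log^2 n$ evaluations of $f$ with errors not exceeding $Q\exp(-C(\sigma,\varkappa)\log^2 n)$ and outputs an approximation $\widetilde f$ such that, with probability at least $1-2e^{-n}$, $$\|\widetilde f-f\|_{L_\infty(B_2^n)}\le Qn^{-\varkappa}.$$
   Context: $B_2^n=\{x\in\mathbb R^n: |x|\le 1\}$ is the closed Euclidean unit ball, $|\cdot|$ the Euclidean norm and $\langle\cdot,\cdot\rangle$ the standard scalar product. For $\sigma>0$, $Q>0$, $H(\sigma,Q)$ is the class of functions $\varphi$ analytic in the rectangle $\Pi_\sigma=\{z=t+iy: |t|\le 1+\sigma,\ |y|\le\sigma\}$ (with $t,y$ real) such that $|\varphi(z)|\le Q$ for $z\in\Pi_\sigma$ and $\varphi(z)$ is real for real $z$. For a class $\Phi$ of functions $\varphi$ defined on $[-1,1]$ with real values (functions in $H(\sigma,Q)$ are restricted to $[-1,1]$), $\mathcal R(\Phi,B_2^n)$ denotes the class of ridge functions $f\colon B_2^n\to\mathbb R$ of the form $f(x)=\varphi(\langle a,x\rangle)$ with $a\in\mathbb R^n$, $|a|=1$, $\varphi\in\Phi$. Evaluation model: an algorithm knows $n,\sigma,Q,\varkappa$ but not $f$ (neither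 $a$ nor $\varphi$). It chooses points $x^1,x^2,\dots\in B_2^n$; after prescribing $x^i$ it receives a real number $y_i$ with $|y_i-f(x^i)|\le\varepsilon$, where $\varepsilon$ is the stated error bound (apart from this bound the errors are arbitrary). It is adaptive if $x^{i+1}$ may depend on $y_1,\dots,y_i$. It is probabilistic if it may use internal randomness; the probability in the claim is with respect to this randomness. "Polynomial" means that, for fixed $\sigma$ and $\varkappa$, the number of operations performed by the algorithm is bounded by a polynomial in $n$. *)

theory Defs
  imports
    "HOL-Complex_Analysis.Complex_Analysis"
    "HOL-Probability.Probability"
    "HOL-Computational_Algebra.Polynomial"
begin

section \<open>Ridge functions on the Euclidean ball\<close>

text \<open>
  One program has to serve all dimensions \<open>n\<close>, so \<open>n\<close> must be a term and not a type.
  Vectors of \<open>R^n\<close> are extensional functions on \<open>{..<n}\<close>, the points of the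
  product measure space \<open>Pi\<^sub>M {..<n} (\<lambda>_. lborel)\<close>; \<open>L2_set\<close> is the Euclidean norm.
\<close>

definition euclidean :: "nat \<Rightarrow> (nat \<Rightarrow> real) set" where
  "euclidean n = {..<n} \<rightarrow>\<^sub>E UNIV"

definition unit_ball :: "nat \<Rightarrow> (nat \<Rightarrow> real) set" where
  "unit_ball n = {x \<in> euclidean n. L2_set x {..<n} \<le> 1}"

definition scalar_product :: "nat \<Rightarrow> (nat \<Rightarrow> real) \<Rightarrow> (nat \<Rightarrow> real) \<Rightarrow> real" where
  "scalar_product n a x = (\<Sum>i<n. a i * x i)"

text \<open>The library's \<open>esssup\<close> is infinite on functions that are not measurable.\<close>

definition Linf_norm_ball :: "nat \<Rightarrow> ((nat \<Rightarrow> real) \<Rightarrow> real) \<Rightarrow> ereal" where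
  "Linf_norm_ball n g =
     esssup (restrict_space (Pi\<^sub>M {..<n} (\<lambda>_. lborel)) (unit_ball n)) (\<lambda>x. ereal \<bar>g x\<bar>)"

definition rectangle :: "real \<Rightarrow> complex set" where
  "rectangle \<sigma> = {z. \<bar>Re z\<bar> \<le> 1 + \<sigma> \<and> \<bar>Im z\<bar> \<le> \<sigma>}"

text \<open>Analyticity on the closed rectangle means analyticity in a neighbourhood of it.\<close>

definition H :: "real \<Rightarrow> real \<Rightarrow> (complex \<Rightarrow> complex) set" where
  "H \<sigma> Q = {\<phi>. \<phi> analytic_on rectangle \<sigma> \<and> (\<forall>z\<in>rectangle \<sigma>. cmod (\<phi> z) \<le> Q) \<and>
                 (\<forall>z\<in>rectangle \<sigma>. z \<in> \<real> \<longrightarrow> \<phi> z \<in> \<real>)}"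

definition H_restricted :: "real \<Rightarrow> real \<Rightarrow> (real \<Rightarrow> real) set" where
  "H_restricted \<sigma> Q =
     {\<psi>. \<exists>\<phi>\<in>H \<sigma> Q. \<forall>t\<in>{-1..1}. complex_of_real (\<psi> t) = \<phi> (complex_of_real t)}"

text \<open>Membership constrains \<open>f\<close> on the ball only; values elsewhere are never used below.\<close>

definition ridge_functions :: "(real \<Rightarrow> real) set \<Rightarrow> nat \<Rightarrow> ((nat \<Rightarrow> real) \<Rightarrow> real) set" where
  "ridge_functions \<Phi> n =
     {f. \<exists>a\<in>euclidean n. \<exists>\<phi>\<in>\<Phi>. L2_set a {..<n} = 1 \<and>
           (\<forall>x\<in>unit_ball n. f x = \<phi> (scalar_product n a x))}"

section \<open>Real-number programs with an oracle and randomness\<close>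

text \<open>
  A structured real RAM: named index registers holding natural numbers and named arrays of exact
  real numbers. Every arithmetic operation, memory access, comparison, assignment, random draw and
  oracle call counts as one operation. There is no rounding from reals to naturals, index
  arithmetic is additive only, and constants are rational, so no unbounded amount of discrete
  information can be packed into a program constant or unpacked from a real at unit cost.
  The HOL conventions \<open>x / 0 = 0\<close> and \<open>sqrt (-x) = - sqrt x\<close> make all operations total.
\<close>

type_synonym vname = string

datatype iexp =
    IConst nat
  | IVar vname
  | IAdd iexp iexp
  | ISub iexp iexp

datatype rexp =
    RConst rat
  | RCell vname iexp
  | RNat iexp
  | RAdd rexp rexp
  | RSub rexp rexp
  | RMul rexp rexp
  | RDiv rexp rexp
  | RSqrt rexp

datatype bexp =
    ILess iexp iexp
  | RLess rexp rexp
  | BNot bexp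
  | BAnd bexp bexp

datatype com =
    Skip
  | IAssign vname iexp
  | RAssign vname iexp rexp  \<comment> \<open>array, index, new contents of the cell\<close>
  | Sample vname iexp        \<comment> \<open>store a fresh random number in a cell\<close>
  | Query vname iexp vname   \<comment> \<open>store in a cell the answer at the point held by the last array\<close>
  | Seq com com
  | If bexp com com
  | While bexp com

record state =
  ireg :: "vname \<Rightarrow> nat"
  arr :: "vname \<Rightarrow> nat \<Rightarrow> real"
  draws :: nat
  queries :: "(nat \<Rightarrow> real) list"
  ops :: nat

primrec ival :: "iexp \<Rightarrow> state \<Rightarrow> nat" where
  "ival (IConst k) s = k"
| "ival (IVar v) s = ireg s v"
| "ival (IAdd a b) s = ival a s + ival b s"
| "ival (ISub a b) s = ival a s - ival b s"

primrec rval :: "rexp \<Rightarrow> state \<Rightarrow> real" where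
  "rval (RConst q) s = of_rat q"
| "rval (RCell v i) s = arr s v (ival i s)"
| "rval (RNat i) s = real (ival i s)"
| "rval (RAdd a b) s = rval a s + rval b s"
| "rval (RSub a b) s = rval a s - rval b s"
| "rval (RMul a b) s = rval a s * rval b s"
| "rval (RDiv a b) s = rval a s / rval b s"
| "rval (RSqrt a) s = sqrt (rval a s)"

primrec bval :: "bexp \<Rightarrow> state \<Rightarrow> bool" where
  "bval (ILess a b) s = (ival a s < ival b s)"
| "bval (RLess a b) s = (rval a s < rval b s)"
| "bval (BNot b) s = (\<not> bval b s)"
| "bval (BAnd a b) s = (bval a s \<and> bval b s)"

primrec icost :: "iexp \<Rightarrow> nat" where
  "icost (IConst k) = 1"
| "icost (IVar v) = 1"
| "icost (IAdd a b) = icost a + icost b + 1"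
| "icost (ISub a b) = icost a + icost b + 1"

primrec rcost :: "rexp \<Rightarrow> nat" where
  "rcost (RConst q) = 1"
| "rcost (RCell v i) = icost i + 1"
| "rcost (RNat i) = icost i + 1"
| "rcost (RAdd a b) = rcost a + rcost b + 1"
| "rcost (RSub a b) = rcost a + rcost b + 1"
| "rcost (RMul a b) = rcost a + rcost b + 1"
| "rcost (RDiv a b) = rcost a + rcost b + 1"
| "rcost (RSqrt a) = rcost a + 1"

primrec bcost :: "bexp \<Rightarrow> nat" where
  "bcost (ILess a b) = icost a + icost b + 1"
| "bcost (RLess a b) = rcost a + rcost b + 1"
| "bcost (BNot b) = bcost b + 1"
| "bcost (BAnd a b) = bcost a + bcost b + 1"

definition tick :: "nat \<Rightarrow> state \<Rightarrow> state" where
  "tick k s = s\<lparr>ops := ops s + k\<rparr>"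

definition set_ireg :: "vname \<Rightarrow> nat \<Rightarrow> state \<Rightarrow> state" where
  "set_ireg v k s = s\<lparr>ireg := (ireg s)(v := k)\<rparr>"

definition set_cell :: "vname \<Rightarrow> nat \<Rightarrow> real \<Rightarrow> state \<Rightarrow> state" where
  "set_cell v i r s = s\<lparr>arr := (arr s)(v := (arr s v)(i := r))\<rparr>"

text \<open>
  Big-step semantics in dimension \<open>n\<close>: \<open>answer i x\<close> is the number returned when the query number
  \<open>i\<close> (counted from 0) is made at the point \<open>x\<close>, and \<open>\<omega>\<close> is the sequence of random numbers.
  A diverging program has no final state.
\<close>

inductive exec ::
  "nat \<Rightarrow> (nat \<Rightarrow> (nat \<Rightarrow> real) \<Rightarrow> real) \<Rightarrow> (nat \<Rightarrow> real) \<Rightarrow> com \<Rightarrow> state \<Rightarrow> state \<Rightarrow> bool"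
  for n answer \<omega> where
  Skip: "exec n answer \<omega> Skip s s"
| IAssign: "exec n answer \<omega> (IAssign v a) s (tick (icost a + 1) (set_ireg v (ival a s) s))"
| RAssign: "exec n answer \<omega> (RAssign v i r) s
     (tick (icost i + rcost r + 1) (set_cell v (ival i s) (rval r s) s))"
| Sample: "exec n answer \<omega> (Sample v i) s
     (tick (icost i + 1) (set_cell v (ival i s) (\<omega> (draws s)) (s\<lparr>draws := draws s + 1\<rparr>)))"
| Query: "x = restrict (arr s p) {..<n} \<Longrightarrow>
     exec n answer \<omega> (Query v i p) s
       (tick (icost i + 1) (set_cell v (ival i s) (answer (length (queries s)) x)
         (s\<lparr>queries := queries s @ [x]\<rparr>)))"
| Seq: "exec n answer \<omega> c s s' \<Longrightarrow> exec n answer \<omega> d s' s'' \<Longrightarrow> exec n answer \<omega> (Seq c d) s s''"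
| IfTrue: "bval b s \<Longrightarrow> exec n answer \<omega> c (tick (bcost b) s) s' \<Longrightarrow> exec n answer \<omega> (If b c d) s s'"
| IfFalse: "\<not> bval b s \<Longrightarrow> exec n answer \<omega> d (tick (bcost b) s) s' \<Longrightarrow> exec n answer \<omega> (If b c d) s s'"
| WhileFalse: "\<not> bval b s \<Longrightarrow> exec n answer \<omega> (While b c) s (tick (bcost b) s)"
| WhileTrue: "bval b s \<Longrightarrow> exec n answer \<omega> c (tick (bcost b) s) s' \<Longrightarrow>
     exec n answer \<omega> (While b c) s' s'' \<Longrightarrow> exec n answer \<omega> (While b c) s s''"

inductive_cases SkipE: "exec n answer \<omega> Skip s t"
inductive_cases IAssignE: "exec n answer \<omega> (IAssign v a) s t"
inductive_cases RAssignE: "exec n answer \<omega> (RAssign v i r) s t"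
inductive_cases SampleE: "exec n answer \<omega> (Sample v i) s t"
inductive_cases QueryE: "exec n answer \<omega> (Query v i p) s t"
inductive_cases SeqE: "exec n answer \<omega> (Seq c d) s t"
inductive_cases IfE: "exec n answer \<omega> (If b c d) s t"
inductive_cases WhileE: "exec n answer \<omega> (While b c) s t"

lemma exec_deterministic:
  "exec n answer \<omega> c s t \<Longrightarrow> exec n answer \<omega> c s t' \<Longrightarrow> t' = t"
proof (induction arbitrary: t' rule: exec.induct)
  case (Seq c s s' d s'')
  then show ?case by (metis SeqE)
next
  case (IfTrue b s c s' d)
  then show ?case by (metis IfE)
next
  case (IfFalse b s d s' c)
  then show ?case by (metis IfE)
next
  case (WhileFalse b s c)
  then show ?case by (metis WhileE)
next
  case (WhileTrue b s c s' s'')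
  then show ?case by (metis WhileE)
qed (auto elim: SkipE IAssignE RAssignE SampleE QueryE)

section \<open>Recovery algorithms\<close>

text \<open>
  The approximation an algorithm outputs is a function, represented by the memory contents left by
  the recovery program together with a program that evaluates it at a given point of the ball.
\<close>

record algorithm =
  recovery :: com
  evaluation :: com

definition initial_state :: "nat \<Rightarrow> real \<Rightarrow> real \<Rightarrow> real \<Rightarrow> state" where
  "initial_state n \<sigma> Q \<kappa> =
     \<lparr>ireg = (\<lambda>_. 0)(''n'' := n),
      arr = (\<lambda>_ _. 0)(''sigma'' := (\<lambda>_. 0)(0 := \<sigma>),
                      ''Q'' := (\<lambda>_. 0)(0 := Q),
                      ''kappa'' := (\<lambda>_. 0)(0 := \<kappa>)),
      draws = 0, queries = [], ops = 0\<rparr>"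

definition load_point :: "nat \<Rightarrow> (nat \<Rightarrow> real) \<Rightarrow> state \<Rightarrow> state" where
  "load_point n x s = s\<lparr>arr := (arr s)(''x'' := (\<lambda>i. if i < n then x i else 0))\<rparr>"

text \<open>
  Started with answers \<open>answer\<close> and random numbers \<open>\<omega>\<close>, the recovery program halts in the state
  \<open>s\<close> and thereby outputs \<open>g\<close>: from \<open>s\<close> and any point \<open>x\<close> of the ball the evaluation program
  computes \<open>g x\<close>, without further queries or random draws. Recovery followed by one evaluation
  takes at most \<open>T\<close> operations.
\<close>

definition outputs_within ::
  "nat \<Rightarrow> algorithm \<Rightarrow> nat \<Rightarrow> real \<Rightarrow> real \<Rightarrow> real \<Rightarrow> (nat \<Rightarrow> (nat \<Rightarrow> real) \<Rightarrow> real) \<Rightarrow>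
   (nat \<Rightarrow> real) \<Rightarrow> state \<Rightarrow> ((nat \<Rightarrow> real) \<Rightarrow> real) \<Rightarrow> bool" where
  "outputs_within T A n \<sigma> Q \<kappa> answer \<omega> s g \<longleftrightarrow>
     exec n answer \<omega> (recovery A) (initial_state n \<sigma> Q \<kappa>) s \<and> ops s \<le> T \<and>
     (\<forall>x\<in>unit_ball n. \<exists>t. exec n answer \<omega> (evaluation A) (load_point n x s) t \<and>
        queries t = queries s \<and> draws t = draws s \<and> ops t \<le> T \<and> arr t ''out'' 0 = g x)"

text \<open>Independent random numbers, uniformly distributed on \<open>[0,1]\<close>.\<close>

definition randomness :: "(nat \<Rightarrow> real) measure" where
  "randomness = Pi\<^sub>M UNIV (\<lambda>_. restrict_space lborel {0..1})"

lemma prob_space_randomness: "prob_space randomness"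
proof -
  have "prob_space (restrict_space lborel {0..1::real})"
    by (rule prob_spaceI) (simp add: emeasure_restrict_space space_restrict_space)
  then show ?thesis
    unfolding randomness_def by (intro prob_space_PiM)
qed

end

theory Submission
  imports Defs
begin

text \<open>
  Put \<open>l = \<lceil>log 2 n\<rceil>\<close>. If a bounded analytic function on the rectangle is at most \<open>2^(- D l^2)\<close> at
  about \<open>l\<close> equispaced nodes of an interval of length \<open>2^(- l)\<close>, then it is at most \<open>2^(- k l)\<close> on the
  whole of \<open>[-1,1]\<close>: a conformal map carries an interval containing \<open>[-1,1]\<close> into a disc, and there
  iterated divided differences at the nodes control the function. Applied to \<open>\<phi>'\<close> along the
  coordinate axes, on one of which the component of \<open>a\<close> is at least \<open>2^(- l)\<close>, this leaves two cases.
  Either \<open>\<phi>\<close> is nearly constant and every direction will do, or the node with the largest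
  difference is one where \<open>\<phi>'\<close> is not too small, and there the forward differences of \<open>f\<close> along
  the axes are nearly proportional to \<open>a\<close>. The profile is then sampled at \<open>O(n)\<close> equispaced points of
  the line in the direction found, and interpolated locally with a fixed degree. The algorithm is
  deterministic, so the event of success is the whole probability space.
\<close>

section \<open>Newton interpolation of analytic functions\<close>

text \<open>Every node gains a fixed factor \<open>q < 1\<close>, so about \<open>l\<close> nodes
  give \<open>2^(- k l)\<close>. But the nodes scale with the unknown component of \<open>a\<close>,
  which may be as small as \<open>2^(- l)\<close>; dividing by gaps of size
  \<open>2^(- O(l))\<close> once per node amplifies noise by \<open>2^(O(l^2))\<close>. Hence the
  noise, the step \<open>h\<close> and the threshold \<open>\<gamma>\<close> for the derivative all
  have the form \<open>2^(- const l^2)\<close>. Their order matters: \<open>\<gamma>\<close> must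
  survive the amplification, and \<open>h\<close> must lie below \<open>\<gamma>\<close> by a
  further power of \<open>n\<close>, so that in a difference of order \<open>Q \<gamma> h\<close>
  both the Taylor remainder and the noise, of order \<open>Q h^2\<close>, are negligible. The
  direction \<open>v\<close> is found up to sign and small error only. On its line \<open>f\<close>
  is the function \<open>\<phi>(c s)\<close> of \<open>s\<close>, with \<open>c = <a,v>\<close>.
  This function is interpolated as it stands, so \<open>c\<close> and its sign never have to be
  known. Enlarging \<open>C\<close> relaxes the query budget and tightens the noise at once, so one
  constant serves both. For \<open>n = 1\<close> the budget is 0, and the output 0 already has error
  at most \<open>Q\<close>.\<close>

fun newton :: "('a::field \<times> 'a) list \<Rightarrow> 'a \<Rightarrow> 'a" where
  "newton [] w = 0"
| "newton ((u, y) # ps) w = y + (w - u) * newton (map (\<lambda>(v, z). (v, (z - y) / (v - u))) ps) w"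

text \<open>
  The parameter \<open>c\<close> makes one induction serve both uses. Dividing out a node multiplies the bound
  by \<open>2\<close> in general, which is harmless when the nodes are close together, but only by \<open>1\<close> if the data
  vanish, and then the ratio \<open>(r + \<rho>) / (R - \<rho>)\<close> may be close to \<open>1\<close>.
\<close>

lemma newton_error:
  fixes G :: "complex \<Rightarrow> complex"
  assumes "G holomorphic_on cball 0 R" and "\<And>z. z \<in> cball 0 R \<Longrightarrow> norm (G z) \<le> B"
    and "\<And>u y. (u, y) \<in> set ps \<Longrightarrow> norm u \<le> \<rho> \<and> norm (G u - y) \<le> \<eta>"
    and "sorted_wrt (\<lambda>p p'. \<delta> \<le> norm (fst p - fst p')) ps"
    and c: "2 \<le> c \<or> c = 1 \<and> (\<forall>p\<in>set ps. snd p = 0)"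
    and "0 < \<delta>" "0 \<le> \<rho>" "\<rho> < R" "norm w \<le> r" "r \<le> R" "2 \<le> 2 * (r + \<rho>) / \<delta>"
    and "c * (r + \<rho>) / (R - \<rho>) \<le> 1" and "0 \<le> \<eta>"
  shows "norm (G w - newton ps w)
    \<le> (c * (r + \<rho>) / (R - \<rho>)) ^ length ps * B + 2 * ((2 * (r + \<rho>) / \<delta>) ^ length ps - 1) * \<eta>"
  using assms(1-5,13)
proof (induction ps arbitrary: G B \<eta> rule: length_induct)
  case (1 ps)
  have r0: "0 \<le> r" using assms(9) norm_ge_zero order_trans by blast
  have wR: "w \<in> cball 0 R" using assms(9,10) by simp
  show ?case
  proof (cases ps)
    case Nil
    then show ?thesis using "1.prems"(2)[OF wR] by simp
  next
    case (Cons p qs)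
    obtain u y where p: "p = (u, y)" by (cases p)
    define q where "q = c * (r + \<rho>) / (R - \<rho>)"
    define s where "s = 2 * (r + \<rho>) / \<delta>"
    define M where "M = length qs"
    \<comment> \<open>The derivative fills the removable singularity at \<open>u\<close>.
      \<open>qs'\<close> is noisy data of \<open>G'\<close> at the remaining nodes, with noise
      \<open>2 * \<eta> / \<delta>\<close>, so the induction hypothesis applies to it.\<close>
    define G' where "G' = (\<lambda>z. if z = u then deriv G u else (G z - G u) / (z - u))"
    define qs' where "qs' = map (\<lambda>(v, z). (v, (z - y) / (v - u))) qs"
    define B' where "B' = (c * B + \<eta>) / (R - \<rho>)"
    have u: "norm u \<le> \<rho>" "norm (G u - y) \<le> \<eta>"
      using "1.prems"(3)[of u y] Cons p by auto
    have uR: "u \<in> ball 0 R" using u(1) assms(8) by simp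
    have B: "0 \<le> B" using "1.prems"(2)[OF wR] norm_ge_zero order_trans by blast
    have c1: "1 \<le> c" using "1.prems"(5) by auto
    have q0: "0 \<le> q" "q \<le> 1" unfolding q_def using assms(7,8,12) r0 c1 by auto
    have hol: "G' holomorphic_on cball 0 R"
      unfolding G'_def by (rule pole_lemma[OF "1.prems"(1)]) (use uR in simp)
    \<comment> \<open>Bounding \<open>norm (G u)\<close> by \<open>B\<close> costs the factor 2; if
      the datum is 0, then \<open>G u\<close> is itself noise and only \<open>\<eta>\<close> is
      added.\<close>
    have Gu: "B + norm (G u) \<le> c * B + \<eta>"
    proof (cases "2 \<le> c")
      case True
      have "norm (G u) \<le> B" using "1.prems"(2)[of u] uR by simp
      moreover have "2 * B \<le> c * B" using True B by (rule mult_right_mono)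
      ultimately show ?thesis using "1.prems"(6) by linarith
    next
      case False
      then have "c = 1" "y = 0" using "1.prems"(5) Cons p by auto
      then show ?thesis using u(2) by simp
    qed
    \<comment> \<open>On the circle \<open>norm z = R\<close> the divisor is at least
      \<open>R - \<rho>\<close>; the maximum principle carries the bound inward, past the point
      \<open>u\<close> where the divisor vanishes.\<close>
    have bd: "norm (G' z) \<le> B'" if "z \<in> cball 0 R" for z
    proof (rule maximum_modulus_frontier[of G' "cball 0 R"])
      show "G' holomorphic_on interior (cball 0 R)"
        using hol by (rule holomorphic_on_subset) (simp add: interior_subset)
      show "continuous_on (closure (cball 0 R)) G'"
        using hol by (simp add: holomorphic_on_imp_continuous_on)
      fix x :: complex assume "x \<in> frontier (cball 0 R)"
      then have x: "norm x = R" using assms(7,8) by (simp add: frontier_cball)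
      have xu: "R - \<rho> \<le> norm (x - u)"
        using norm_triangle_ineq2[of x u] x u(1) by linarith
      then have "x \<noteq> u" using assms(8) by auto
      then have "norm (G' x) = norm (G x - G u) / norm (x - u)"
        by (simp add: G'_def norm_divide)
      also have "\<dots> \<le> (c * B + \<eta>) / (R - \<rho>)"
      proof (rule frac_le)
        show "norm (G x - G u) \<le> c * B + \<eta>"
          using norm_triangle_ineq4[of "G x" "G u"] "1.prems"(2)[of x] x Gu by simp
      qed (use B c1 xu assms(8) "1.prems"(6) in auto)
      finally show "norm (G' x) \<le> B'" unfolding B'_def .
    qed (use that in auto)
    have sep: "\<delta> \<le> norm (u - v)" if "(v, z) \<in> set qs" for v z
      using "1.prems"(4) that by (auto simp: Cons p)
    have "norm (G' w - newton qs' w)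
        \<le> q ^ length qs' * B' + 2 * (s ^ length qs' - 1) * (2 * \<eta> / \<delta>)"
      unfolding q_def s_def
    proof (rule "1.IH"[rule_format])
      show "length qs' < length ps" by (simp add: qs'_def Cons)
      show "G' holomorphic_on cball 0 R" by (rule hol)
      show "norm (G' z) \<le> B'" if "z \<in> cball 0 R" for z by (rule bd[OF that])
      show "norm v \<le> \<rho> \<and> norm (G' v - x) \<le> 2 * \<eta> / \<delta>" if "(v, x) \<in> set qs'" for v x
      proof -
        from that obtain z where z: "(v, z) \<in> set qs" "x = (z - y) / (v - u)"
          by (auto simp: qs'_def)
        have v: "norm v \<le> \<rho>" "norm (G v - z) \<le> \<eta>"
          using "1.prems"(3)[of v z] z Cons by auto
        have d: "\<delta> \<le> norm (v - u)" using sep[OF z(1)] by (simp add: norm_minus_commute)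
        then have "v \<noteq> u" using assms(6) by auto
        then have "G' v - x = ((G v - z) - (G u - y)) / (v - u)"
          by (simp add: G'_def z(2) diff_divide_distrib)
        then have "norm (G' v - x) = norm ((G v - z) - (G u - y)) / norm (v - u)"
          by (simp add: norm_divide)
        also have "\<dots> \<le> 2 * \<eta> / \<delta>"
          by (rule frac_le) (use norm_triangle_ineq4[of "G v - z" "G u - y"] v u d assms(6) "1.prems"(6) in auto)
        finally show ?thesis using v by simp
      qed
      show "sorted_wrt (\<lambda>p p'. \<delta> \<le> norm (fst p - fst p')) qs'"
        using "1.prems"(4)
        by (simp add: qs'_def Cons sorted_wrt_map case_prod_beta)
      show "2 \<le> c \<or> c = 1 \<and> (\<forall>p\<in>set qs'. snd p = 0)"
        using "1.prems"(5) by (auto simp: qs'_def Cons p)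
      show "0 \<le> 2 * \<eta> / \<delta>" using assms(6) "1.prems"(6) by simp
    qed
    then have IH: "norm (G' w - newton qs' w) \<le> q ^ M * B' + 2 * (s ^ M - 1) * (2 * \<eta> / \<delta>)"
      by (simp add: qs'_def M_def)
    have wu: "norm (w - u) \<le> r + \<rho>"
      using norm_triangle_ineq4[of w u] assms(9) u(1) by linarith
    have Gw: "G w = G u + (w - u) * G' w" by (simp add: G'_def)
    have "G w - newton ps w = (G u - y) + (w - u) * (G' w - newton qs' w)"
      unfolding Gw by (simp add: Cons p qs'_def algebra_simps)
    then have "norm (G w - newton ps w) \<le> norm (G u - y) + norm (w - u) * norm (G' w - newton qs' w)"
      by (metis norm_mult norm_triangle_ineq)
    also have "\<dots> \<le> \<eta> + (r + \<rho>) * (q ^ M * B' + 2 * (s ^ M - 1) * (2 * \<eta> / \<delta>))"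
      using u(2) wu IH r0 assms(7) by (intro add_mono mult_mono) auto
    also have "\<dots> = \<eta> + q ^ M * (c * (r + \<rho>) / (R - \<rho>)) * B + q ^ M * ((r + \<rho>) / (R - \<rho>)) * \<eta>
        + s * (2 * (s ^ M - 1)) * \<eta>"
      by (simp add: B'_def s_def add_divide_distrib algebra_simps)
    also have "\<dots> \<le> \<eta> + q ^ M * q * B + 1 * \<eta> + s * (2 * (s ^ M - 1)) * \<eta>"
    proof -
      have "(r + \<rho>) / (R - \<rho>) \<le> c * ((r + \<rho>) / (R - \<rho>))"
        using mult_right_mono[OF c1, of "(r + \<rho>) / (R - \<rho>)"] r0 assms(7,8) by simp
      then have "(r + \<rho>) / (R - \<rho>) \<le> 1" using q0(2) q_def by simp
      moreover have "q ^ M \<le> 1" using q0 by (simp add: power_le_one)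
      ultimately have "q ^ M * ((r + \<rho>) / (R - \<rho>)) \<le> 1"
        using mult_mono[of "q ^ M" 1 "(r + \<rho>) / (R - \<rho>)" 1] r0 assms(7,8) by simp
      then have "q ^ M * ((r + \<rho>) / (R - \<rho>)) * \<eta> \<le> 1 * \<eta>"
        using "1.prems"(6) by (rule mult_right_mono)
      then show ?thesis unfolding q_def by linarith
    qed
    also have "\<dots> = q ^ Suc M * B + (2 * s ^ Suc M - (2 * s - 2)) * \<eta>"
      by (simp add: algebra_simps)
    \<comment> \<open>Each node adds \<open>2 * \<eta>\<close>; the \<open>-1\<close> in the noise
      factor absorbs it, because \<open>2 - 2 * s \<le> -2\<close>.\<close>
    also have "\<dots> \<le> q ^ Suc M * B + (2 * (s ^ Suc M - 1)) * \<eta>"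
    proof (intro add_left_mono mult_right_mono)
      have "2 \<le> s" using assms(11) by (simp add: s_def)
      then show "2 * s ^ Suc M - (2 * s - 2) \<le> 2 * (s ^ Suc M - 1)" by simp
    qed (rule "1.prems"(6))
    finally show ?thesis by (simp add: q_def s_def M_def Cons)
  qed
qed

lemma newton_zero: "(\<And>p. p \<in> set ps \<Longrightarrow> snd p = 0) \<Longrightarrow> newton ps w = 0"
proof (induction ps w rule: newton.induct)
  case (2 u y ps w)
  have "y = 0" using "2.prems"[of "(u, y)"] by simp
  have "newton (map (\<lambda>(v, z). (v, (z - y) / (v - u))) ps) w = 0"
    by (rule "2.IH") (use "2.prems" \<open>y = 0\<close> in fastforce)
  then show ?case using \<open>y = 0\<close> by simp
qed simp

section \<open>Smallness at nodes near the origin spreads to the segment\<close>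

text \<open>The derivative \<open>1 - tanh v ^ 2\<close> lies between \<open>1 - tanh z ^ 2\<close>
  and 1 on \<open>[-z, z]\<close>. The lower bound will keep pulled-back nodes apart, the upper one
  keeps them near 0.\<close>

lemma tanh_diff_bounds:
  fixes x y z :: real
  assumes "\<bar>x\<bar> \<le> z" "\<bar>y\<bar> \<le> z"
  shows "(1 - tanh z ^ 2) * \<bar>x - y\<bar> \<le> \<bar>tanh x - tanh y\<bar>" "\<bar>tanh x - tanh y\<bar> \<le> \<bar>x - y\<bar>"
proof -
  have *: "(1 - tanh z ^ 2) * \<bar>x - y\<bar> \<le> \<bar>tanh x - tanh y\<bar> \<and> \<bar>tanh x - tanh y\<bar> \<le> \<bar>x - y\<bar>"
    if xy: "x < y" "\<bar>x\<bar> \<le> z" "\<bar>y\<bar> \<le> z" for x y :: real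
  proof -
    have "\<exists>v>x. v < y \<and> tanh y - tanh x = (y - x) * (1 - tanh v ^ 2)"
      by (rule MVT2[OF xy(1)]) (auto intro!: derivative_eq_intros)
    then obtain v where v: "x < v" "v < y" "tanh y - tanh x = (y - x) * (1 - tanh v ^ 2)"
      by blast
    have "\<bar>v\<bar> \<le> z" using v xy by linarith
    then have "tanh \<bar>v\<bar> \<le> tanh z" by (simp only: tanh_real_le_iff)
    moreover have "0 \<le> tanh \<bar>v\<bar>" by simp
    ultimately have "tanh \<bar>v\<bar> ^ 2 \<le> tanh z ^ 2" by (rule power_mono)
    then have "tanh v ^ 2 \<le> tanh z ^ 2" by (simp add: abs_if split: if_splits)
    moreover have "tanh v ^ 2 \<le> 1" using tanh_real_bounds[of v] by (simp add: abs_square_le_1 abs_le_iff)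
    ultimately have "(1 - tanh z ^ 2) * (y - x) \<le> (1 - tanh v ^ 2) * (y - x)"
      "(1 - tanh v ^ 2) * (y - x) \<le> 1 * (y - x)" "0 \<le> (y - x) * (1 - tanh v ^ 2)"
      using xy by (auto intro!: mult_right_mono)
    then have "\<bar>tanh y - tanh x\<bar> = (1 - tanh v ^ 2) * (y - x)" "\<bar>x - y\<bar> = y - x"
      using v xy by (auto simp: mult.commute)
    then show ?thesis
      using \<open>(1 - tanh z ^ 2) * (y - x) \<le> (1 - tanh v ^ 2) * (y - x)\<close>
        \<open>(1 - tanh v ^ 2) * (y - x) \<le> 1 * (y - x)\<close>
      by (simp add: abs_minus_commute)
  qed
  have "x < y \<or> x = y \<or> y < x" by linarith
  then have "(1 - tanh z ^ 2) * \<bar>x - y\<bar> \<le> \<bar>tanh x - tanh y\<bar> \<and> \<bar>tanh x - tanh y\<bar> \<le> \<bar>x - y\<bar>"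
    using *[of x y] *[of y x] assms by (auto simp: abs_minus_commute)
  then show "(1 - tanh z ^ 2) * \<bar>x - y\<bar> \<le> \<bar>tanh x - tanh y\<bar>" "\<bar>tanh x - tanh y\<bar> \<le> \<bar>x - y\<bar>"
    by auto
qed

text \<open>The conformal map of the unit disc onto the strip of half-width \<open>A * pi / 2\<close>.\<close>

definition strip_map :: "real \<Rightarrow> complex \<Rightarrow> complex" where
  "strip_map A w = of_real A * Ln ((1 + w) / (1 - w))"

text \<open>Multiplying by the conjugate of the denominator leaves \<open>1 - |w|^2\<close> as real
  part of the numerator. So the quotient avoids the branch cut of \<open>Ln\<close> and has argument
  below \<open>pi / 2\<close>.\<close>

lemma Re_moebius_pos:
  fixes w :: complex
  assumes "norm w < 1" shows "0 < Re ((1 + w) / (1 - w))"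
proof -
  have "w \<noteq> 1" using assms by auto
  have "(1 + w) / (1 - w) = (1 + w) * cnj (1 - w) / of_real ((cmod (1 - w))\<^sup>2)"
    by (subst complex_norm_square) (use \<open>w \<noteq> 1\<close> in simp)
  then have "Re ((1 + w) / (1 - w)) = Re ((1 + w) * cnj (1 - w)) / (cmod (1 - w))\<^sup>2"
    by (simp only: Re_divide_of_real)
  also have "Re ((1 + w) * cnj (1 - w)) = 1 - (cmod w)\<^sup>2"
    unfolding cmod_power2 by (simp add: algebra_simps power2_eq_square)
  finally show ?thesis
    using assms \<open>w \<noteq> 1\<close> by (simp add: abs_square_less_1 zero_less_divide_iff)
qed

lemma strip_map_holomorphic: "strip_map A holomorphic_on ball 0 1"
proof -
  have "(1 + w) / (1 - w) \<notin> \<real>\<^sub>\<le>\<^sub>0" if "w \<in> ball 0 1" for w :: complex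
    using Re_moebius_pos[of w] that by (auto simp: complex_nonpos_Reals_iff)
  moreover have "1 - w \<noteq> 0" if "w \<in> ball 0 1" for w :: complex using that by auto
  ultimately show ?thesis
    unfolding strip_map_def by (intro holomorphic_intros) auto
qed

lemma strip_map_Im:
  fixes w :: complex
  assumes "norm w < 1" "0 < A" shows "\<bar>Im (strip_map A w)\<bar> \<le> A * pi / 2"
proof -
  have "(1 + w) / (1 - w) \<noteq> 0" using Re_moebius_pos[OF assms(1)] by (metis less_irrefl zero_complex.simps(1))
  then have "\<bar>Im (Ln ((1 + w) / (1 - w)))\<bar> < pi / 2"
    using Re_moebius_pos[OF assms(1)] Re_Ln_pos_lt by blast
  then have "A * \<bar>Im (Ln ((1 + w) / (1 - w)))\<bar> \<le> A * (pi / 2)"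
    using assms(2) by (intro mult_left_mono) auto
  then show ?thesis using assms(2) by (simp add: strip_map_def abs_mult)
qed

text \<open>The modulus of the quotient lies between \<open>(1 - R) / (1 + R)\<close> and its
  inverse, and \<open>A * ln ((1 + R) / (1 - R)) = 2 * A * artanh R = x\<close>. Smaller discs thus
  go into rectangles inside the strip.\<close>

lemma strip_map_Re:
  fixes w :: complex
  assumes "norm w \<le> tanh (x / (2 * A))" "0 < A" shows "\<bar>Re (strip_map A w)\<bar> \<le> x"
proof -
  define R where "R = tanh (x / (2 * A))"
  have R: "0 \<le> R" "R < 1" "norm w \<le> R"
    using assms order_trans[OF norm_ge_zero assms(1)] tanh_real_lt_1 by (auto simp only: R_def)
  have "1 - R \<le> norm (1 + w)" "norm (1 + w) \<le> 1 + R" "1 - R \<le> norm (1 - w)" "norm (1 - w) \<le> 1 + R"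
    using norm_triangle_ineq2[of 1 "-w"] norm_triangle_ineq[of 1 w]
      norm_triangle_ineq2[of 1 w] norm_triangle_ineq4[of 1 w] R(3) by auto
  then have q: "(1 - R) / (1 + R) \<le> norm (1 + w) / norm (1 - w)"
    "norm (1 + w) / norm (1 - w) \<le> (1 + R) / (1 - R)" "0 < norm (1 + w) / norm (1 - w)"
    using R by (auto intro!: frac_le divide_pos_pos)
  have "(1 + w) / (1 - w) \<noteq> 0" using q(3) by auto
  then have Re: "Re (strip_map A w) = A * ln (norm (1 + w) / norm (1 - w))"
    by (simp add: strip_map_def norm_divide)
  have ar: "ln ((1 + R) / (1 - R)) = x / A"
    using artanh_tanh_real[of "x / (2 * A)"] assms(2) by (simp add: artanh_def R_def field_simps)
  have "ln ((1 - R) / (1 + R)) = - ln ((1 + R) / (1 - R))"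
    using R by (simp add: ln_div)
  then have "\<bar>ln (norm (1 + w) / norm (1 - w))\<bar> \<le> x / A"
    using q R ar ln_le_cancel_iff[of "(1 - R) / (1 + R)" "norm (1 + w) / norm (1 - w)"]
      ln_le_cancel_iff[of "norm (1 + w) / norm (1 - w)" "(1 + R) / (1 - R)"]
    by (auto simp: abs_le_iff)
  then have "A * \<bar>ln (norm (1 + w) / norm (1 - w))\<bar> \<le> A * (x / A)"
    using assms(2) by (intro mult_left_mono) auto
  then show ?thesis unfolding Re using assms(2) by (simp add: abs_mult)
qed

lemma strip_map_tanh:
  assumes "0 < A" shows "strip_map A (of_real (tanh (t / (2 * A)))) = of_real t"
proof -
  define R where "R = tanh (t / (2 * A))"
  have R: "-1 < R" "R < 1" unfolding R_def by (auto simp: tanh_real_lt_1 tanh_real_gt_neg1)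
  have "(1 + of_real R) / (1 - of_real R) = complex_of_real ((1 + R) / (1 - R))" by simp
  moreover have "0 < (1 + R) / (1 - R)" using R by auto
  ultimately have "Ln ((1 + of_real R) / (1 - of_real R)) = of_real (ln ((1 + R) / (1 - R)))"
    by (metis Ln_of_real)
  moreover have "ln ((1 + R) / (1 - R)) = t / A"
    using artanh_tanh_real[of "t / (2 * A)"] assms by (simp add: artanh_def R_def field_simps)
  ultimately show ?thesis
    using assms unfolding strip_map_def R_def[symmetric] by simp
qed

lemma half_power_le: "0 < (x::real) \<Longrightarrow> \<exists>k. (1/2) ^ k \<le> x"
  using real_arch_pow_inv[of x "1/2"] by (auto intro: less_imp_le)

text \<open>Values below \<open>\<eta>\<close> are zero data with noise \<open>\<eta>\<close>, and
  zero data have the interpolant 0. So \<open>newton_error\<close> with \<open>c = 1\<close>,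
  applied to \<open>F \<circ> strip_map A\<close>, bounds \<open>F\<close> itself. \<open>T\<close>,
  \<open>K\<close> and \<open>D\<close> are chosen before \<open>\<alpha>\<close>, which stands for
  an unknown component of the direction.\<close>

lemma small_on_segment:
  fixes k :: nat
  assumes "0 < \<sigma>"
  shows "\<exists>T\<ge>2. \<exists>K>0. \<exists>D. \<forall>l\<ge>1. \<forall>\<alpha> F B \<eta> t.
    F holomorphic_on rectangle \<sigma> \<longrightarrow> (\<forall>z\<in>rectangle \<sigma>. norm (F z) \<le> B) \<longrightarrow>
    (1/2) ^ l \<le> \<bar>\<alpha>\<bar> \<longrightarrow> \<bar>\<alpha>\<bar> \<le> 1 \<longrightarrow>
    (\<forall>j<K * l. norm (F (of_real (real j / real (T * (K * l)) * \<alpha>))) \<le> \<eta>) \<longrightarrow> \<bar>t\<bar> \<le> 1 \<longrightarrow>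
    norm (F (of_real t)) \<le> (1/2) ^ (k * l) * B + 2 ^ (D * l\<^sup>2) * \<eta>"
proof -
  \<comment> \<open>The strip gets half-width exactly \<open>\<sigma>\<close>. On the real axis the
    radii \<open>r\<close> and \<open>R\<close> correspond to \<open>1\<close> and
    \<open>1 + \<sigma>\<close>, and \<open>\<rho>\<close> is small enough for
    \<open>q < 1\<close>.\<close>
  define A where "A = 2 * \<sigma> / pi"
  have A: "0 < A" using assms by (simp add: A_def)
  define r where "r = tanh (1 / (2 * A))"
  define R where "R = tanh ((1 + \<sigma>) / (2 * A))"
  define \<rho> where "\<rho> = (R - r) / 4"
  have r: "0 < r" "r < R" "R < 1"
    using A assms by (auto simp: r_def R_def divide_strict_right_mono tanh_real_lt_1)
  have \<rho>: "0 < \<rho>" using r by (simp add: \<rho>_def)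
  define q where "q = (r + \<rho>) / (R - \<rho>)"
  have q: "0 \<le> q" "q < 1" using r \<rho> by (auto simp: q_def \<rho>_def field_simps)
  obtain K0 where K0: "q ^ K0 < (1/2) ^ k" using real_arch_pow_inv[of "(1/2)^k" q] q by auto
  define K where "K = Suc K0"
  have "q ^ K \<le> q ^ K0" unfolding K_def using q by (intro power_decreasing) auto
  then have K: "0 < K" "q ^ K \<le> (1/2) ^ k" using K0 by (auto simp: K_def)
  \<comment> \<open>Nodes within \<open>1 / T\<close> of 0 have preimages of modulus at most
    \<open>\<rho>\<close>. The summand 2 secures \<open>2 \<le> T\<close>, which later leaves room
    in the ball for the step \<open>h\<close>.\<close>
  obtain T where T': "1 / (2 * A * \<rho>) + 2 < real T" using reals_Archimedean2 by blast
  have "0 < 1 / (2 * A * \<rho>)" using A \<rho> by simp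
  then have "1 / (2 * A * \<rho>) < real T" "2 < real T" using T' by linarith+
  then have T: "1 / (2 * A * \<rho>) < real T" "2 \<le> T" "0 < T" by auto
  note T0 = T(3)
  have T1: "1 / (2 * A) / real T \<le> \<rho>"
    using T(1) A \<rho> T0 by (simp add: field_simps)
  \<comment> \<open>Preimages of distinct nodes are at least \<open>c0 * (1/2) ^ l / l\<close>
    apart: the spacing in the worst case \<open>(1/2) ^ l = |\<alpha>|\<close> times the lower slope
    of \<open>tanh\<close>.\<close>
  define c0 where "c0 = (1 - r\<^sup>2) / (2 * A * real T * real K)"
  have "r\<^sup>2 < 1" using r by (simp add: abs_square_less_1)
  then have c0: "0 < c0" using A T0 K by (simp add: c0_def)
  obtain D0 where D0: "(1/2) ^ D0 \<le> min c0 r" using half_power_le[of "min c0 r"] c0 r by auto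
  \<comment> \<open>In \<open>\<delta> = (1/2) ^ (D' * l)\<close> the part \<open>D0\<close> absorbs
    \<open>c0\<close> and \<open>r\<close>, the other two powers absorb \<open>(1/2) ^ l\<close> and
    \<open>1 / l\<close>. The last 1 in \<open>D\<close> pays for the factor 2 of the noise
    term.\<close>
  define D' where "D' = D0 + 2"
  define D where "D = (D' + 1) * K + 1"
  have main: "norm (F (of_real t)) \<le> (1/2) ^ (k * l) * B + 2 ^ (D * l\<^sup>2) * \<eta>"
    if l: "1 \<le> l" and hol: "F holomorphic_on rectangle \<sigma>"
      and B: "\<And>z. z \<in> rectangle \<sigma> \<Longrightarrow> norm (F z) \<le> B"
      and \<alpha>: "(1/2) ^ l \<le> \<bar>\<alpha>\<bar>" "\<bar>\<alpha>\<bar> \<le> 1"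
      and \<eta>: "\<And>j. j < K * l \<Longrightarrow> norm (F (of_real (real j / real (T * (K * l)) * \<alpha>))) \<le> \<eta>"
      and t: "\<bar>t\<bar> \<le> 1" for l \<alpha> F B \<eta> t
  proof -
    define M where "M = K * l"
    have M: "0 < M" using K l by (simp add: M_def)
    define x where "x j = real j / real (T * M) * \<alpha> / (2 * A)" for j
    define ps where "ps = map (\<lambda>j. (complex_of_real (tanh (x j)), 0::complex)) [0..<M]"
    define \<delta> where "\<delta> = (1/2 :: real) ^ (D' * l)"
    define G where "G = F \<circ> strip_map A"
    have sub: "strip_map A ` cball 0 R \<subseteq> rectangle \<sigma>"
    proof
      fix z assume "z \<in> strip_map A ` cball 0 R"
      then obtain w where w: "norm w \<le> R" "z = strip_map A w" by auto
      have "\<bar>Re z\<bar> \<le> 1 + \<sigma>" using w strip_map_Re[of w "1 + \<sigma>" A] A by (simp add: R_def)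
      moreover have "\<bar>Im z\<bar> \<le> \<sigma>" using w strip_map_Im[of w A] A r by (simp add: A_def)
      ultimately show "z \<in> rectangle \<sigma>" by (simp add: rectangle_def)
    qed
    have x: "\<bar>x j\<bar> \<le> 1 / (2 * A) / real T" if "j < M" for j
    proof -
      have "real j / real (T * M) \<le> 1 / real T"
        using that T0 M by (simp add: field_simps)
      then have "real j / real (T * M) * \<bar>\<alpha>\<bar> \<le> 1 / real T * 1"
        using \<alpha> by (intro mult_mono) auto
      then have "real j / real (T * M) * \<bar>\<alpha>\<bar> / (2 * A) \<le> 1 / real T * 1 / (2 * A)"
        using A by (intro divide_right_mono) auto
      then show ?thesis using A by (simp add: x_def abs_mult mult.commute)
    qed
    have x1: "\<bar>x j\<bar> \<le> 1 / (2 * A)" if "j < M" for j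
    proof -
      have "1 / (2 * A) / real T \<le> 1 / (2 * A) / 1" using T0 A by (intro divide_left_mono) auto
      then show ?thesis using x[OF that] by simp
    qed
    have \<delta>0: "0 < \<delta>" by (simp add: \<delta>_def)
    have \<delta>1: "\<delta> \<le> r" "\<delta> \<le> c0 * (1/2) ^ l / real l"
    proof -
      have "(1/2 :: real) ^ (D0 * l) \<le> (1/2) ^ D0" using l by (intro power_decreasing) auto
      then have a: "(1/2 :: real) ^ (D0 * l) \<le> min c0 r" using D0 by linarith
      have e: "\<delta> = (1/2 :: real) ^ (D0 * l) * ((1/2) ^ l * (1/2) ^ l)"
        by (simp add: \<delta>_def D'_def power_add[symmetric] algebra_simps)
      have "real l < 2 ^ l" by (rule of_nat_less_two_power)
      then have "(1/2 :: real) ^ l \<le> 1 / real l" using l by (simp add: power_one_over field_simps)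
      then have "\<delta> \<le> c0 * ((1/2) ^ l * (1 / real l))"
        unfolding e using a c0 by (intro mult_mono) auto
      then show "\<delta> \<le> c0 * (1/2) ^ l / real l" by simp
      have "(1/2 :: real) ^ l * (1/2) ^ l \<le> 1 * 1" by (intro mult_mono power_le_one) auto
      then have "\<delta> \<le> r * 1" unfolding e using a r by (intro mult_mono) auto
      then show "\<delta> \<le> r" by simp
    qed
    define w where "w = complex_of_real (tanh (t / (2 * A)))"
    have wr: "norm w \<le> r"
    proof -
      have "\<bar>t\<bar> / (2 * A) \<le> 1 / (2 * A)" using t A by (intro divide_right_mono) auto
      then have "tanh (\<bar>t\<bar> / (2 * A)) \<le> r" by (simp add: r_def)
      moreover have "\<bar>tanh (t / (2 * A))\<bar> = tanh (\<bar>t\<bar> / (2 * A))"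
        using A by (subst tanh_real_abs[symmetric]) (simp add: abs_divide)
      ultimately show ?thesis by (simp add: w_def)
    qed
    have \<eta>0: "0 \<le> \<eta>" using \<eta>[of 0] M norm_ge_zero order_trans unfolding M_def by blast
    have q': "1 * (r + \<rho>) / (R - \<rho>) = q" by (simp add: q_def)
    have "norm (G w - newton ps w) \<le> (1 * (r + \<rho>) / (R - \<rho>)) ^ length ps * B
      + 2 * ((2 * (r + \<rho>) / \<delta>) ^ length ps - 1) * \<eta>"
    proof (rule newton_error)
      show "G holomorphic_on cball 0 R"
        unfolding G_def
      proof (rule holomorphic_on_compose_gen[OF _ hol sub])
        show "strip_map A holomorphic_on cball 0 R"
          using strip_map_holomorphic by (rule holomorphic_on_subset) (use r in auto)
      qed
      show "norm (G z) \<le> B" if "z \<in> cball 0 R" for z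
        using B[of "strip_map A z"] sub that by (auto simp: G_def image_subset_iff)
      show "norm u \<le> \<rho> \<and> norm (G u - y) \<le> \<eta>" if uy: "(u, y) \<in> set ps" for u y
      proof -
        from uy obtain j where j: "j < M" "u = of_real (tanh (x j))" "y = 0" by (auto simp: ps_def)
        have "\<bar>tanh (x j) - tanh 0\<bar> \<le> \<bar>x j - 0\<bar>" by (rule tanh_diff_bounds[of _ "\<bar>x j\<bar>"]) auto
        then have "norm u \<le> \<rho>" using x[OF j(1)] T1 j(2) by simp
        moreover have "G u = F (of_real (real j / real (T * M) * \<alpha>))"
          unfolding G_def o_def j(2) x_def by (subst strip_map_tanh[OF A]) simp
        ultimately show ?thesis using \<eta>[of j] j by (simp add: M_def)
      qed
      show "sorted_wrt (\<lambda>p p'. \<delta> \<le> norm (fst p - fst p')) ps"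
      proof (subst sorted_wrt_iff_nth_less, intro allI impI)
        fix i j assume ij: "i < j" "j < length ps"
        then have jM: "j < M" by (simp add: ps_def)
        have "x j - x i = (real j - real i) / real (T * M) * \<alpha> / (2 * A)"
          by (simp add: x_def diff_divide_distrib left_diff_distrib)
        then have "\<bar>x i - x j\<bar> = (real j - real i) / real (T * M) * \<bar>\<alpha>\<bar> / (2 * A)"
          using A ij by (subst abs_minus_commute) (simp add: abs_mult)
        also have "\<dots> \<ge> 1 / real (T * M) * (1/2) ^ l / (2 * A)"
          using ij \<alpha> A by (intro divide_right_mono mult_mono) auto
        finally have "(1 - r\<^sup>2) * (1 / real (T * M) * (1/2) ^ l / (2 * A)) \<le> (1 - r\<^sup>2) * \<bar>x i - x j\<bar>"
          using \<open>r\<^sup>2 < 1\<close> by (intro mult_left_mono) auto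
        also have "\<dots> \<le> \<bar>tanh (x i) - tanh (x j)\<bar>"
          unfolding r_def by (rule tanh_diff_bounds) (use x1 ij jM in auto)
        also have "(1 - r\<^sup>2) * (1 / real (T * M) * (1/2) ^ l / (2 * A)) = c0 * (1/2) ^ l / real l"
          by (simp add: c0_def M_def)
        finally have "\<delta> \<le> \<bar>tanh (x i) - tanh (x j)\<bar>" using \<delta>1 by linarith
        moreover have "norm (complex_of_real (tanh (x i)) - complex_of_real (tanh (x j)))
            = \<bar>tanh (x i) - tanh (x j)\<bar>" by (metis norm_of_real of_real_diff)
        ultimately show "\<delta> \<le> norm (fst (ps ! i) - fst (ps ! j))"
          using ij jM by (simp add: ps_def)
      qed
      show "2 \<le> (1::real) \<or> 1 = (1::real) \<and> (\<forall>p\<in>set ps. snd p = 0)" by (auto simp: ps_def)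
      have "1 \<le> (r + \<rho>) / \<delta>" using \<delta>1 \<delta>0 \<rho> by simp
      then have "2 \<le> 2 * ((r + \<rho>) / \<delta>)" by linarith
      then show "2 \<le> 2 * (r + \<rho>) / \<delta>" by (simp only: times_divide_eq_right)
      show "1 * (r + \<rho>) / (R - \<rho>) \<le> 1" unfolding q' using q by simp
      show "\<rho> < R" using r by (simp add: \<rho>_def)
    qed (use r \<rho> \<delta>0 wr \<eta>0 in auto)
    moreover have "newton ps w = 0" by (rule newton_zero) (auto simp: ps_def)
    moreover have "G w = F (of_real t)" unfolding G_def w_def o_def by (subst strip_map_tanh[OF A]) simp
    ultimately have 1: "norm (F (of_real t)) \<le> q ^ M * B + 2 * ((2 * (r + \<rho>) / \<delta>) ^ M - 1) * \<eta>"
      unfolding q' by (simp add: ps_def)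
    have "(0::complex) \<in> rectangle \<sigma>" using assms by (simp add: rectangle_def)
    then have B0: "0 \<le> B" using B norm_ge_zero order_trans by blast
    have "q ^ M = (q ^ K) ^ l" by (simp add: M_def power_mult)
    also have "\<dots> \<le> ((1/2) ^ k) ^ l" using K q by (intro power_mono) auto
    finally have 2: "q ^ M * B \<le> (1/2) ^ (k * l) * B" using B0 by (intro mult_right_mono) (auto simp: power_mult)
    have "r + \<rho> \<le> 1" unfolding \<rho>_def using r by (simp add: field_simps)
    then have "2 * (r + \<rho>) / \<delta> \<le> 2 * 1 / \<delta>" using \<delta>0 by (intro divide_right_mono mult_left_mono) auto
    also have "\<dots> = 2 ^ (D' * l + 1)" by (simp add: \<delta>_def power_one_over field_simps)
    also have "\<dots> \<le> 2 ^ ((D' + 1) * l)" using l by (intro power_increasing) auto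
    finally have "(2 * (r + \<rho>) / \<delta>) ^ M \<le> (2 ^ ((D' + 1) * l)) ^ M"
      using r \<rho> \<delta>0 by (intro power_mono) auto
    also have "\<dots> = 2 ^ ((D' + 1) * K * l\<^sup>2)"
      by (simp add: M_def power_mult[symmetric] power2_eq_square algebra_simps)
    finally have "2 * ((2 * (r + \<rho>) / \<delta>) ^ M - 1) \<le> 2 ^ ((D' + 1) * K * l\<^sup>2 + 1)" by simp
    also have "\<dots> \<le> 2 ^ (D * l\<^sup>2)" unfolding D_def using l
      by (intro power_increasing) (auto simp: algebra_simps)
    finally have "2 * ((2 * (r + \<rho>) / \<delta>) ^ M - 1) * \<eta> \<le> 2 ^ (D * l\<^sup>2) * \<eta>"
      using \<eta>0 by (rule mult_right_mono)
    then show ?thesis using 1 2 by linarith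
  qed
  show ?thesis
  proof (rule exI[of _ T], rule conjI[OF T(2)], rule exI[of _ K], rule conjI[OF K(1)], rule exI[of _ D],
      intro allI impI)
    fix l and \<alpha> B \<eta> t :: real and F :: "complex \<Rightarrow> complex"
    assume "1 \<le> l" "F holomorphic_on rectangle \<sigma>" "\<forall>z\<in>rectangle \<sigma>. norm (F z) \<le> B"
      "(1/2) ^ l \<le> \<bar>\<alpha>\<bar>" "\<bar>\<alpha>\<bar> \<le> 1" "\<bar>t\<bar> \<le> 1"
      "\<forall>j<K * l. norm (F (of_real (real j / real (T * (K * l)) * \<alpha>))) \<le> \<eta>"
    then show "norm (F (of_real t)) \<le> (1/2) ^ (k * l) * B + 2 ^ (D * l\<^sup>2) * \<eta>"
      using main[of l F B \<alpha> \<eta> t] by simp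
  qed
qed

section \<open>Estimates in the class H\<close>

lemma cball_subset_rectangle:
  assumes "z \<in> rectangle \<sigma>" shows "cball z \<sigma> \<subseteq> rectangle (2 * \<sigma>)"
proof
  fix w assume "w \<in> cball z \<sigma>"
  then have "norm (w - z) \<le> \<sigma>" by (simp add: dist_norm norm_minus_commute)
  then have "\<bar>Re (w - z)\<bar> \<le> \<sigma>" "\<bar>Im (w - z)\<bar> \<le> \<sigma>"
    using abs_Re_le_cmod[of "w - z"] abs_Im_le_cmod[of "w - z"] by linarith+
  then show "w \<in> rectangle (2 * \<sigma>)" using assms by (auto simp: rectangle_def)
qed

text \<open>Each point of the inner rectangle is the centre of a disc of radius
  \<open>\<sigma>\<close> inside the outer one, so Cauchy's inequality applies. Used twice, it
  controls the first and the second derivative of a function in \<open>H\<close>.\<close>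

lemma deriv_on_rectangle:
  assumes "0 < \<sigma>" "F holomorphic_on rectangle (2 * \<sigma>)"
    and B: "\<And>z. z \<in> rectangle (2 * \<sigma>) \<Longrightarrow> norm (F z) \<le> B"
  shows "deriv F holomorphic_on rectangle \<sigma>"
    and "\<And>z. z \<in> rectangle \<sigma> \<Longrightarrow> norm (deriv F z) \<le> B / \<sigma>"
    and "\<And>z. z \<in> rectangle \<sigma> \<Longrightarrow> (F has_field_derivative deriv F z) (at z)"
proof -
  define U where "U = interior (rectangle (2 * \<sigma>))"
  have U: "open U" "rectangle \<sigma> \<subseteq> U"
  proof -
    show "rectangle \<sigma> \<subseteq> U"
    proof
      fix z assume "z \<in> rectangle \<sigma>"
      then have "cball z \<sigma> \<subseteq> rectangle (2 * \<sigma>)" by (rule cball_subset_rectangle)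
      then show "z \<in> U" unfolding U_def mem_interior_cball using assms(1) by blast
    qed
  qed (simp add: U_def)
  have FU: "F holomorphic_on U"
    using assms(2) by (rule holomorphic_on_subset) (simp add: U_def interior_subset)
  show "deriv F holomorphic_on rectangle \<sigma>"
    using holomorphic_deriv[OF FU U(1)] U(2) by (rule holomorphic_on_subset)
  fix z assume z: "z \<in> rectangle \<sigma>"
  show "(F has_field_derivative deriv F z) (at z)"
    using holomorphic_derivI[OF FU U(1)] U(2) z by blast
  have sub: "cball z \<sigma> \<subseteq> rectangle (2 * \<sigma>)" using z by (rule cball_subset_rectangle)
  have hol: "F holomorphic_on cball z \<sigma>" using assms(2) sub by (rule holomorphic_on_subset)
  have "norm ((deriv ^^ 1) F z) \<le> fact 1 * B / \<sigma> ^ 1"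
  proof (rule Cauchy_inequality)
    show "F holomorphic_on ball z \<sigma>" using hol by (rule holomorphic_on_subset) auto
    show "continuous_on (cball z \<sigma>) F" using hol by (rule holomorphic_on_imp_continuous_on)
    show "norm (F x) \<le> B" if "norm (z - x) = \<sigma>" for x
      by (rule B) (use sub that in \<open>auto simp: dist_norm\<close>)
  qed (rule assms(1))
  then show "norm (deriv F z) \<le> B / \<sigma>" by simp
qed

lemma convex_rectangle: "convex (rectangle \<sigma>)"
proof -
  have "rectangle \<sigma> = {z. Re z \<le> 1 + \<sigma>} \<inter> {z. - (1 + \<sigma>) \<le> Re z} \<inter> {z. Im z \<le> \<sigma>} \<inter> {z. - \<sigma> \<le> Im z}"
    by (auto simp: rectangle_def)
  then show ?thesis
    by (simp only:) (intro convex_Int convex_halfspace_Re_le convex_halfspace_Re_ge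
        convex_halfspace_Im_le convex_halfspace_Im_ge)
qed

lemma H_deriv:
  assumes "\<phi> \<in> H \<sigma> Q" "0 < \<sigma>"
  shows "deriv \<phi> holomorphic_on rectangle (\<sigma> / 2)"
    and "\<And>z. z \<in> rectangle (\<sigma> / 2) \<Longrightarrow> norm (deriv \<phi> z) \<le> 2 * Q / \<sigma>"
    and "\<And>z. z \<in> rectangle (\<sigma> / 2) \<Longrightarrow> (\<phi> has_field_derivative deriv \<phi> z) (at z)"
  using deriv_on_rectangle[of "\<sigma> / 2" \<phi> Q] assms
  by (auto simp: H_def analytic_imp_holomorphic mult.commute)

lemma of_real_in_rectangle: "\<bar>t\<bar> \<le> 1 \<Longrightarrow> 0 \<le> \<sigma> \<Longrightarrow> complex_of_real t \<in> rectangle \<sigma>"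
  by (auto simp: rectangle_def)

text \<open>The constant comes from two Cauchy estimates: \<open>2 * Q / \<sigma>\<close> for the
  derivative on \<open>rectangle (\<sigma> / 2)\<close>, then division by
  \<open>\<sigma> / 4\<close>.\<close>

lemma H_taylor:
  assumes "\<phi> \<in> H \<sigma> Q" "0 < \<sigma>" "\<bar>s\<bar> \<le> 1" "\<bar>t\<bar> \<le> 1"
  shows "norm (\<phi> (of_real t) - \<phi> (of_real s) - deriv \<phi> (of_real s) * of_real (t - s))
    \<le> Q * (8 / \<sigma>\<^sup>2) * (t - s)\<^sup>2"
proof -
  let ?S = "rectangle (\<sigma> / 4)"
  have sub: "?S \<subseteq> rectangle (\<sigma> / 2)" using assms(2) by (auto simp: rectangle_def)
  note d1 = H_deriv[OF assms(1,2)]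
  have d2: "norm (deriv (deriv \<phi>) z) \<le> 8 * Q / \<sigma>\<^sup>2"
    "(deriv \<phi> has_field_derivative deriv (deriv \<phi>) z) (at z)" if "z \<in> ?S" for z
    using deriv_on_rectangle(2,3)[of "\<sigma> / 4" "deriv \<phi>" "2 * Q / \<sigma>" z] d1 that assms(2)
    by (auto simp: power2_eq_square)
  let ?f = "\<lambda>i::nat. if i = 0 then \<phi> else if i = 1 then deriv \<phi> else deriv (deriv \<phi>)"
  have "norm (?f 0 (of_real t) - (\<Sum>i\<le>1. ?f i (of_real s) * (of_real t - of_real s) ^ i / fact i))
    \<le> 8 * Q / \<sigma>\<^sup>2 * norm (complex_of_real t - of_real s) ^ (Suc 1) / fact 1"
  proof (rule complex_Taylor[of ?S])
    show "convex ?S" by (rule convex_rectangle)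
    show "(?f i has_field_derivative ?f (Suc i) x) (at x within ?S)" if "x \<in> ?S" "i \<le> 1" for i x
    proof -
      have "i = 0 \<or> i = 1" using that by auto
      then show ?thesis
        using d1(3)[of x] d2(2)[of x] sub that by (auto intro: has_field_derivative_at_within)
    qed
    show "norm (?f (Suc 1) x) \<le> 8 * Q / \<sigma>\<^sup>2" if "x \<in> ?S" for x using d2(1)[OF that] by simp
  qed (use assms in \<open>auto intro: of_real_in_rectangle\<close>)
  moreover have "norm (complex_of_real t - of_real s) = \<bar>t - s\<bar>" by (metis norm_of_real of_real_diff)
  ultimately show ?thesis
    by (simp add: power2_eq_square algebra_simps)
qed

text \<open>The bound on the derivative is asked on the segment only, because for a nearly constant
  profile that is where it is known to be tiny.\<close>

lemma H_lipschitz: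
  assumes "\<phi> \<in> H \<sigma> Q" "0 < \<sigma>" "\<bar>s\<bar> \<le> 1" "\<bar>t\<bar> \<le> 1"
    and B: "\<And>x. \<bar>x\<bar> \<le> 1 \<Longrightarrow> norm (deriv \<phi> (of_real x)) \<le> B"
  shows "norm (\<phi> (of_real t) - \<phi> (of_real s)) \<le> B * \<bar>t - s\<bar>"
proof -
  let ?S = "complex_of_real ` {-1..1}"
  have "norm (\<phi> (of_real t) - \<phi> (of_real s)) \<le> B * norm (complex_of_real t - of_real s)"
  proof (rule field_differentiable_bound[of ?S])
    show "convex ?S"
      by (intro convex_linear_image bounded_linear.linear[OF bounded_linear_of_real]) simp
    show "(\<phi> has_field_derivative deriv \<phi> z) (at z within ?S)" if "z \<in> ?S" for z
    proof -
      have "z \<in> rectangle (\<sigma> / 2)" using that assms(2) by (auto simp: rectangle_def)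
      then show ?thesis using H_deriv(3)[OF assms(1,2)] has_field_derivative_at_within by blast
    qed
    show "norm (deriv \<phi> z) \<le> B" if "z \<in> ?S" for z using that B by auto
  qed (use assms(3,4) in \<open>auto simp: abs_le_iff intro!: imageI\<close>)
  also have "norm (complex_of_real t - of_real s) = \<bar>t - s\<bar>" by (metis norm_of_real of_real_diff)
  finally show ?thesis .
qed

text \<open>The program interpolates in real arithmetic, while the error estimate lives in the
  complex plane.\<close>

lemma newton_of_real:
  "newton (map (\<lambda>(u, y). (of_real u, of_real y)) ps) (of_real w)
    = (of_real (newton ps w) :: 'a :: real_field)"
proof (induction ps w rule: newton.induct)
  case (2 u y ps w)
  have "map (\<lambda>(v, z). (v, (z - of_real y) / (v - of_real u)))
      (map (\<lambda>(u, y). (of_real u, of_real y :: 'a)) ps)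
    = map (\<lambda>(u, y). (of_real u, of_real y)) (map (\<lambda>(v, z). (v, (z - y) / (v - u))) ps)"
    by (simp add: comp_def case_prod_beta)
  then show ?case using 2 by (simp del: map_map)
qed simp

text \<open>Write the argument as \<open>c * (-1 + 2 * (b + v) / N)\<close>. In \<open>v\<close> the
  nodes are \<open>0, ..., m - 1\<close>, and the disc of radius \<open>\<sigma> * N / 2\<close>
  goes into the rectangle since \<open>|c| \<le> 1\<close>. Then \<open>newton_error\<close> applies
  with its factor 2, both inner radii \<open>m\<close> and gap 1;
  \<open>5 * m \<le> \<sigma> * N / 2\<close> makes the ratio at most 1. The evaluation point may
  lie one step beyond the last node.\<close>

lemma interpolation_error:
  fixes m N b :: nat and y :: "nat \<Rightarrow> real"
  assumes \<phi>: "\<phi> \<in> H \<sigma> Q" and "0 < \<sigma>" "0 < m" "\<bar>c\<bar> \<le> 1"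
    and b: "b + m \<le> N" "real b \<le> u" "u \<le> real (b + m)"
    and y: "\<And>j. j < m \<Longrightarrow> norm (\<phi> (of_real (c * (-1 + 2 * real (b + j) / real N))) - of_real (y j)) \<le> \<epsilon>"
    and N: "5 * real m \<le> \<sigma> * real N / 2"
  shows "norm (\<phi> (of_real (c * (-1 + 2 * u / real N)))
      - of_real (newton (map (\<lambda>j. (real j, y j)) [0..<m]) (u - real b)))
    \<le> (4 * real m / (\<sigma> * real N / 2 - real m)) ^ m * Q + 2 * (4 * real m) ^ m * \<epsilon>"
proof -
  define R where "R = \<sigma> * real N / 2"
  define L where "L = (\<lambda>v. complex_of_real c * (-1 + 2 * (of_real (real b) + v) / of_real (real N)))"
  define ps where "ps = map (\<lambda>j. (complex_of_real (real j), complex_of_real (y j))) [0..<m]"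
  have N0: "0 < N" using assms(3) b by simp
  have R: "5 * real m \<le> R" "0 < real m" "1 \<le> real m" using N assms(3) by (auto simp: R_def)
  have L: "L z \<in> rectangle \<sigma>" if "norm z \<le> R" for z
  proof -
    have z: "\<bar>Re z\<bar> \<le> R" "\<bar>Im z\<bar> \<le> R"
      using that abs_Re_le_cmod[of z] abs_Im_le_cmod[of z] by linarith+
    have Lz: "L z = of_real (c * (-1 + 2 * real b / real N)) + of_real (2 * c / real N) * z"
      by (simp add: L_def add_divide_distrib algebra_simps)
    have c2: "\<bar>2 * c / real N\<bar> * x \<le> \<sigma>" if "0 \<le> x" "x \<le> R" for x
    proof -
      have "\<bar>2 * c / real N\<bar> * x \<le> (2 * 1 / real N) * R"
        using that assms(4) by (intro mult_mono) (auto simp: abs_mult divide_right_mono)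
      also have "\<dots> = \<sigma>" using N0 by (simp add: R_def)
      finally show ?thesis .
    qed
    have "real b / real N \<le> 1" "0 \<le> real b / real N" using b N0 by auto
    then have "\<bar>-1 + 2 * real b / real N\<bar> \<le> 1" by (simp add: abs_le_iff)
    then have "\<bar>c\<bar> * \<bar>-1 + 2 * real b / real N\<bar> \<le> 1 * 1"
      using assms(4) by (intro mult_mono) auto
    then have c1: "\<bar>c * (-1 + 2 * real b / real N)\<bar> \<le> 1" by (simp only: abs_mult mult_1)
    have "Re (L z) = c * (-1 + 2 * real b / real N) + 2 * c / real N * Re z"
      "Im (L z) = 2 * c / real N * Im z"
      unfolding Lz by (auto simp del: of_real_mult of_real_add of_real_divide)
    moreover have "\<bar>2 * c / real N * Re z\<bar> \<le> \<sigma>" "\<bar>2 * c / real N * Im z\<bar> \<le> \<sigma>"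
      using c2[OF abs_ge_zero z(1)] c2[OF abs_ge_zero z(2)] by (simp_all only: abs_mult)
    ultimately have "\<bar>Re (L z)\<bar> \<le> 1 + \<sigma>" "\<bar>Im (L z)\<bar> \<le> \<sigma>" using c1 by linarith+
    then show ?thesis by (simp add: rectangle_def)
  qed
  have hol: "\<phi> holomorphic_on rectangle \<sigma>" "\<And>z. z \<in> rectangle \<sigma> \<Longrightarrow> norm (\<phi> z) \<le> Q"
    using \<phi> by (auto simp: H_def analytic_imp_holomorphic)
  have "norm ((\<phi> \<circ> L) (of_real (u - real b)) - newton ps (of_real (u - real b)))
    \<le> (2 * (real m + real m) / (R - real m)) ^ length ps * Q
      + 2 * ((2 * (real m + real m) / 1) ^ length ps - 1) * \<epsilon>"
  proof (rule newton_error)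
    show "(\<phi> \<circ> L) holomorphic_on cball 0 R"
    proof (rule holomorphic_on_compose_gen[OF _ hol(1)])
      show "L holomorphic_on cball 0 R" unfolding L_def
        using N0 by (intro holomorphic_intros) auto
    qed (use L in auto)
    show "norm ((\<phi> \<circ> L) z) \<le> Q" if "z \<in> cball 0 R" for z using L hol(2) that by simp
    show "norm v \<le> real m \<and> norm ((\<phi> \<circ> L) v - x) \<le> \<epsilon>" if vx: "(v, x) \<in> set ps" for v x
    proof -
      from vx obtain j where j: "j < m" "v = of_real (real j)" "x = of_real (y j)"
        by (auto simp: ps_def)
      have "L v = of_real (c * (-1 + 2 * real (b + j) / real N))" by (simp add: L_def j(2))
      then show ?thesis using y[OF j(1)] j by simp
    qed
    show "sorted_wrt (\<lambda>p p'. 1 \<le> norm (fst p - fst p')) ps"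
    proof (subst sorted_wrt_iff_nth_less, intro allI impI)
      fix i j assume ij: "i < j" "j < length ps"
      have "norm (complex_of_real (real i) - of_real (real j)) = \<bar>real i - real j\<bar>"
        by (metis norm_of_real of_real_diff)
      then show "1 \<le> norm (fst (ps ! i) - fst (ps ! j))" using ij by (simp add: ps_def)
    qed
    show "norm (complex_of_real (u - real b)) \<le> real m" unfolding norm_of_real using b by simp
    show "2 * (real m + real m) / (R - real m) \<le> 1" using R by simp
    show "0 \<le> \<epsilon>" using y[of 0] assms(3) norm_ge_zero order_trans by blast
  qed (use R in auto)
  moreover have "(\<phi> \<circ> L) (of_real (u - real b)) = \<phi> (of_real (c * (-1 + 2 * u / real N)))"
    by (simp add: L_def)
  moreover have "newton ps (of_real (u - real b))
      = of_real (newton (map (\<lambda>j. (real j, y j)) [0..<m]) (u - real b))"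
    by (subst newton_of_real[symmetric]) (simp add: ps_def comp_def)
  moreover have "0 \<le> \<epsilon>" using y[of 0] assms(3) norm_ge_zero order_trans by blast
  ultimately show ?thesis by (simp add: ps_def R_def algebra_simps)
qed

section \<open>Recovery of the direction\<close>

text \<open>Among the multiples of a unit vector \<open>v\<close>, the orthogonal projection is
  closest to \<open>a\<close>. Hence neither the length nor the sign of an approximate direction has
  to be known.\<close>

lemma projection_le:
  fixes a v :: "'i \<Rightarrow> real"
  assumes "L2_set a I = 1" "L2_set v I = 1"
  shows "L2_set (\<lambda>i. (\<Sum>j\<in>I. a j * v j) * v i - a i) I \<le> L2_set (\<lambda>i. s * v i - a i) I"
proof -
  define c where "c = (\<Sum>j\<in>I. a j * v j)"
  have 1: "(\<Sum>i\<in>I. (a i)\<^sup>2) = 1" "(\<Sum>i\<in>I. (v i)\<^sup>2) = 1" using assms by (auto simp: L2_set_def)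
  have *: "(\<Sum>i\<in>I. (x * v i - a i)\<^sup>2) = (x - c)\<^sup>2 + (1 - c\<^sup>2)" for x
  proof -
    have "(x * v i - a i)\<^sup>2 = x\<^sup>2 * (v i)\<^sup>2 - 2 * x * (a i * v i) + (a i)\<^sup>2" for i
      by (simp add: power2_eq_square algebra_simps)
    then have "(\<Sum>i\<in>I. (x * v i - a i)\<^sup>2) = x\<^sup>2 * (\<Sum>i\<in>I. (v i)\<^sup>2) - 2 * x * c + (\<Sum>i\<in>I. (a i)\<^sup>2)"
      by (simp add: sum.distrib sum_subtractf sum_distrib_left c_def)
    then show ?thesis unfolding 1 by (simp add: power2_eq_square algebra_simps)
  qed
  show ?thesis unfolding L2_set_def c_def[symmetric]
    by (rule real_sqrt_le_mono) (simp add: *)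
qed

text \<open>Otherwise the squares would sum to at most
  \<open>n * (1/2) ^ (2 * l) \<le> (1/2) ^ l\<close>, which is below 1 because
  \<open>1 \<le> l\<close>.\<close>

lemma exists_large_component:
  fixes a :: "nat \<Rightarrow> real"
  assumes "L2_set a {..<n} = 1" "n \<le> 2 ^ l" "1 \<le> l"
  shows "\<exists>i<n. (1/2) ^ l \<le> \<bar>a i\<bar>"
proof (rule ccontr)
  assume "\<not> ?thesis"
  then have small: "\<bar>a i\<bar> \<le> (1/2) ^ l" if "i < n" for i using that by (auto simp: not_le intro: less_imp_le)
  have "(\<Sum>i<n. (a i)\<^sup>2) \<le> (\<Sum>i<n. ((1/2) ^ l)\<^sup>2)"
    by (rule sum_mono) (metis small lessThan_iff power2_abs power_mono abs_ge_zero)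
  also have "\<dots> = real n * (1/2) ^ l * (1/2) ^ l" by (simp add: power2_eq_square)
  also have "\<dots> \<le> 2 ^ l * (1/2) ^ l * (1/2) ^ l"
  proof -
    have "real n \<le> 2 ^ l" using assms(2) by (metis of_nat_le_iff of_nat_numeral of_nat_power)
    then show ?thesis by (intro mult_right_mono) auto
  qed
  also have "\<dots> = (1/2) ^ l" by (simp add: power_one_over)
  also have "\<dots> \<le> (1/2) ^ 1" using assms(3) by (intro power_decreasing) auto
  finally have "(\<Sum>i<n. (a i)\<^sup>2) < 1" by simp
  moreover have "(\<Sum>i<n. (a i)\<^sup>2) = 1" using assms(1) by (simp add: L2_set_def)
  ultimately show False by simp
qed

text \<open>By \<open>projection_le\<close> the projection onto \<open>v\<close> is at least as
  close to \<open>a\<close> as \<open>d / \<mu>\<close>, which removes the unknown scale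
  \<open>\<mu>\<close>. The factor \<open>n\<close> comes from bounding the norm by the sum of
  absolute values.\<close>

lemma direction_estimate:
  fixes a d :: "nat \<Rightarrow> real"
  assumes a: "L2_set a {..<n} = 1" and \<mu>: "\<mu> \<noteq> 0"
    and e: "\<And>i. i < n \<Longrightarrow> \<bar>d i / \<mu> - a i\<bar> \<le> \<beta>"
  defines "v \<equiv> \<lambda>i. d i / sqrt (\<Sum>k<n. (d k)\<^sup>2)"
  shows "L2_set (\<lambda>i. (\<Sum>j<n. a j * v j) * v i - a i) {..<n} \<le> real n * \<beta>"
proof -
  define S where "S = sqrt (\<Sum>k<n. (d k)\<^sup>2)"
  have v: "v i = d i / S" for i by (simp add: v_def S_def)
  have "L2_set (\<lambda>i. (\<Sum>j<n. a j * v j) * v i - a i) {..<n} \<le> L2_set (\<lambda>i. d i / \<mu> - a i) {..<n}"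
  proof (cases "S = 0")
    \<comment> \<open>Here \<open>d\<close> vanishes, and so does \<open>v\<close> because of
      \<open>x / 0 = 0\<close>; both sides are the norm of \<open>a\<close>.\<close>
    case True
    then have "\<forall>k<n. d k = 0" unfolding S_def by (simp add: sum_nonneg_eq_0_iff)
    then have "L2_set (\<lambda>i. (\<Sum>j<n. a j * v j) * v i - a i) {..<n} = L2_set (\<lambda>i. d i / \<mu> - a i) {..<n}"
      by (intro L2_set_cong) (auto simp: v)
    then show ?thesis by simp
  next
    case False
    have S0: "0 < S" using False by (simp add: S_def sum_nonneg order_less_le)
    have "(\<Sum>i<n. (v i)\<^sup>2) = (\<Sum>k<n. (d k)\<^sup>2) / S\<^sup>2"
      by (simp add: v power_divide sum_divide_distrib)
    also have "\<dots> = 1" using False by (simp add: S_def sum_nonneg)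
    finally have "L2_set v {..<n} = 1" by (simp add: L2_set_def)
    from projection_le[OF a this, of "S / \<mu>"] show ?thesis using S0 by (simp add: v)
  qed
  also have "\<dots> \<le> (\<Sum>i<n. \<bar>d i / \<mu> - a i\<bar>)" by (rule L2_set_le_sum_abs)
  also have "\<dots> \<le> (\<Sum>i<n. \<beta>)" by (intro sum_mono e) auto
  finally show ?thesis by simp
qed

lemma abs_inner_le:
  fixes a x :: "'i \<Rightarrow> real"
  assumes "L2_set x I \<le> 1" shows "\<bar>\<Sum>i\<in>I. a i * x i\<bar> \<le> L2_set a I"
proof -
  have "\<bar>\<Sum>i\<in>I. a i * x i\<bar> \<le> (\<Sum>i\<in>I. \<bar>a i\<bar> * \<bar>x i\<bar>)"
    using sum_abs[of "\<lambda>i. a i * x i" I] by (simp add: abs_mult)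
  also have "\<dots> \<le> L2_set a I * L2_set x I" by (rule L2_set_mult_ineq)
  also have "\<dots> \<le> L2_set a I * 1" using assms by (intro mult_left_mono) auto
  finally show ?thesis by simp
qed

lemma L2_set_normalized_le:
  fixes d :: "'i \<Rightarrow> real"
  shows "L2_set (\<lambda>i. d i / sqrt (\<Sum>k\<in>I. (d k)\<^sup>2)) I \<le> 1"
proof -
  have "(\<Sum>i\<in>I. (d i / sqrt (\<Sum>k\<in>I. (d k)\<^sup>2))\<^sup>2) = (\<Sum>k\<in>I. (d k)\<^sup>2) / (\<Sum>k\<in>I. (d k)\<^sup>2)"
    by (simp add: power_divide sum_divide_distrib[symmetric] sum_nonneg)
  also have "\<dots> \<le> 1" by (simp add: divide_le_eq_1)
  finally show ?thesis by (simp add: L2_set_def)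
qed

text \<open>If no difference found by the search is large, then \<open>\<phi>\<close> is almost constant;
  otherwise the differences at the chosen point are almost proportional to \<open>a\<close>.\<close>

lemma direction_recovery:
  fixes k :: nat
  assumes \<sigma>: "0 < \<sigma>"
  shows "\<exists>T\<ge>2. \<exists>K>0. \<exists>P0. \<forall>P\<ge>P0. \<forall>l\<ge>1. \<forall>(n::nat)\<le>2 ^ l. \<forall>Q>0. \<forall>\<phi>\<in>H \<sigma> Q. \<forall>a d bi bj h \<epsilon> x V.
    let p = (\<lambda>j. real j / real (T * (K * l))); \<psi> = (\<lambda>t. Re (\<phi> (of_real t)));
        v = (\<lambda>i. d i / sqrt (\<Sum>k<n. (d k)\<^sup>2)) in
    h = (1/2) ^ (P * l\<^sup>2) \<longrightarrow> \<epsilon> \<le> Q * h\<^sup>2 \<longrightarrow> L2_set a {..<n} = 1 \<longrightarrow> bi < n \<longrightarrow> bj < K * l \<longrightarrow>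
    (\<forall>i<n. \<forall>j<K * l. \<bar>\<psi> ((p j + h) * a i) - \<psi> (p j * a i)\<bar> \<le> V + 2 * \<epsilon>) \<longrightarrow>
    V \<le> \<bar>\<psi> ((p bj + h) * a bi) - \<psi> (p bj * a bi)\<bar> + 2 * \<epsilon> \<longrightarrow>
    (\<forall>i<n. \<bar>d i - (\<psi> (p bj * a bi + h * a i) - \<psi> (p bj * a bi))\<bar> \<le> 2 * \<epsilon>) \<longrightarrow>
    L2_set x {..<n} \<le> 1 \<longrightarrow>
    norm (\<phi> (of_real ((\<Sum>i<n. a i * v i) * (\<Sum>i<n. v i * x i))) - \<phi> (of_real (\<Sum>i<n. a i * x i)))
      \<le> (1/2) ^ (k * l) * Q"
proof -
  define c2 where "c2 = 8 / \<sigma>\<^sup>2"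
  have c2: "0 \<le> c2" by (simp add: c2_def)
  \<comment> \<open>\<open>k1\<close> and \<open>k2\<close> reduce the two parts of the derivative
    bound \<open>B\<close> to a quarter of \<open>(1/2) ^ (k * l) * Q\<close> each;
    \<open>k3\<close> offsets the constants lost when the direction is only approximate.\<close>
  obtain k1 where k1: "(1/2) ^ k1 \<le> \<sigma> / 8" using half_power_le[of "\<sigma> / 8"] \<sigma> by auto
  obtain k2 where k2: "(1/2) ^ k2 \<le> 1 / (4 * (5 + 2 * c2))"
    using half_power_le[of "1 / (4 * (5 + 2 * c2))"] c2 by auto
  obtain k3 where k3: "(1/2) ^ k3 \<le> \<sigma> / (2 * (c2 + 2))"
    using half_power_le[of "\<sigma> / (2 * (c2 + 2))"] c2 \<sigma> by auto
  obtain T K D where T: "2 \<le> T" and K: "0 < K" and small: "\<forall>l\<ge>1. \<forall>\<alpha> F B \<eta> t.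
    F holomorphic_on rectangle (\<sigma> / 2) \<longrightarrow> (\<forall>z\<in>rectangle (\<sigma> / 2). norm (F z) \<le> B) \<longrightarrow>
    (1/2) ^ l \<le> \<bar>\<alpha>\<bar> \<longrightarrow> \<bar>\<alpha>\<bar> \<le> 1 \<longrightarrow>
    (\<forall>j<K * l. norm (F (of_real (real j / real (T * (K * l)) * \<alpha>))) \<le> \<eta>) \<longrightarrow> \<bar>t\<bar> \<le> 1 \<longrightarrow>
    norm (F (of_real t)) \<le> (1/2) ^ ((k + k1) * l) * B + 2 ^ (D * l\<^sup>2) * \<eta>"
    using small_on_segment[of "\<sigma> / 2" "k + k1"] \<sigma> by auto
  \<comment> \<open>The summands of \<open>G\<close> let \<open>\<gamma>\<close> beat the
    amplification \<open>2 ^ (D * l\<^sup>2)\<close>, the division by a component of size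
    \<open>(1/2) ^ l\<close>, the target accuracy and a constant. Those of \<open>P0\<close> let
    \<open>h / \<gamma>\<close> beat the factor \<open>n\<close>, the target accuracy and a
    constant.\<close>
  define G where "G = D + 1 + k + k2"
  define P0 where "P0 = G + 1 + k + k3"
  have main: "norm (\<phi> (of_real ((\<Sum>i<n. a i * v i) * (\<Sum>i<n. v i * x i))) - \<phi> (of_real (\<Sum>i<n. a i * x i)))
      \<le> (1/2) ^ (k * l) * Q"
    if P: "P0 \<le> P" and l: "1 \<le> l" and n: "n \<le> 2 ^ l" and Q: "0 < Q" and \<phi>: "\<phi> \<in> H \<sigma> Q"
      and h_def: "h = (1/2) ^ (P * l\<^sup>2)" and \<epsilon>: "\<epsilon> \<le> Q * h\<^sup>2" and a: "L2_set a {..<n} = 1"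
      and bi: "bi < n" and bj: "bj < K * l"
      and p_def: "p = (\<lambda>j. real j / real (T * (K * l)))" and \<psi>_def: "\<psi> = (\<lambda>t. Re (\<phi> (of_real t)))"
      and v_def: "v = (\<lambda>i. d i / sqrt (\<Sum>k<n. (d k)\<^sup>2))"
      and all: "\<And>i j. i < n \<Longrightarrow> j < K * l \<Longrightarrow> \<bar>\<psi> ((p j + h) * a i) - \<psi> (p j * a i)\<bar> \<le> V + 2 * \<epsilon>"
      and best: "V \<le> \<bar>\<psi> ((p bj + h) * a bi) - \<psi> (p bj * a bi)\<bar> + 2 * \<epsilon>"
      and d: "\<And>i. i < n \<Longrightarrow> \<bar>d i - (\<psi> (p bj * a bi + h * a i) - \<psi> (p bj * a bi))\<bar> \<le> 2 * \<epsilon>"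
      and x: "L2_set x {..<n} \<le> 1"
    for P l n bi bj :: nat and Q \<phi> h \<epsilon> a p \<psi> v d V x
  proof -
    define \<gamma> where "\<gamma> = (1/2::real) ^ (G * l\<^sup>2)"
    have l2: "1 \<le> l\<^sup>2" using l by simp
    have ll: "l \<le> l\<^sup>2" using l by (simp add: power2_eq_square)
    have \<gamma>: "0 < \<gamma>" and h0: "0 < h" by (auto simp: \<gamma>_def h_def)
    have hle: "h \<le> \<gamma> * ((1/2) ^ l * ((1/2) ^ (k * l) * (1/2) ^ k3))"
    proof -
      have "G * l\<^sup>2 + (l + (k * l + k3)) \<le> G * l\<^sup>2 + (l\<^sup>2 + (k * l\<^sup>2 + k3 * l\<^sup>2))"
        using ll l2 by (intro add_mono mult_left_mono) auto
      also have "\<dots> = P0 * l\<^sup>2" by (simp add: P0_def algebra_simps)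
      also have "\<dots> \<le> P * l\<^sup>2" using P by (intro mult_right_mono) auto
      finally have "h \<le> (1/2) ^ (G * l\<^sup>2 + (l + (k * l + k3)))"
        unfolding h_def by (intro power_decreasing) auto
      then show ?thesis by (simp only: \<gamma>_def power_add)
    qed
    have pw: "(1/2::real) ^ i \<le> 1" "0 < (1/2::real) ^ i" for i by (auto simp: power_le_one)
    have h\<gamma>: "h \<le> \<gamma>"
    proof -
      have "(1/2::real) ^ l * ((1/2) ^ (k * l) * (1/2) ^ k3) \<le> 1 * (1 * 1)"
        by (intro mult_mono pw) (use pw(2) in \<open>auto intro: less_imp_le\<close>)
      then have "\<gamma> * ((1/2::real) ^ l * ((1/2) ^ (k * l) * (1/2) ^ k3)) \<le> \<gamma> * 1"
        using \<gamma> by (intro mult_left_mono) auto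
      then show ?thesis using hle by linarith
    qed
    have hhalf: "h \<le> 1 / 2"
    proof -
      have "1 \<le> P * l\<^sup>2" using P l2 by (simp add: P0_def)
      then have "h \<le> (1/2) ^ 1" unfolding h_def by (intro power_decreasing) auto
      then show ?thesis by simp
    qed
    have p: "0 \<le> p j" "p j \<le> 1 / 2" if "j < K * l" for j
    proof -
      have "2 * real j \<le> real T * real (K * l)" using T that by (intro mult_mono) (auto simp del: of_nat_mult)
      moreover have "0 < real T * real (K * l)" using T K l by simp
      ultimately show "p j \<le> 1 / 2" unfolding p_def of_nat_mult[of T] by (simp add: divide_le_eq)
      show "0 \<le> p j" by (simp add: p_def)
    qed
    have ai: "\<bar>a i\<bar> \<le> 1" if "i < n" for i
    proof -
      have "(a i)\<^sup>2 \<le> (\<Sum>i<n. (a i)\<^sup>2)" using that by (intro member_le_sum) auto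
      also have "\<dots> = 1" using a by (simp add: L2_set_def)
      finally show ?thesis by (simp add: abs_square_le_1)
    qed
    have arg: "\<bar>s * a i + h * a i'\<bar> \<le> 1" "\<bar>s * a i\<bar> \<le> 1" if "0 \<le> s" "s \<le> 1 / 2" "i < n" "i' < n" for s i i'
    proof -
      have "\<bar>s * a i\<bar> \<le> 1 / 2 * 1" "\<bar>h * a i'\<bar> \<le> 1 / 2 * 1"
        unfolding abs_mult using that h0 hhalf ai by (intro mult_mono; simp)+
      then show "\<bar>s * a i + h * a i'\<bar> \<le> 1" "\<bar>s * a i\<bar> \<le> 1" by linarith+
    qed
    have tay: "norm (\<phi> (of_real (s * a i + h * a i')) - \<phi> (of_real (s * a i))
        - deriv \<phi> (of_real (s * a i)) * of_real (h * a i')) \<le> Q * c2 * h\<^sup>2"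
      if "0 \<le> s" "s \<le> 1 / 2" "i < n" "i' < n" for s i i'
    proof -
      have "norm (\<phi> (of_real (s * a i + h * a i')) - \<phi> (of_real (s * a i))
        - deriv \<phi> (of_real (s * a i)) * of_real (h * a i')) \<le> Q * c2 * (h * a i')\<^sup>2"
        using H_taylor[OF \<phi> \<sigma> arg(2)[OF that] arg(1)[OF that]] by (simp add: c2_def)
      also have "\<dots> \<le> Q * c2 * h\<^sup>2"
        using ai[OF that(4)] c2 Q by (intro mult_left_mono)
          (auto simp: power_mult_distrib mult_left_le abs_square_le_1)
      finally show ?thesis .
    qed
    define g where "g = Re (deriv \<phi> (of_real (p bj * a bi)))"
    have gd: "\<bar>\<psi> (p bj * a bi + h * a i) - \<psi> (p bj * a bi) - g * (h * a i)\<bar> \<le> Q * c2 * h\<^sup>2" if "i < n" for i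
    proof -
      have "\<bar>\<psi> (p bj * a bi + h * a i) - \<psi> (p bj * a bi) - g * (h * a i)\<bar>
        = \<bar>Re (\<phi> (of_real (p bj * a bi + h * a i)) - \<phi> (of_real (p bj * a bi))
        - deriv \<phi> (of_real (p bj * a bi)) * of_real (h * a i))\<bar>"
        by (simp add: \<psi>_def g_def)
      also have "\<dots> \<le> Q * c2 * h\<^sup>2"
        by (rule order_trans[OF abs_Re_le_cmod tay]) (use p[OF bj] bi that in auto)
      finally show ?thesis .
    qed
    define c where "c = (\<Sum>i<n. a i * v i)"
    have v1: "L2_set v {..<n} \<le> 1" unfolding v_def by (rule L2_set_normalized_le)
    have cb: "\<bar>c\<bar> \<le> 1" using abs_inner_le[OF v1, of a] a by (simp add: c_def)
    have sb: "\<bar>\<Sum>i<n. v i * x i\<bar> \<le> 1" "\<bar>\<Sum>i<n. a i * x i\<bar> \<le> 1"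
      using abs_inner_le[OF x, of v] abs_inner_le[OF x, of a] v1 a by auto
    have csb: "\<bar>c * (\<Sum>i<n. v i * x i)\<bar> \<le> 1"
      unfolding abs_mult using cb sb(1) by (simp add: mult_le_one)
    let ?L = "norm (\<phi> (of_real (c * (\<Sum>i<n. v i * x i))) - \<phi> (of_real (\<Sum>i<n. a i * x i)))"
    have lip: "?L \<le> B * \<bar>c * (\<Sum>i<n. v i * x i) - (\<Sum>i<n. a i * x i)\<bar>"
      if "\<And>t. \<bar>t\<bar> \<le> 1 \<Longrightarrow> norm (deriv \<phi> (of_real t)) \<le> B" for B
      by (rule H_lipschitz[OF \<phi> \<sigma> sb(2) csb that])
    \<comment> \<open>The derivative at the chosen node decides. If it is below
      \<open>Q * \<gamma>\<close>, then the largest difference is small, hence all are, and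
      \<open>small_on_segment\<close> applies. Otherwise the differences there are dominated by
      their linear part.\<close>
    have "?L \<le> (1/2) ^ (k * l) * Q"
    proof (cases "\<bar>g\<bar> \<le> Q * \<gamma>")
      case True
      define W where "W = \<bar>\<psi> ((p bj + h) * a bi) - \<psi> (p bj * a bi)\<bar>"
      have "W \<le> Q * (h * \<gamma>) + Q * c2 * h\<^sup>2"
      proof -
        have "\<bar>g * (h * a bi)\<bar> = \<bar>g\<bar> * (h * \<bar>a bi\<bar>)" using h0 by (simp add: abs_mult)
        also have "\<dots> \<le> (Q * \<gamma>) * (h * 1)"
          using True ai[OF bi] h0 Q \<gamma> by (intro mult_mono) auto
        finally have "\<bar>g * (h * a bi)\<bar> \<le> Q * (h * \<gamma>)" by (simp add: ac_simps)
        moreover have "(p bj + h) * a bi = p bj * a bi + h * a bi" by (simp add: algebra_simps)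
        ultimately show ?thesis using gd[OF bi] unfolding W_def by simp
      qed
      obtain i where i: "i < n" "(1/2) ^ l \<le> \<bar>a i\<bar>" using exists_large_component[OF a n l] by blast
      define \<eta> where "\<eta> = Q * \<gamma> * (5 + 2 * c2) * 2 ^ l"
      \<comment> \<open>The constant \<open>5 + 2 * c2\<close> collects the threshold (1), the
        errors of \<open>V\<close> (4) and two Taylor remainders, using
        \<open>h \<le> \<gamma>\<close>. Dividing by the component \<open>a i\<close> costs
        \<open>2 ^ l\<close>.\<close>
      have nodes: "norm (deriv \<phi> (of_real (p j * a i))) \<le> \<eta>" if j: "j < K * l" for j
      proof -
        define z where "z = deriv \<phi> (of_real (p j * a i))"
        define w where "w = \<phi> (of_real (p j * a i + h * a i)) - \<phi> (of_real (p j * a i))"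
        have e: "(p j + h) * a i = p j * a i + h * a i" by (simp add: algebra_simps)
        have "\<bar>Re w\<bar> \<le> V + 2 * \<epsilon>" using all[OF i(1) j] by (simp add: \<psi>_def w_def e)
        moreover have "V + 2 * \<epsilon> \<le> Q * (h * \<gamma>) + Q * c2 * h\<^sup>2 + 4 * (Q * h\<^sup>2)"
          using best \<epsilon> \<open>W \<le> _\<close> unfolding W_def[symmetric] by linarith
        \<comment> \<open>The queries see only \<open>Re \<phi>\<close>; reality on the segment
          turns a bound on \<open>Re w\<close> into one on \<open>norm w\<close>.\<close>
        moreover have "Im w = 0"
        proof -
          have "\<phi> (of_real t) \<in> \<real>" if "\<bar>t\<bar> \<le> 1" for t
            using \<phi> that \<sigma> by (auto simp: H_def of_real_in_rectangle)
          then show ?thesis using arg[OF p[OF j] i(1) i(1)]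
            by (simp add: w_def complex_is_Real_iff del: of_real_add of_real_mult)
        qed
        ultimately have "norm w \<le> Q * (h * \<gamma>) + Q * c2 * h\<^sup>2 + 4 * (Q * h\<^sup>2)"
          using cmod_eq_Re[of w] by linarith
        moreover have "norm (w - z * of_real (h * a i)) \<le> Q * c2 * h\<^sup>2"
          using tay[OF p[OF j] i(1) i(1)] by (simp only: w_def z_def)
        moreover have "norm (z * of_real (h * a i)) \<le> norm w + norm (w - z * of_real (h * a i))"
          using norm_triangle_ineq4[of w "w - z * of_real (h * a i)"] by simp
        ultimately have "norm (z * of_real (h * a i)) \<le> Q * (h * \<gamma>) + (2 * c2 + 4) * Q * (h * h)"
          by (simp add: power2_eq_square algebra_simps)
        also have "\<dots> \<le> Q * (h * \<gamma>) + (2 * c2 + 4) * Q * (h * \<gamma>)"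
          using h\<gamma> h0 Q c2 by (intro add_left_mono mult_left_mono) auto
        also have "\<dots> = (Q * \<gamma> * (5 + 2 * c2)) * h" by (simp add: algebra_simps)
        also have "norm (z * of_real (h * a i)) = norm z * \<bar>a i\<bar> * h"
          using h0 by (simp add: norm_mult abs_mult)
        finally have "norm z * \<bar>a i\<bar> \<le> Q * \<gamma> * (5 + 2 * c2)" using h0 by simp
        then have "norm z * (1/2) ^ l \<le> Q * \<gamma> * (5 + 2 * c2)"
          using mult_left_mono[OF i(2) norm_ge_zero, of z] by linarith
        then have "norm z * (1/2) ^ l * 2 ^ l \<le> \<eta>" unfolding \<eta>_def by (intro mult_right_mono) auto
        then show ?thesis by (simp add: z_def power_one_over)
      qed
      define B where "B = (1/2) ^ ((k + k1) * l) * (2 * Q / \<sigma>) + 2 ^ (D * l\<^sup>2) * \<eta>"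
      have "norm (deriv \<phi> (of_real t)) \<le> B" if t: "\<bar>t\<bar> \<le> 1" for t
        unfolding B_def
        using small[rule_format, OF l H_deriv(1)[OF \<phi> \<sigma>] H_deriv(2)[OF \<phi> \<sigma>] i(2) ai[OF i(1)] _ t, of \<eta>]
          nodes by (simp add: p_def)
      from lip[OF this] have "?L \<le> B * \<bar>c * (\<Sum>i<n. v i * x i) - (\<Sum>i<n. a i * x i)\<bar>" .
      \<comment> \<open>Two points of \<open>[-1,1]\<close> are at distance at most 2, whatever the
        direction found.\<close>
      also have "\<dots> \<le> B * 2"
      proof (rule mult_left_mono)
        show "0 \<le> B" unfolding B_def \<eta>_def using Q \<sigma> \<gamma> c2 by (intro add_nonneg_nonneg mult_nonneg_nonneg) auto
      qed (use csb sb in linarith)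
      also have "B \<le> (1/2) ^ (k * l) * Q / 4 + (1/2) ^ (k * l) * Q / 4"
        unfolding B_def
      proof (rule add_mono)
        have "(1/2::real) ^ ((k + k1) * l) = (1/2) ^ (k * l) * (1/2) ^ (k1 * l)"
          by (simp add: power_add algebra_simps)
        also have "\<dots> \<le> (1/2) ^ (k * l) * (\<sigma> / 8)"
        proof (rule mult_left_mono)
          have "(1/2::real) ^ (k1 * l) \<le> (1/2) ^ k1" using l by (intro power_decreasing) auto
          then show "(1/2) ^ (k1 * l) \<le> \<sigma> / 8" using k1 by linarith
        qed simp
        finally have "(1/2) ^ ((k + k1) * l) \<le> (1/2) ^ (k * l) * (\<sigma> / 8)" .
        then have "(1/2) ^ ((k + k1) * l) * (2 * Q / \<sigma>) \<le> (1/2) ^ (k * l) * (\<sigma> / 8) * (2 * Q / \<sigma>)"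
          using Q \<sigma> by (intro mult_right_mono) auto
        then show "(1/2) ^ ((k + k1) * l) * (2 * Q / \<sigma>) \<le> (1/2) ^ (k * l) * Q / 4"
            using \<sigma> by (simp add: mult.commute)
        have "\<gamma> = (1/2) ^ (D * l\<^sup>2) * ((1/2) ^ l\<^sup>2 * ((1/2) ^ (k * l\<^sup>2) * (1/2) ^ (k2 * l\<^sup>2)))"
          by (simp add: \<gamma>_def G_def power_add[symmetric] algebra_simps)
        also have "\<dots> \<le> (1/2) ^ (D * l\<^sup>2) * ((1/2) ^ l * ((1/2) ^ (k * l) * (1/2) ^ k2))"
        proof -
          have "(1/2::real) ^ l\<^sup>2 \<le> (1/2) ^ l" using ll by (intro power_decreasing) auto
          moreover have "(1/2::real) ^ (k * l\<^sup>2) \<le> (1/2) ^ (k * l)"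
            by (rule power_decreasing[OF mult_left_mono[OF ll]]) auto
          moreover have "(1/2::real) ^ (k2 * l\<^sup>2) \<le> (1/2) ^ k2"
            using l2 by (intro power_decreasing) auto
          ultimately show ?thesis by (intro mult_mono mult_nonneg_nonneg) auto
        qed
        also have "\<dots> \<le> (1/2) ^ (D * l\<^sup>2) * ((1/2) ^ l * ((1/2) ^ (k * l) * (1 / (4 * (5 + 2 * c2)))))"
          using k2 by (intro mult_left_mono) auto
        finally have "\<gamma> * (Q * (5 + 2 * c2) * 2 ^ l * 2 ^ (D * l\<^sup>2))
          \<le> (1/2) ^ (D * l\<^sup>2) * ((1/2) ^ l * ((1/2) ^ (k * l) * (1 / (4 * (5 + 2 * c2)))))
            * (Q * (5 + 2 * c2) * 2 ^ l * 2 ^ (D * l\<^sup>2))"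
          using Q c2 by (intro mult_right_mono mult_nonneg_nonneg) auto
        also have "\<dots> = (1/2) ^ (k * l) * Q / 4"
        proof -
          have e: "(1/2::real) ^ i * 2 ^ i = 1" for i by (simp add: power_one_over)
          have "(1/2) ^ (D * l\<^sup>2) * ((1/2) ^ l * ((1/2) ^ (k * l) * (1 / (4 * (5 + 2 * c2)))))
              * (Q * (5 + 2 * c2) * 2 ^ l * 2 ^ (D * l\<^sup>2))
            = ((1/2) ^ (D * l\<^sup>2) * 2 ^ (D * l\<^sup>2)) * ((1/2) ^ l * 2 ^ l)
              * ((1/2) ^ (k * l) * Q * ((5 + 2 * c2) * (1 / (4 * (5 + 2 * c2)))))"
            by (simp only: ac_simps)
          also have "(5 + 2 * c2) * (1 / (4 * (5 + 2 * c2))) = 1 / 4" using c2 by simp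
          finally have "(1/2) ^ (D * l\<^sup>2) * ((1/2) ^ l * ((1/2) ^ (k * l) * (1 / (4 * (5 + 2 * c2)))))
              * (Q * (5 + 2 * c2) * 2 ^ l * 2 ^ (D * l\<^sup>2)) = 1 * 1 * ((1/2) ^ (k * l) * Q * (1 / 4))"
            unfolding e .
          then show ?thesis by simp
        qed
        finally show "2 ^ (D * l\<^sup>2) * \<eta> \<le> (1/2) ^ (k * l) * Q / 4"
          by (simp only: \<eta>_def ac_simps)
      qed
      finally show ?thesis by (simp add: mult.commute[of Q])
    next
      case False
      \<comment> \<open>\<open>d\<close> approximates \<open>\<mu> * a\<close>. The error is
        \<open>O(Q h^2)\<close> and the scale at least \<open>Q * \<gamma> * h\<close>, hence the
        relative error \<open>\<beta>\<close>.\<close>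
      define \<mu> where "\<mu> = g * h"
      have g: "Q * \<gamma> < \<bar>g\<bar>" using False by simp
      have \<mu>0: "Q * \<gamma> * h \<le> \<bar>\<mu>\<bar>" using g h0 by (simp add: \<mu>_def abs_mult)
      then have \<mu>1: "\<mu> \<noteq> 0" using Q \<gamma> h0 by (metis abs_zero mult_pos_pos not_le)
      define \<beta> where "\<beta> = (c2 + 2) * h / \<gamma>"
      have e: "\<bar>d i / \<mu> - a i\<bar> \<le> \<beta>" if "i < n" for i
      proof -
        have "\<bar>d i - \<mu> * a i\<bar> \<le> Q * c2 * h\<^sup>2 + 2 * (Q * h\<^sup>2)"
          using gd[OF that] d[OF that] \<epsilon> by (simp add: \<mu>_def mult.assoc)
        also have "\<dots> = \<beta> * (Q * \<gamma> * h)"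
          using \<gamma> by (simp add: \<beta>_def power2_eq_square field_simps)
        also have "\<dots> \<le> \<beta> * \<bar>\<mu>\<bar>" using \<mu>0 c2 h0 \<gamma> by (intro mult_left_mono) (auto simp: \<beta>_def)
        finally have "\<bar>d i - \<mu> * a i\<bar> / \<bar>\<mu>\<bar> \<le> \<beta>" using \<mu>1 by (simp add: divide_le_eq)
        moreover have "d i / \<mu> - a i = (d i - \<mu> * a i) / \<mu>" using \<mu>1 by (simp add: diff_divide_distrib)
        ultimately show ?thesis by (simp add: abs_divide)
      qed
      have "\<bar>\<Sum>i<n. (c * v i - a i) * x i\<bar> \<le> real n * \<beta>"
        using abs_inner_le[OF x, of "\<lambda>i. c * v i - a i"] direction_estimate[OF a \<mu>1 e]
        unfolding c_def v_def by simp
      moreover have "(\<Sum>i<n. (c * v i - a i) * x i) = c * (\<Sum>i<n. v i * x i) - (\<Sum>i<n. a i * x i)"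
        by (simp add: left_diff_distrib sum_subtractf sum_distrib_left mult.assoc)
      ultimately have cx: "\<bar>c * (\<Sum>i<n. v i * x i) - (\<Sum>i<n. a i * x i)\<bar> \<le> real n * \<beta>" by simp
      have "?L \<le> 2 * Q / \<sigma> * \<bar>c * (\<Sum>i<n. v i * x i) - (\<Sum>i<n. a i * x i)\<bar>"
        by (rule lip, rule H_deriv(2)[OF \<phi> \<sigma>]) (use \<sigma> in \<open>auto intro: of_real_in_rectangle\<close>)
      also have "\<dots> \<le> 2 * Q / \<sigma> * (real n * \<beta>)" using cx Q \<sigma> by (intro mult_left_mono) auto
      also have "\<dots> \<le> 2 * Q / \<sigma> * (2 ^ l * \<beta>)"
      proof -
        have "real n \<le> 2 ^ l" using n by (metis of_nat_le_iff of_nat_numeral of_nat_power)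
        then show ?thesis using Q \<sigma> c2 h0 \<gamma> by (intro mult_left_mono mult_right_mono) (auto simp: \<beta>_def)
      qed
      also have "\<dots> \<le> 2 * Q / \<sigma> * (2 ^ l * ((c2 + 2) * ((1/2) ^ l * ((1/2) ^ (k * l) * (\<sigma> / (2 * (c2 + 2)))))))"
      proof -
        have "h / \<gamma> \<le> (1/2) ^ l * ((1/2) ^ (k * l) * (1/2) ^ k3)"
          using hle \<gamma> by (simp add: pos_divide_le_eq mult.commute)
        also have "\<dots> \<le> (1/2) ^ l * ((1/2) ^ (k * l) * (\<sigma> / (2 * (c2 + 2))))"
          using k3 by (intro mult_left_mono) auto
        finally show ?thesis unfolding \<beta>_def times_divide_eq_right[symmetric, of "c2 + 2"] using Q \<sigma> c2
          by (intro mult_left_mono) auto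
      qed
      also have "\<dots> = (1/2) ^ (k * l) * Q"
      proof -
        have "2 * Q / \<sigma> * (2 ^ l * ((c2 + 2) * ((1/2) ^ l * ((1/2) ^ (k * l) * (\<sigma> / (2 * (c2 + 2)))))))
          = (2 ^ l * (1/2) ^ l) * ((1/2) ^ (k * l) * (2 * Q / \<sigma> * ((c2 + 2) * (\<sigma> / (2 * (c2 + 2))))))"
          by (simp only: ac_simps)
        also have "2 * Q / \<sigma> * ((c2 + 2) * (\<sigma> / (2 * (c2 + 2)))) = Q"
        proof -
          have "(c2 + 2) * (\<sigma> / (2 * (c2 + 2))) = \<sigma> / 2" using c2 by (simp add: divide_simps)
          then show ?thesis using \<sigma> by (simp only:) simp
        qed
        finally show ?thesis by (simp add: power_one_over)
      qed
      finally show ?thesis .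
    qed
    then show ?thesis by (simp only: c_def)
  qed
  show ?thesis unfolding Let_def
  proof (rule exI[of _ T], rule conjI[OF T], rule exI[of _ K], rule conjI[OF K], rule exI[of _ P0],
      intro allI impI ballI, goal_cases)
    case (1 P l n Q \<phi> a d bi bj h \<epsilon> x V)
    show ?case
      by (rule main[OF 1(1,2,3,4,5,6,7,8,9,10) refl refl refl, of V d x]) (use 1(11-14) in auto)
  qed
qed

section \<open>Weakest preconditions with cost bounds\<close>

text \<open>Loops count as \<open>0\<close> here: the two functions are meant for loop-free programs.\<close>

primrec straight_ops :: "com \<Rightarrow> nat" where
  "straight_ops Skip = 0"
| "straight_ops (IAssign v a) = icost a + 1"
| "straight_ops (RAssign v i r) = icost i + rcost r + 1"
| "straight_ops (Sample v i) = icost i + 1"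
| "straight_ops (Query v i p) = icost i + 1"
| "straight_ops (Seq c d) = straight_ops c + straight_ops d"
| "straight_ops (If b c d) = bcost b + (straight_ops c + straight_ops d)"
| "straight_ops (While b c) = 0"

primrec straight_queries :: "com \<Rightarrow> nat" where
  "straight_queries Skip = 0"
| "straight_queries (IAssign v a) = 0"
| "straight_queries (RAssign v i r) = 0"
| "straight_queries (Sample v i) = 0"
| "straight_queries (Query v i p) = 1"
| "straight_queries (Seq c d) = straight_queries c + straight_queries d"
| "straight_queries (If b c d) = straight_queries c + straight_queries d"
| "straight_queries (While b c) = 0"

definition For :: "vname \<Rightarrow> iexp \<Rightarrow> com \<Rightarrow> com" where
  "For v e c = Seq (IAssign v (IConst 0))
     (While (ILess (IVar v) e) (Seq c (IAssign v (IAdd (IVar v) (IConst 1)))))"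

locale noisy_oracle =
  fixes n :: nat and answer :: "nat \<Rightarrow> (nat \<Rightarrow> real) \<Rightarrow> real" and \<omega> :: "nat \<Rightarrow> real"
    and f :: "(nat \<Rightarrow> real) \<Rightarrow> real" and \<epsilon> :: real
  assumes answer: "\<bar>answer i x - f x\<bar> \<le> \<epsilon>"
begin

text \<open>Since \<open>exec\<close> is deterministic, the existence of one run is total
  correctness. The budgets for operations and queries and the admissibility of the query points are
  bundled with the postcondition so that all compose by the same rules.\<close>

definition wp :: "com \<Rightarrow> nat \<Rightarrow> nat \<Rightarrow> (state \<Rightarrow> bool) \<Rightarrow> state \<Rightarrow> bool" where
  "wp c t q R s \<longleftrightarrow> (\<exists>s' xs. exec n answer \<omega> c s s' \<and> R s' \<and> ops s' \<le> ops s + t \<and>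
     draws s' = draws s \<and> queries s' = queries s @ xs \<and> length xs \<le> q \<and> set xs \<subseteq> unit_ball n)"

lemma wpI:
  assumes "exec n answer \<omega> c s s'" "R s'" "ops s' \<le> ops s + t" "draws s' = draws s"
    "queries s' = queries s @ xs" "length xs \<le> q" "set xs \<subseteq> unit_ball n"
  shows "wp c t q R s"
  using assms unfolding wp_def by blast

lemma wpE:
  assumes "wp c t q R s"
  obtains s' xs where "exec n answer \<omega> c s s'" "R s'" "ops s' \<le> ops s + t" "draws s' = draws s"
    "queries s' = queries s @ xs" "length xs \<le> q" "set xs \<subseteq> unit_ball n"
  using assms unfolding wp_def by blast

lemma wp_mono:
  assumes "wp c t q R s" "\<And>s. R s \<Longrightarrow> R' s" "t \<le> t'" "q \<le> q'"
  shows "wp c t' q' R' s"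
proof -
  obtain s' xs where s: "exec n answer \<omega> c s s'" "R s'" "ops s' \<le> ops s + t" "draws s' = draws s"
    "queries s' = queries s @ xs" "length xs \<le> q" "set xs \<subseteq> unit_ball n"
    using assms(1) by (rule wpE)
  then show ?thesis using assms(2-4) by (intro wpI[of c s s' R' t' xs q']) auto
qed

lemma wp_Seq:
  assumes "wp c t q (\<lambda>s'. wp d t' q' R s') s"
  shows "wp (Seq c d) (t + t') (q + q') R s"
proof -
  obtain s1 xs where 1: "exec n answer \<omega> c s s1" "wp d t' q' R s1" "ops s1 \<le> ops s + t" "draws s1 = draws s"
    "queries s1 = queries s @ xs" "length xs \<le> q" "set xs \<subseteq> unit_ball n"
    using assms by (rule wpE)
  obtain s2 ys where 2: "exec n answer \<omega> d s1 s2" "R s2" "ops s2 \<le> ops s1 + t'" "draws s2 = draws s1"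
    "queries s2 = queries s1 @ ys" "length ys \<le> q'" "set ys \<subseteq> unit_ball n"
    using 1(2) by (rule wpE)
  show ?thesis
    by (rule wpI[of _ s s2 _ _ "xs @ ys"]) (use 1 2 in \<open>auto intro: exec.Seq\<close>)
qed

text \<open>The invariant carries the number of iterations done, so exactly \<open>K\<close> rounds
  occur; the final \<open>bcost b\<close> is the failing test. Induction on the rounds left.\<close>

lemma wp_While:
  assumes "I 0 s"
    and "\<And>j s. j < K \<Longrightarrow> I j s \<Longrightarrow> bval b s \<and> wp c t q (I (Suc j)) (tick (bcost b) s)"
    and "\<And>s. I K s \<Longrightarrow> \<not> bval b s \<and> R (tick (bcost b) s)"
  shows "wp (While b c) (K * (t + bcost b) + bcost b) (K * q) R s"
proof -
  have "wp (While b c) ((K - j) * (t + bcost b) + bcost b) ((K - j) * q) R s" if "j \<le> K" "I j s" for j s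
    using that
  proof (induction "K - j" arbitrary: j s)
    case 0
    then have "I K s" by simp
    from assms(3)[OF this] show ?case
      by (intro wpI[OF exec.WhileFalse, where xs = "[]"]) (auto simp: tick_def)
  next
    case (Suc x)
    then have jK: "j < K" by simp
    note b = assms(2)[OF jK Suc.prems(2)]
    obtain s1 xs where 1: "exec n answer \<omega> c (tick (bcost b) s) s1" "I (Suc j) s1"
      "ops s1 \<le> ops (tick (bcost b) s) + t" "draws s1 = draws (tick (bcost b) s)"
      "queries s1 = queries (tick (bcost b) s) @ xs" "length xs \<le> q" "set xs \<subseteq> unit_ball n"
      using b[THEN conjunct2] by (rule wpE)
    have "wp (While b c) ((K - Suc j) * (t + bcost b) + bcost b) ((K - Suc j) * q) R s1"
      using Suc.hyps(1)[of "Suc j" s1] Suc.hyps(2) jK 1(2) by simp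
    then obtain s2 ys where 2: "exec n answer \<omega> (While b c) s1 s2" "R s2"
      "ops s2 \<le> ops s1 + ((K - Suc j) * (t + bcost b) + bcost b)" "draws s2 = draws s1"
      "queries s2 = queries s1 @ ys" "length ys \<le> (K - Suc j) * q" "set ys \<subseteq> unit_ball n"
      by (rule wpE)
    have K: "K - j = Suc (K - Suc j)" using jK by simp
    show ?case unfolding K
    proof (rule wpI[OF exec.WhileTrue[OF _ 1(1) 2(1)], where xs = "xs @ ys"])
      show "bval b s" using b by blast
      show "ops s2 \<le> ops s + (Suc (K - Suc j) * (t + bcost b) + bcost b)"
        using 1(3) 2(3) by (simp add: tick_def)
    qed (use 1 2 in \<open>simp_all add: tick_def\<close>)
  qed
  from this[of 0 s] assms(1) show ?thesis by simp
qed

text \<open>Per round, 4 operations go to the increment and \<open>icost e + 2\<close> to the test;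
  the closing \<open>icost e + 4\<close> is the initial assignment and the failing test. The
  invariant must ignore the cost counter and the loop register, and the body must preserve the
  latter.\<close>

lemma wp_For:
  assumes "I 0 s"
    and I: "\<And>j k s. I j (tick k s) = I j s" "\<And>j x s. I j (set_ireg v x s) = I j s"
    and e: "\<And>j s. I j s \<Longrightarrow> ival e s = K"
    and body: "\<And>j s. j < K \<Longrightarrow> I j s \<Longrightarrow> ireg s v = j \<Longrightarrow> wp c t q (\<lambda>s'. I (Suc j) s' \<and> ireg s' v = j) s"
    and R: "\<And>s. I K s \<Longrightarrow> R s"
  shows "wp (For v e c) (K * (t + icost e + 6) + icost e + 4) (K * q) R s"
proof -
  let ?b = "ILess (IVar v) e" and ?inc = "IAssign v (IAdd (IVar v) (IConst 1))"
  let ?J = "\<lambda>j s. I j s \<and> ireg s v = j"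
  define s0 where "s0 = tick (icost (IConst 0) + 1) (set_ireg v (ival (IConst 0) s) s)"
  have e0: "exec n answer \<omega> (IAssign v (IConst 0)) s s0" unfolding s0_def by (rule exec.IAssign)
  have "wp (While ?b (Seq c ?inc)) (K * ((t + 4) + bcost ?b) + bcost ?b) (K * (q + 0)) R s0"
  proof (rule wp_While[where I = ?J])
    show "?J 0 s0" using assms(1) by (simp add: s0_def I) (simp add: tick_def set_ireg_def)
    show "bval ?b s \<and> wp (Seq c ?inc) (t + 4) (q + 0) (?J (Suc j)) (tick (bcost ?b) s)"
      if "j < K" "?J j s" for j s
    proof
      show "bval ?b s" using that e[of j s] by simp
      show "wp (Seq c ?inc) (t + 4) (q + 0) (?J (Suc j)) (tick (bcost ?b) s)"
      proof (rule wp_Seq, rule wp_mono[OF body[of j]])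
        show "wp ?inc 4 0 (?J (Suc j)) s'" if "I (Suc j) s' \<and> ireg s' v = j" for s'
          by (rule wpI[OF exec.IAssign, where xs = "[]"])
            (use that in \<open>simp_all add: I\<close>, simp_all add: tick_def set_ireg_def)
      qed (use that in \<open>auto simp: I\<close>, simp add: tick_def)
    qed
    show "\<not> bval ?b s \<and> R (tick (bcost ?b) s)" if "?J K s" for s
      using that e[of K s] R[of "tick (bcost ?b) s"] by (simp add: I)
  qed
  then obtain s1 xs where 1: "exec n answer \<omega> (While ?b (Seq c ?inc)) s0 s1" "R s1"
    "ops s1 \<le> ops s0 + (K * ((t + 4) + bcost ?b) + bcost ?b)" "draws s1 = draws s0"
    "queries s1 = queries s0 @ xs" "length xs \<le> K * (q + 0)" "set xs \<subseteq> unit_ball n"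
    by (rule wpE)
  show ?thesis unfolding For_def
  proof (rule wpI[OF exec.Seq[OF e0 1(1)]])
    show "ops s1 \<le> ops s + (K * (t + icost e + 6) + icost e + 4)"
      using 1(3) by (simp add: s0_def tick_def set_ireg_def algebra_simps)
    show "queries s1 = queries s @ xs" using 1(5) by (simp add: s0_def tick_def set_ireg_def)
    show "draws s1 = draws s" using 1(4) by (simp add: s0_def tick_def set_ireg_def)
  qed (use 1(2,6,7) in auto)
qed

text \<open>For loop-free code the budgets are read off the syntax. A conditional is charged for
  both branches, which avoids maxima.\<close>

definition swp :: "com \<Rightarrow> (state \<Rightarrow> bool) \<Rightarrow> state \<Rightarrow> bool" where
  "swp c R s = wp c (straight_ops c) (straight_queries c) R s"

lemma swp_Skip: "R s \<Longrightarrow> swp Skip R s"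
  unfolding swp_def by (rule wpI[OF exec.Skip, where xs = "[]"]) auto

lemma swp_IAssign:
  "R (s\<lparr>ireg := (ireg s)(v := ival a s), ops := ops s + (icost a + 1)\<rparr>) \<Longrightarrow> swp (IAssign v a) R s"
  unfolding swp_def
  by (rule wpI[OF exec.IAssign, where xs = "[]"]) (auto simp: tick_def set_ireg_def)

lemma swp_RAssign:
  "R (s\<lparr>arr := (arr s)(v := (arr s v)(ival i s := rval r s)), ops := ops s + (icost i + rcost r + 1)\<rparr>)
    \<Longrightarrow> swp (RAssign v i r) R s"
  unfolding swp_def
  by (rule wpI[OF exec.RAssign, where xs = "[]"]) (auto simp: tick_def set_cell_def)

text \<open>The postcondition is required for every answer within \<open>\<epsilon>\<close>, so the
  errors are treated as adversarial; log and cost are generalized as well, since \<open>wp\<close>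
  already accounts for them.\<close>

lemma swp_Query:
  assumes "restrict (arr s p) {..<n} \<in> unit_ball n"
    and "\<And>y k xs. \<bar>y - f (restrict (arr s p) {..<n})\<bar> \<le> \<epsilon> \<Longrightarrow>
      R (s\<lparr>arr := (arr s)(v := (arr s v)(ival i s := y)), queries := xs, ops := k\<rparr>)"
  shows "swp (Query v i p) R s"
  unfolding swp_def
proof (rule wpI[OF exec.Query[OF refl], where xs = "[restrict (arr s p) {..<n}]"])
  let ?x = "restrict (arr s p) {..<n}"
  let ?s = "tick (icost i + 1) (set_cell v (ival i s) (answer (length (queries s)) ?x)
    (s\<lparr>queries := queries s @ [?x]\<rparr>))"
  have eq: "?s = s\<lparr>arr := (arr s)(v := (arr s v)(ival i s := answer (length (queries s)) ?x)),
      queries := queries s @ [?x], ops := ops s + (icost i + 1)\<rparr>"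
    by (simp add: tick_def set_cell_def)
  show "R ?s" unfolding eq by (rule assms(2)[OF answer])
  show "set [?x] \<subseteq> unit_ball n" using assms(1) by simp
qed (simp_all add: tick_def set_cell_def)

lemma swp_Seq: "swp c (swp d R) s \<Longrightarrow> swp (Seq c d) R s"
  unfolding swp_def using wp_Seq by simp

lemma swp_If:
  assumes "bval b s \<Longrightarrow> swp c R (tick (bcost b) s)" "\<not> bval b s \<Longrightarrow> swp d R (tick (bcost b) s)"
  shows "swp (If b c d) R s"
proof (cases "bval b s")
  case True
  obtain s' xs where 1: "exec n answer \<omega> c (tick (bcost b) s) s'" "R s'"
    "ops s' \<le> ops (tick (bcost b) s) + straight_ops c" "draws s' = draws (tick (bcost b) s)"
    "queries s' = queries (tick (bcost b) s) @ xs" "length xs \<le> straight_queries c" "set xs \<subseteq> unit_ball n"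
    using assms(1)[OF True] unfolding swp_def by (rule wpE)
  show ?thesis unfolding swp_def
    by (rule wpI[OF exec.IfTrue[OF True 1(1)], where xs = xs]) (use 1(2-7) in \<open>simp_all add: tick_def\<close>)
next
  case False
  obtain s' xs where 1: "exec n answer \<omega> d (tick (bcost b) s) s'" "R s'"
    "ops s' \<le> ops (tick (bcost b) s) + straight_ops d" "draws s' = draws (tick (bcost b) s)"
    "queries s' = queries (tick (bcost b) s) @ xs" "length xs \<le> straight_queries d" "set xs \<subseteq> unit_ball n"
    using assms(2)[OF False] unfolding swp_def by (rule wpE)
  show ?thesis unfolding swp_def
    by (rule wpI[OF exec.IfFalse[OF False 1(1)], where xs = xs]) (use 1(2-7) in \<open>simp_all add: tick_def\<close>)
qed

lemmas swp_intros = swp_Skip swp_IAssign swp_RAssign swp_Query swp_Seq swp_If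

end

section \<open>The programs\<close>

text \<open>Index expressions have no multiplication, so constant factors are unrolled.\<close>

primrec imul :: "nat \<Rightarrow> iexp \<Rightarrow> iexp" where
  "imul 0 e = IConst 0"
| "imul (Suc c) e = IAdd e (imul c e)"

lemma ival_imul [simp]: "ival (imul c e) s = c * ival e s"
  by (induction c) auto

abbreviation cell :: "vname \<Rightarrow> rexp" where
  "cell v \<equiv> RCell v (IConst 0)"

text \<open>For fixed \<open>m\<close> the interpolation formula is one expression, unrolled into
  the program text; the nodes are rational constants, so its cost does not depend on
  \<open>n\<close>.\<close>

fun newton_exp :: "(rat \<times> rexp) list \<Rightarrow> rexp \<Rightarrow> rexp" where
  "newton_exp [] w = RConst 0"
| "newton_exp ((u, y) # ps) w = RAdd y (RMul (RSub w (RConst u))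
    (newton_exp (map (\<lambda>(v, z). (v, RDiv (RSub z y) (RConst (v - u)))) ps) w))"

lemma rval_newton_exp:
  "rval (newton_exp ps w) s = newton (map (\<lambda>(u, y). (of_rat u, rval y s)) ps) (rval w s)"
proof (induction ps w rule: newton_exp.induct)
  case (2 u y ps w)
  then show ?case by (simp add: comp_def case_prod_beta of_rat_diff)
qed simp

text \<open>The ceiling of \<open>log_2 n\<close> for positive \<open>n\<close>, in the form in
  which a doubling loop finds it.\<close>

definition level :: "nat \<Rightarrow> nat" where
  "level n = (LEAST l. n \<le> 2 ^ l)"

text \<open>The machine has no powers: \<open>h = (1/2) ^ (P * l\<^sup>2)\<close> arises from
  \<open>l\<^sup>2\<close> multiplications by a constant. \<open>M\<close> will be the number of
  nodes per axis and \<open>N\<close> the number of profile samples.\<close>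

definition setup_prog :: "nat \<Rightarrow> nat \<Rightarrow> nat \<Rightarrow> com" where
  "setup_prog K P B =
    Seq (IAssign ''p'' (IConst 1))
   (Seq (While (ILess (IVar ''p'') (IVar ''n''))
          (Seq (IAssign ''p'' (IAdd (IVar ''p'') (IVar ''p'')))
               (IAssign ''l'' (IAdd (IVar ''l'') (IConst 1)))))
   (Seq (RAssign ''h'' (IConst 0) (RConst 1))
   (Seq (For ''i'' (IVar ''l'') (For ''j'' (IVar ''l'')
          (RAssign ''h'' (IConst 0) (RMul (cell ''h'') (RConst ((1/2) ^ P))))))
   (Seq (IAssign ''M'' (imul K (IVar ''l'')))
        (IAssign ''N'' (imul B (IVar ''n'')))))))"

text \<open>
  Array \<open>P\<close> holds the query point, \<open>V\<close> the largest absolute difference seen so far, and registers \<open>bi\<close>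
  and \<open>bj\<close> the axis and the node where it occurred. Array \<open>v\<close> becomes the direction, \<open>y\<close> the samples.
\<close>

definition search_step :: "nat \<Rightarrow> com" where
  "search_step T =
    Seq (RAssign ''P'' (IVar ''i'') (RDiv (RNat (IVar ''j'')) (RNat (imul T (IVar ''M'')))))
   (Seq (Query ''u'' (IConst 0) ''P'')
   (Seq (RAssign ''P'' (IVar ''i'') (RAdd (RCell ''P'' (IVar ''i'')) (cell ''h'')))
   (Seq (Query ''w'' (IConst 0) ''P'')
   (Seq (RAssign ''P'' (IVar ''i'') (RConst 0))
   (Seq (RAssign ''D'' (IConst 0) (RSqrt (RMul (RSub (cell ''w'') (cell ''u'')) (RSub (cell ''w'') (cell ''u'')))))
        (If (RLess (cell ''V'') (cell ''D''))
          (Seq (RAssign ''V'' (IConst 0) (cell ''D''))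
          (Seq (IAssign ''bi'' (IVar ''i'')) (IAssign ''bj'' (IVar ''j''))))
          Skip))))))"

definition search_prog :: "nat \<Rightarrow> com" where
  "search_prog T = For ''i'' (IVar ''n'') (For ''j'' (IVar ''M'') (search_step T))"

text \<open>Adding \<open>h\<close> and subtracting it again restores the point exactly, as reals
  are not rounded, also for the axis whose cell holds the node. \<open>S\<close> accumulates the
  squared length for the later normalization.\<close>

definition difference_step :: com where
  "difference_step =
    Seq (RAssign ''P'' (IVar ''k'') (RAdd (RCell ''P'' (IVar ''k'')) (cell ''h'')))
   (Seq (Query ''w'' (IConst 0) ''P'')
   (Seq (RAssign ''P'' (IVar ''k'') (RSub (RCell ''P'' (IVar ''k'')) (cell ''h'')))
   (Seq (RAssign ''d'' (IVar ''k'') (RSub (cell ''w'') (cell ''u'')))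
        (RAssign ''S'' (IConst 0) (RAdd (cell ''S'')
          (RMul (RCell ''d'' (IVar ''k'')) (RCell ''d'' (IVar ''k''))))))))"

definition base_prog :: "nat \<Rightarrow> com" where
  "base_prog T =
    Seq (RAssign ''P'' (IVar ''bi'') (RDiv (RNat (IVar ''bj'')) (RNat (imul T (IVar ''M'')))))
        (Query ''u'' (IConst 0) ''P'')"

text \<open>If all differences vanish, \<open>x / 0 = 0\<close> makes the direction \<open>0\<close>; this happens only for nearly constant profiles.\<close>

definition normalize_step :: com where
  "normalize_step = RAssign ''v'' (IVar ''k'') (RDiv (RCell ''d'' (IVar ''k'')) (RSqrt (cell ''S'')))"

definition direction_prog :: "nat \<Rightarrow> com" where
  "direction_prog T =
    Seq (base_prog T)
   (Seq (For ''k'' (IVar ''n'') difference_step)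
        (For ''k'' (IVar ''n'') normalize_step))"

text \<open>The points are \<open>2 * i / N - 1\<close> times \<open>v\<close> for
  \<open>i < N\<close>. The right endpoint is not sampled; the interpolation estimate allows one
  step beyond the last node.\<close>

definition point_step :: com where
  "point_step = RAssign ''P'' (IVar ''k'') (RMul (RSub
     (RDiv (RNat (IAdd (IVar ''i'') (IVar ''i''))) (RNat (IVar ''N''))) (RConst 1)) (RCell ''v'' (IVar ''k'')))"

definition profile_prog :: com where
  "profile_prog = For ''i'' (IVar ''N'') (Seq (For ''k'' (IVar ''n'') point_step)
     (Query ''y'' (IVar ''i'') ''P''))"

text \<open>For \<open>n = 1\<close> the budget \<open>C * n * (ln n)\<^sup>2\<close> is 0, so the
  program must stop without a query.\<close>

definition recovery_prog :: "nat \<Rightarrow> nat \<Rightarrow> nat \<Rightarrow> nat \<Rightarrow> com" where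
  "recovery_prog T K P B = If (ILess (IVar ''n'') (IConst 2)) Skip
     (Seq (setup_prog K P B) (Seq (search_prog T) (Seq (direction_prog T) profile_prog)))"

text \<open>Without rounding from reals to naturals the window start is found by counting up, in at
  most \<open>B * n\<close> rounds.\<close>

definition locate_prog :: "nat \<Rightarrow> com" where
  "locate_prog m = Seq (IAssign ''b'' (IConst 0))
     (While (RLess (RNat (IAdd (IVar ''b'') (IConst m))) (cell ''Y''))
       (IAssign ''b'' (IAdd (IVar ''b'') (IConst 1))))"

definition evaluation_prog :: "nat \<Rightarrow> com" where
  "evaluation_prog m = If (ILess (IVar ''n'') (IConst 2)) Skip
     (Seq (RAssign ''t'' (IConst 0) (RConst 0))
     (Seq (For ''k'' (IVar ''n'') (RAssign ''t'' (IConst 0)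
            (RAdd (cell ''t'') (RMul (RCell ''v'' (IVar ''k'')) (RCell ''x'' (IVar ''k''))))))
     (Seq (RAssign ''Y'' (IConst 0) (RDiv (RMul (RAdd (cell ''t'') (RConst 1)) (RNat (IVar ''N''))) (RConst 2)))
     (Seq (locate_prog m)
          (RAssign ''out'' (IConst 0) (newton_exp
            (map (\<lambda>j. (of_nat j, RCell ''y'' (IAdd (IVar ''b'') (IConst j)))) [0..<m])
            (RSub (cell ''Y'') (RNat (IVar ''b'')))))))))"

text \<open>\<open>Y\<close> is the position of \<open>t\<close> on the sample grid, measured in
  steps, and \<open>b\<close> the least start of a window with \<open>Y \<le> b + m\<close>.\<close>

definition piecewise_newton :: "nat \<Rightarrow> nat \<Rightarrow> (nat \<Rightarrow> real) \<Rightarrow> real \<Rightarrow> real" where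
  "piecewise_newton m N y t = (let Y = (t + 1) * real N / 2; b = nat \<lceil>Y - real m\<rceil> in
     newton (map (\<lambda>j. (real j, y (b + j))) [0..<m]) (Y - real b))"

section \<open>Correctness of the recovery\<close>

locale ridge_oracle = noisy_oracle +
  fixes a :: "nat \<Rightarrow> real" and \<psi> :: "real \<Rightarrow> real" and T K P B l :: nat and h :: real
  assumes ridge: "\<And>x. x \<in> unit_ball n \<Longrightarrow> f x = \<psi> (scalar_product n a x)"
    and n2: "2 \<le> n" and T2: "2 \<le> T" and K0: "0 < K" and P0: "0 < P" and B0: "0 < B"
    and l_def: "l = level n" and h_def: "h = (1/2) ^ (P * l\<^sup>2)"
begin

lemma query_point:
  assumes "L2_set g {..<n} \<le> 1"
  shows "restrict g {..<n} \<in> unit_ball n" "f (restrict g {..<n}) = \<psi> (\<Sum>i<n. a i * g i)"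
proof -
  show *: "restrict g {..<n} \<in> unit_ball n"
    using assms L2_set_cong[of "{..<n}" "{..<n}" "restrict g {..<n}" g]
    by (simp add: unit_ball_def euclidean_def del: restrict_apply) simp
  show "f (restrict g {..<n}) = \<psi> (\<Sum>i<n. a i * g i)"
    by (simp add: ridge[OF *] scalar_product_def)
qed

lemma level: "n \<le> 2 ^ l" "\<And>j. j < l \<Longrightarrow> 2 ^ j < n" "1 \<le> l" "l \<le> n"
proof -
  have e: "n \<le> 2 ^ n" by (simp add: less_imp_le)
  then show "n \<le> 2 ^ l" "l \<le> n" unfolding l_def level_def by (rule LeastI, rule Least_le)
  then have "l \<noteq> 0" using n2 by (intro notI) simp
  then show "1 \<le> l" by simp
  show "2 ^ j < n" if "j < l" for j
    using not_less_Least[of j "\<lambda>l. n \<le> 2 ^ l"] that by (auto simp: l_def level_def)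
qed

lemma h: "0 < h" "h \<le> 1 / 2"
proof -
  have "1 \<le> P * l\<^sup>2" using P0 level(3) by simp
  then have "h \<le> (1/2) ^ 1" unfolding h_def by (intro power_decreasing) auto
  then show "h \<le> 1 / 2" by simp
qed (simp add: h_def)

definition node :: "nat \<Rightarrow> real" where
  "node j = real j / real (T * (K * l))"

lemma node: "j < K * l \<Longrightarrow> 0 \<le> node j" "j < K * l \<Longrightarrow> node j \<le> 1 / 2"
proof -
  assume j: "j < K * l"
  then have "2 * real j \<le> real T * real (K * l)"
    using T2 by (intro mult_mono) (auto simp del: of_nat_mult)
  moreover have "0 < real T * real (K * l)" using T2 K0 level(3) by simp
  ultimately show "node j \<le> 1 / 2" unfolding node_def of_nat_mult[of T] by (simp add: divide_le_eq)
qed (simp add: node_def)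

definition env :: "state \<Rightarrow> bool" where
  "env s \<longleftrightarrow> ireg s ''n'' = n \<and> ireg s ''l'' = l \<and> ireg s ''M'' = K * l \<and> ireg s ''N'' = B * n \<and>
     arr s ''h'' 0 = h"

lemma wp_Seq':
  assumes "wp c t q R1 s" "\<And>s. R1 s \<Longrightarrow> wp d t' q' R s"
  shows "wp (Seq c d) (t + t') (q + q') R s"
  by (rule wp_Seq, rule wp_mono[OF assms(1)]) (auto intro: assms(2))

lemma swp_wp: "swp c R s \<Longrightarrow> straight_queries c = q \<Longrightarrow> wp c (straight_ops c) q R s"
  by (simp add: swp_def)

section \<open>Setup of the step size and the loop bounds\<close>

definition blank :: "state \<Rightarrow> bool" where
  "blank s \<longleftrightarrow> ireg s ''bi'' = 0 \<and> ireg s ''bj'' = 0 \<and> arr s ''P'' = (\<lambda>_. 0) \<and>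
     arr s ''S'' 0 = 0 \<and> arr s ''V'' 0 = 0"

definition setup_cost :: nat where
  "setup_cost = straight_ops (RAssign ''h'' (IConst 0) (RMul (cell ''h'') (RConst ((1/2) ^ P))))
     + icost (imul K (IVar ''l'')) + icost (imul B (IVar ''n'')) + 60"

lemma setup_correct:
  assumes s: "ireg s ''n'' = n" "ireg s ''l'' = 0" "blank s"
  shows "wp (setup_prog K P B) (setup_cost * n\<^sup>2) 0 (\<lambda>s. env s \<and> blank s) s"
proof -
  let ?N = "\<lambda>s. ireg s ''n'' = n \<and> blank s"
  let ?wb = "Seq (IAssign ''p'' (IAdd (IVar ''p'') (IVar ''p''))) (IAssign ''l'' (IAdd (IVar ''l'') (IConst 1)))"
  let ?hs = "RAssign ''h'' (IConst 0) (RMul (cell ''h'') (RConst ((1/2) ^ P)))"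
  let ?cm = "Seq (IAssign ''M'' (imul K (IVar ''l''))) (IAssign ''N'' (imul B (IVar ''n'')))"
  let ?tj = "l * (straight_ops ?hs + 1 + 6) + 1 + 4"
  have 1: "wp (IAssign ''p'' (IConst 1)) 2 0 (\<lambda>s. ?N s \<and> ireg s ''p'' = 1 \<and> ireg s ''l'' = 0) s"
    by (rule wp_mono[OF swp_wp[OF swp_IAssign]]) (use s in \<open>auto simp: blank_def\<close>)
  have 2: "wp (While (ILess (IVar ''p'') (IVar ''n'')) ?wb) (l * (8 + 3) + 3) (l * 0)
      (\<lambda>s. ?N s \<and> ireg s ''l'' = l) s"
    if "?N s \<and> ireg s ''p'' = 1 \<and> ireg s ''l'' = 0" for s
  proof -
    have "wp (While (ILess (IVar ''p'') (IVar ''n'')) ?wb)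
        (l * (8 + bcost (ILess (IVar ''p'') (IVar ''n''))) + bcost (ILess (IVar ''p'') (IVar ''n''))) (l * 0)
      (\<lambda>s. ?N s \<and> ireg s ''l'' = l) s"
    \<comment> \<open>By minimality of \<open>level n\<close>, the test \<open>2 ^ j < n\<close>
      holds for \<open>j < l\<close> and fails at \<open>l\<close>, so the doubling loop runs
      exactly \<open>l\<close> rounds.\<close>
    proof (rule wp_While[where I = "\<lambda>j s. ?N s \<and> ireg s ''p'' = 2 ^ j \<and> ireg s ''l'' = j"], goal_cases)
      case (2 j s)
      have "swp ?wb (\<lambda>s. ?N s \<and> ireg s ''p'' = 2 ^ Suc j \<and> ireg s ''l'' = Suc j) (tick 3 s)"
        by (intro swp_intros) (use 2 in \<open>auto simp: tick_def blank_def\<close>)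
      then show ?case using 2 level(2)[of j] by (simp add: swp_def eval_nat_numeral)
    qed (use that level(1) in \<open>auto simp: tick_def blank_def not_less\<close>)
    then show ?thesis by (simp add: eval_nat_numeral)
  qed
  have 3: "wp (RAssign ''h'' (IConst 0) (RConst 1)) 3 0
      (\<lambda>s. ?N s \<and> ireg s ''l'' = l \<and> arr s ''h'' 0 = 1) s"
    if "?N s \<and> ireg s ''l'' = l" for s
    by (rule wp_mono[OF swp_wp[OF swp_RAssign]]) (use that in \<open>auto simp: blank_def\<close>)
  have 4: "wp (For ''i'' (IVar ''l'') (For ''j'' (IVar ''l'') ?hs))
      (l * (?tj + icost (IVar ''l'') + 6) + icost (IVar ''l'') + 4) (l * (l * 0))
      (\<lambda>s. ?N s \<and> ireg s ''l'' = l \<and> arr s ''h'' 0 = h) s"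
    if "?N s \<and> ireg s ''l'' = l \<and> arr s ''h'' 0 = 1" for s
  proof (rule wp_For[where I = "\<lambda>i s. ?N s \<and> ireg s ''l'' = l \<and> arr s ''h'' 0 = (1/2) ^ (P * (i * l))"], goal_cases)
    case (5 i s)
    have "wp (For ''j'' (IVar ''l'') ?hs)
        (l * (straight_ops ?hs + icost (IVar ''l'') + 6) + icost (IVar ''l'') + 4) (l * 0)
      (\<lambda>s. (?N s \<and> ireg s ''l'' = l \<and> arr s ''h'' 0 = (1/2) ^ (P * (Suc i * l))) \<and> ireg s ''i'' = i) s"
    proof (rule wp_For[where I = "\<lambda>j s. ?N s \<and> ireg s ''l'' = l \<and> ireg s ''i'' = i \<and>
        arr s ''h'' 0 = (1/2) ^ (P * (i * l + j))"], goal_cases)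
      case (5 j s)
      then show ?case
        by (intro swp_wp swp_RAssign) (simp_all add: blank_def of_rat_power of_rat_divide power_add ac_simps)
    qed (use 5 in \<open>simp_all add: tick_def set_ireg_def blank_def add.commute\<close>)
    then show ?case by (simp del: straight_ops.simps)
  qed (use that in \<open>simp_all add: tick_def set_ireg_def blank_def h_def power2_eq_square\<close>)
  have 5: "wp ?cm (straight_ops ?cm) 0 (\<lambda>s. env s \<and> blank s) s"
    if "?N s \<and> ireg s ''l'' = l \<and> arr s ''h'' 0 = h" for s
    by (intro swp_wp swp_intros) (use that in \<open>simp_all add: blank_def env_def\<close>)
  have "wp (setup_prog K P B) (2 + (l * (8 + 3) + 3 + (3 + (l * (?tj + icost (IVar ''l'') + 6)
      + icost (IVar ''l'') + 4 + straight_ops ?cm)))) (0 + (l * 0 + (0 + (l * (l * 0) + 0))))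
      (\<lambda>s. env s \<and> blank s) s"
    unfolding setup_prog_def
    by (rule wp_Seq'[OF 1 wp_Seq'[OF 2 wp_Seq'[OF 3 wp_Seq'[OF 4 5]]]])
  then show ?thesis
  proof (rule wp_mono)
    define x where "x = straight_ops ?hs"
    have sq: "l \<le> n\<^sup>2" "l * l \<le> n\<^sup>2" "1 \<le> n\<^sup>2"
      using level(4) n2 by (auto simp: power2_eq_square intro: mult_le_mono le_trans[of l n])
    have "l * l * (x + 7) \<le> n\<^sup>2 * (x + 7)" using sq(2) by (rule mult_right_mono) simp
    moreover have "straight_ops ?cm * 1 \<le> straight_ops ?cm * n\<^sup>2" using sq(3) by (intro mult_left_mono) auto
    moreover have "setup_cost * n\<^sup>2 = n\<^sup>2 * (x + 7) + straight_ops ?cm * n\<^sup>2 + 51 * n\<^sup>2"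
      by (simp add: setup_cost_def x_def algebra_simps)
    moreover have "2 + (l * (8 + 3) + 3 + (3 + (l * (?tj + icost (IVar ''l'') + 6)
      + icost (IVar ''l'') + 4 + straight_ops ?cm))) = l * l * (x + 7) + 23 * l + 13 + straight_ops ?cm * 1"
      unfolding x_def[symmetric] by (simp add: algebra_simps)
    ultimately show "2 + (l * (8 + 3) + 3 + (3 + (l * (?tj + icost (IVar ''l'') + 6)
      + icost (IVar ''l'') + 4 + straight_ops ?cm))) \<le> setup_cost * n\<^sup>2"
      using sq by linarith
  qed auto
qed

end

lemma sum_single_point:
  fixes a :: "'i \<Rightarrow> real"
  assumes "finite I" "i \<in> I"
  shows "(\<Sum>k\<in>I. a k * ((\<lambda>_. 0)(i := t)) k) = t * a i" "L2_set ((\<lambda>_. 0)(i := t)) I = \<bar>t\<bar>"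
proof -
  have "(\<Sum>k\<in>I. a k * ((\<lambda>_. 0)(i := t)) k) = (\<Sum>k\<in>I. if k = i then t * a i else 0)"
    by (intro sum.cong) auto
  then show "(\<Sum>k\<in>I. a k * ((\<lambda>_. 0)(i := t)) k) = t * a i" using assms by simp
  have "(\<Sum>k\<in>I. (((\<lambda>_. 0)(i := t)) k)\<^sup>2) = (\<Sum>k\<in>I. if k = i then t\<^sup>2 else 0)"
    by (intro sum.cong) auto
  then show "L2_set ((\<lambda>_. 0)(i := t)) I = \<bar>t\<bar>" using assms by (simp add: L2_set_def)
qed

context ridge_oracle
begin

lemma query_axis:
  assumes "i < n" "\<bar>t\<bar> \<le> 1"
  shows "restrict ((\<lambda>_. 0)(i := t)) {..<n} \<in> unit_ball n"
    "f (restrict ((\<lambda>_. 0)(i := t)) {..<n}) = \<psi> (t * a i)"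
  using query_point[of "(\<lambda>_. 0)(i := t)"] sum_single_point[of "{..<n}" i] assms by auto

text \<open>\<open>g\<close> is a sum of two one-coordinate vectors, which covers
  \<open>i = k\<close> without a case distinction; the triangle inequality keeps it in the
  ball.\<close>

lemma query_two_axes:
  assumes "i < n" "k < n" "\<bar>t\<bar> + \<bar>u\<bar> \<le> 1"
  defines "g \<equiv> ((\<lambda>_. 0)(i := t))(k := ((\<lambda>_. 0)(i := t)) k + u)"
  shows "restrict g {..<n} \<in> unit_ball n" "f (restrict g {..<n}) = \<psi> (t * a i + u * a k)"
proof -
  have g: "g = (\<lambda>j. ((\<lambda>_. 0)(i := t)) j + ((\<lambda>_. 0)(k := u)) j)" by (auto simp: g_def fun_eq_iff)
  have "L2_set g {..<n} \<le> \<bar>t\<bar> + \<bar>u\<bar>"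
    unfolding g using L2_set_triangle_ineq[of "(\<lambda>_. 0)(i := t)" "(\<lambda>_. 0)(k := u)" "{..<n}"]
      assms(1,2) by (simp only: sum_single_point finite_lessThan lessThan_iff)
  then have L2: "L2_set g {..<n} \<le> 1" using assms by simp
  have "(\<Sum>j<n. a j * g j) = t * a i + u * a k"
    unfolding g distrib_left sum.distrib using assms by (simp only: sum_single_point finite_lessThan lessThan_iff)
  then show "restrict g {..<n} \<in> unit_ball n" "f (restrict g {..<n}) = \<psi> (t * a i + u * a k)"
    using query_point[OF L2] by auto
qed

text \<open>
  The rules above copy the state several times, so that iterating them leads to terms of exponential
  size; the following variants name each intermediate state instead.
\<close>

lemma step_IAssign:
  "(\<And>s'. ireg s' = (ireg s)(v := ival e s) \<Longrightarrow> arr s' = arr s \<Longrightarrow> R s') \<Longrightarrow> swp (IAssign v e) R s"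
  by (rule swp_IAssign) simp

lemma step_RAssign:
  "(\<And>s'. ireg s' = ireg s \<Longrightarrow> arr s' = (arr s)(v := (arr s v)(ival i s := rval r s)) \<Longrightarrow> R s') \<Longrightarrow>
    swp (RAssign v i r) R s"
  by (rule swp_RAssign) simp

lemma step_Query:
  assumes "restrict (arr s p) {..<n} \<in> unit_ball n"
    and "\<And>y s'. \<bar>y - f (restrict (arr s p) {..<n})\<bar> \<le> \<epsilon> \<Longrightarrow> ireg s' = ireg s \<Longrightarrow>
      arr s' = (arr s)(v := (arr s v)(ival i s := y)) \<Longrightarrow> R s'"
  shows "swp (Query v i p) R s"
  by (rule swp_Query[OF assms(1)]) (rule assms(2), simp_all)

lemma step_If:
  assumes "\<And>s'. bval b s \<Longrightarrow> ireg s' = ireg s \<Longrightarrow> arr s' = arr s \<Longrightarrow> swp c R s'"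
    and "\<And>s'. \<not> bval b s \<Longrightarrow> ireg s' = ireg s \<Longrightarrow> arr s' = arr s \<Longrightarrow> swp d R s'"
  shows "swp (If b c d) R s"
  by (rule swp_If) (rule assms, simp_all add: tick_def)+

lemmas steps = swp_Skip swp_Seq step_IAssign step_RAssign step_Query step_If

section \<open>The search over axes and nodes\<close>

definition increment :: "nat \<Rightarrow> nat \<Rightarrow> real" where
  "increment i j = \<psi> ((node j + h) * a i) - \<psi> (node j * a i)"

text \<open>A maximum under noise: a difference of two answers is off by at most
  \<open>2 * \<epsilon>\<close>, so the record \<open>V\<close> bounds all true increments from
  above and the recorded one from below up to that error.\<close>

definition found :: "(nat \<times> nat) set \<Rightarrow> state \<Rightarrow> bool" where
  "found A s \<longleftrightarrow> ireg s ''bi'' < n \<and> ireg s ''bj'' < K * l \<and>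
     (\<forall>(i, j)\<in>A. \<bar>increment i j\<bar> \<le> arr s ''V'' 0 + 2 * \<epsilon>) \<and>
     arr s ''V'' 0 \<le> \<bar>increment (ireg s ''bi'') (ireg s ''bj'')\<bar> + 2 * \<epsilon>"

definition searching :: "(nat \<times> nat) set \<Rightarrow> state \<Rightarrow> bool" where
  "searching A s \<longleftrightarrow> env s \<and> arr s ''P'' = (\<lambda>_. 0) \<and> arr s ''S'' 0 = 0 \<and> found A s"

lemma search_step_correct:
  assumes "i < n" "j < K * l" "searching A s" "ireg s ''i'' = i" "ireg s ''j'' = j"
  shows "swp (search_step T) (\<lambda>s. searching (insert (i, j) A) s \<and> ireg s ''i'' = i \<and> ireg s ''j'' = j) s"
proof -
  have nj: "\<bar>node j\<bar> \<le> 1" "\<bar>node j + h\<bar> \<le> 1" using node[OF assms(2)] h by auto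
  have N: "real j / (real T * (real K * real l)) = node j" by (simp add: node_def)
  note s = assms(3)[unfolded searching_def env_def found_def] assms(4,5)
  note q1 = query_axis[OF assms(1) nj(1)] and q2 = query_axis[OF assms(1) nj(2)]
  have Z: "(\<lambda>_. 0::real)(i := 0) = (\<lambda>_. 0)" by auto
  have key: "\<bar>increment i j\<bar> \<le> \<bar>y2 - y1\<bar> + 2 * \<epsilon> \<and> \<bar>y2 - y1\<bar> \<le> \<bar>increment i j\<bar> + 2 * \<epsilon>"
    if "\<bar>y1 - \<psi> (node j * a i)\<bar> \<le> \<epsilon>" "\<bar>y2 - \<psi> ((node j + h) * a i)\<bar> \<le> \<epsilon>" for y1 y2
    using that unfolding increment_def by linarith
  show ?thesis unfolding search_step_def
  proof (intro steps, goal_cases)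
    case 1
    then show ?case by (simp add: s N q1)
  next
    case 2
    then show ?case by (simp add: s N q1 q2)
  next
    \<comment> \<open>The record is beaten: the bounds for earlier pairs only get weaker, and the
      new pair takes over.\<close>
    case p: (3 s1 y1 s2 s3 y2 s4 s5 s6 s7 s8 s9 s10)
    have y: "\<bar>y1 - \<psi> (node j * a i)\<bar> \<le> \<epsilon>" "\<bar>y2 - \<psi> ((node j + h) * a i)\<bar> \<le> \<epsilon>"
      using p by (simp_all add: s N q1 q2)
    have D: "arr s6 ''D'' 0 = \<bar>y2 - y1\<bar>" "arr s ''V'' 0 < \<bar>y2 - y1\<bar>"
      using p by (simp_all add: s)
    have m: "env s10" "arr s10 ''P'' = (\<lambda>_. 0)" "arr s10 ''S'' 0 = 0" "arr s10 ''V'' 0 = \<bar>y2 - y1\<bar>"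
      "ireg s10 ''bi'' = i" "ireg s10 ''bj'' = j" "ireg s10 ''i'' = i" "ireg s10 ''j'' = j"
      using p D(1) by (simp_all add: env_def s Z)
    have "\<bar>increment i' j'\<bar> \<le> \<bar>y2 - y1\<bar> + 2 * \<epsilon>" if "(i', j') \<in> insert (i, j) A" for i' j'
    proof (cases "(i', j') \<in> A")
      case True
      then have "\<bar>increment i' j'\<bar> \<le> arr s ''V'' 0 + 2 * \<epsilon>" using s by fast
      then show ?thesis using D(2) by linarith
    next
      case False
      then show ?thesis using that key[OF y] by simp
    qed
    then show ?case using key[OF y] assms(1,2) by (auto simp: searching_def found_def m)
  next
    \<comment> \<open>The record stands, so the new measured difference is at most
      \<open>V\<close>.\<close>
    case p: (4 s1 y1 s2 s3 y2 s4 s5 s6 s7)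
    have y: "\<bar>y1 - \<psi> (node j * a i)\<bar> \<le> \<epsilon>" "\<bar>y2 - \<psi> ((node j + h) * a i)\<bar> \<le> \<epsilon>"
      using p by (simp_all add: s N q1 q2)
    have D: "\<bar>y2 - y1\<bar> \<le> arr s ''V'' 0"
      using p by (simp add: s)
    have m: "env s7" "arr s7 ''P'' = (\<lambda>_. 0)" "arr s7 ''S'' 0 = 0" "arr s7 ''V'' 0 = arr s ''V'' 0"
      "ireg s7 = ireg s" "ireg s ''i'' = i" "ireg s ''j'' = j"
      using p by (simp_all add: env_def s Z)
    have "\<bar>increment i' j'\<bar> \<le> arr s ''V'' 0 + 2 * \<epsilon>" if "(i', j') \<in> insert (i, j) A" for i' j'
    proof (cases "(i', j') \<in> A")
      case True
      then show ?thesis using s by fast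
    next
      case False
      then show ?thesis using that key[OF y] D by simp
    qed
    then show ?case using s by (auto simp: searching_def found_def m)
  qed
qed

definition search_cost :: nat where
  "search_cost = K * (straight_ops (search_step T) + 7) + 20"

lemma search_correct:
  assumes "env s" "blank s"
  shows "wp (search_prog T) (search_cost * n\<^sup>2) (2 * n * (K * l)) (searching ({..<n} \<times> {..<K * l})) s"
proof -
  let ?S = "straight_ops (search_step T)"
  have q2: "straight_queries (search_step T) = 2" by (simp add: search_step_def)
  have inv: "searching A (tick k s) = searching A s"
    "v \<in> {''i'', ''j'', ''k''} \<Longrightarrow> searching A (set_ireg v x s) = searching A s" for A k v x s
    by (auto simp: searching_def found_def env_def tick_def set_ireg_def)
  have \<epsilon>: "0 \<le> \<epsilon>" using answer[of 0 undefined] by linarith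
  have "wp (search_prog T) (n * ((K * l * (?S + icost (IVar ''M'') + 6) + icost (IVar ''M'') + 4)
      + icost (IVar ''n'') + 6) + icost (IVar ''n'') + 4) (n * (K * l * 2)) (searching ({..<n} \<times> {..<K * l})) s"
    unfolding search_prog_def
  proof (rule wp_For[where I = "\<lambda>i. searching ({..<i} \<times> {..<K * l})"], goal_cases)
    case 1
    \<comment> \<open>Before any query the record is \<open>V = 0\<close> at axis 0 and node 0,
      which are in range since \<open>n\<close> and \<open>K * l\<close> are positive.\<close>
    have "0 < K * l" using K0 level(3) by simp
    then show ?case using assms n2 \<epsilon> by (simp add: searching_def found_def blank_def)
  next
    case (5 i s)
    have "wp (For ''j'' (IVar ''M'') (search_step T)) (K * l * (?S + icost (IVar ''M'') + 6) + icost (IVar ''M'') + 4)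
      (K * l * 2) (\<lambda>s. searching ({..<Suc i} \<times> {..<K * l}) s \<and> ireg s ''i'' = i) s"
    proof (rule wp_For[where I = "\<lambda>j s. searching ({..<i} \<times> {..<K * l} \<union> {i} \<times> {..<j}) s \<and> ireg s ''i'' = i"], goal_cases)
      case 2 then show ?case unfolding inv by (simp add: tick_def)
    next
      case 3 then show ?case by (simp add: inv) (simp add: set_ireg_def)
    next
      case (4 j s) then show ?case by (simp add: searching_def env_def)
    next
      case (5 j s)
      let ?A = "{..<i} \<times> {..<K * l} \<union> {i} \<times> {..<j}"
      have e: "insert (i, j) ?A = {..<i} \<times> {..<K * l} \<union> {i} \<times> {..<Suc j}" by auto
      have "wp (search_step T) ?S 2 (\<lambda>s. searching (insert (i, j) ?A) s \<and> ireg s ''i'' = i \<and> ireg s ''j'' = j) s"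
        by (rule swp_wp[OF search_step_correct q2]) (use 5 \<open>i < n\<close> in auto)
      then show ?case unfolding e by (rule wp_mono) auto
    next
      case (6 s)
      have "{..<i} \<times> {..<K * l} \<union> {i} \<times> {..<K * l} = {..<Suc i} \<times> {..<K * l}" by auto
      then show ?case using 6 by simp
    qed (use 5 in auto)
    then show ?case .
  next
    case (4 j s) then show ?case by (simp add: searching_def env_def)
  qed (auto simp: inv)
  then show ?thesis
  proof (rule wp_mono)
    have sq: "n * l \<le> n\<^sup>2" "n \<le> n\<^sup>2" "1 \<le> n\<^sup>2" using level(4) n2 by (auto simp: power2_eq_square)
    have "n * l * (K * (?S + 7)) \<le> n\<^sup>2 * (K * (?S + 7))" using sq(1) by (rule mult_right_mono) simp
    moreover have "search_cost * n\<^sup>2 = n\<^sup>2 * (K * (?S + 7)) + 20 * n\<^sup>2"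
      by (simp add: search_cost_def algebra_simps)
    moreover have "n * ((K * l * (?S + icost (IVar ''M'') + 6) + icost (IVar ''M'') + 4)
      + icost (IVar ''n'') + 6) + icost (IVar ''n'') + 4 = n * l * (K * (?S + 7)) + 12 * n + 5"
      by (simp add: algebra_simps)
    ultimately show "n * ((K * l * (?S + icost (IVar ''M'') + 6) + icost (IVar ''M'') + 4)
      + icost (IVar ''n'') + 6) + icost (IVar ''n'') + 4 \<le> search_cost * n\<^sup>2"
      using sq by linarith
  qed auto
qed

section \<open>Forward differences at the chosen node and their normalization\<close>

definition gradient :: "nat \<Rightarrow> nat \<Rightarrow> nat \<Rightarrow> real" where
  "gradient i j k = \<psi> (node j * a i + h * a k) - \<psi> (node j * a i)"

definition differencing :: "nat \<Rightarrow> state \<Rightarrow> bool" where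
  "differencing k s \<longleftrightarrow> env s \<and> found ({..<n} \<times> {..<K * l}) s \<and>
     arr s ''P'' = (\<lambda>_. 0)(ireg s ''bi'' := node (ireg s ''bj'')) \<and>
     \<bar>arr s ''u'' 0 - \<psi> (node (ireg s ''bj'') * a (ireg s ''bi''))\<bar> \<le> \<epsilon> \<and>
     (\<forall>i<k. \<bar>arr s ''d'' i - gradient (ireg s ''bi'') (ireg s ''bj'') i\<bar> \<le> 2 * \<epsilon>) \<and>
     arr s ''S'' 0 = (\<Sum>i<k. (arr s ''d'' i)\<^sup>2)"

lemma base_correct:
  assumes "searching ({..<n} \<times> {..<K * l}) s"
  shows "swp (base_prog T) (differencing 0) s"
proof -
  note s = assms[unfolded searching_def env_def]
  have b: "ireg s ''bi'' < n" "ireg s ''bj'' < K * l" using s by (auto simp: found_def)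
  have N: "real (ireg s ''bj'') / (real T * (real K * real l)) = node (ireg s ''bj'')" by (simp add: node_def)
  have nj: "\<bar>node (ireg s ''bj'')\<bar> \<le> 1" using node[OF b(2)] by auto
  note q1 = query_axis[OF b(1) nj]
  show ?thesis unfolding base_prog_def
  proof (intro steps, goal_cases)
    case 1
    then show ?case by (simp add: s N q1)
  next
    case (2 s1 y s2)
    then show ?case using s by (simp add: N q1 differencing_def env_def found_def)
  qed
qed

lemma difference_step_correct:
  assumes "k < n" "differencing k s" "ireg s ''k'' = k"
  shows "swp difference_step (\<lambda>s. differencing (Suc k) s \<and> ireg s ''k'' = k) s"
proof -
  note s = assms(2)[unfolded differencing_def env_def] assms(3)
  let ?i = "ireg s ''bi''" and ?j = "ireg s ''bj''"
  have b: "?i < n" "?j < K * l" using s by (auto simp: found_def)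
  have "\<bar>node ?j\<bar> + \<bar>h\<bar> \<le> 1" using node[OF b(2)] h by auto
  note q' = query_two_axes[OF b(1) assms(1) this]
  define g where "g = (\<lambda>_. 0)(?i := node ?j)"
  note q = q'[folded g_def]
  have P: "arr s ''P'' = g" and h': "arr s ''h'' 0 = h"
    using s by (auto simp: g_def)
  show ?thesis unfolding difference_step_def
  proof (intro steps, goal_cases)
    case (1 s1)
    then show ?case by (simp add: P h' assms(3) q)
  next
    case p: (2 s1 y s2 s3 s4 s5)
    have y: "\<bar>y - \<psi> (node ?j * a ?i + h * a k)\<bar> \<le> \<epsilon>"
      using p by (simp add: P h' assms(3) q)
    have s5: "ireg s5 = ireg s" "arr s5 ''P'' = arr s ''P''" "arr s5 ''d'' = (arr s ''d'')(k := y - arr s ''u'' 0)"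
      "arr s5 ''S'' 0 = arr s ''S'' 0 + (y - arr s ''u'' 0)\<^sup>2" "\<And>v. v \<notin> {''P'', ''w'', ''d'', ''S''} \<Longrightarrow> arr s5 v = arr s v"
      using p by (simp_all add: h' assms(3) power2_eq_square)
    have "\<bar>(y - arr s ''u'' 0) - gradient ?i ?j k\<bar> \<le> 2 * \<epsilon>"
      using s y unfolding gradient_def by linarith
    then show ?case using s by (auto simp: differencing_def env_def found_def s5 less_Suc_eq)
  qed
qed

definition direction_cost :: nat where
  "direction_cost = straight_ops (base_prog T) + straight_ops difference_step + straight_ops normalize_step + 30"

text \<open>The hypotheses of \<open>direction_recovery\<close> on the differences, with the machine
  state forgotten: axis, node and record survive only as existential witnesses.\<close>

definition good_differences :: "(nat \<Rightarrow> real) \<Rightarrow> bool" where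
  "good_differences d \<longleftrightarrow> (\<exists>bi<n. \<exists>bj<K * l. \<exists>V.
     (\<forall>i<n. \<forall>j<K * l. \<bar>increment i j\<bar> \<le> V + 2 * \<epsilon>) \<and> V \<le> \<bar>increment bi bj\<bar> + 2 * \<epsilon> \<and>
     (\<forall>i<n. \<bar>d i - gradient bi bj i\<bar> \<le> 2 * \<epsilon>))"

definition normalized :: "(nat \<Rightarrow> real) \<Rightarrow> nat \<Rightarrow> real" where
  "normalized d k = d k / sqrt (\<Sum>i<n. (d i)\<^sup>2)"

lemma direction_correct:
  assumes "searching ({..<n} \<times> {..<K * l}) s"
  shows "wp (direction_prog T) (direction_cost * n\<^sup>2) (n + 1)
    (\<lambda>s. env s \<and> (\<exists>d. good_differences d \<and> (\<forall>k<n. arr s ''v'' k = normalized d k))) s"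
proof -
  have 1: "wp (base_prog T) (straight_ops (base_prog T)) 1 (differencing 0) s"
    by (rule swp_wp[OF base_correct[OF assms]]) (simp add: base_prog_def)
  have 2: "wp (For ''k'' (IVar ''n'') difference_step)
      (n * (straight_ops difference_step + icost (IVar ''n'') + 6) + icost (IVar ''n'') + 4) (n * 1) (differencing n) s"
    if "differencing 0 s" for s
  proof (rule wp_For[where I = differencing], goal_cases)
    case (5 k s)
    then show ?case
      by (intro swp_wp difference_step_correct) (simp_all add: difference_step_def)
  qed (use that in \<open>auto simp: differencing_def found_def env_def tick_def set_ireg_def\<close>)
  have 3: "wp (For ''k'' (IVar ''n'') normalize_step)
      (n * (straight_ops normalize_step + icost (IVar ''n'') + 6) + icost (IVar ''n'') + 4) (n * 0)
      (\<lambda>s. env s \<and> (\<exists>d. good_differences d \<and> (\<forall>k<n. arr s ''v'' k = normalized d k))) s"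
    if "differencing n s" for s
  proof -
    define d where "d = arr s ''d''"
    have d: "good_differences d"
      using that unfolding differencing_def found_def good_differences_def d_def by fast
    show ?thesis
    proof (rule wp_For[where I = "\<lambda>k s. env s \<and> arr s ''d'' = d \<and> arr s ''S'' 0 = (\<Sum>i<n. (d i)\<^sup>2) \<and>
        (\<forall>i<k. arr s ''v'' i = normalized d i)"], goal_cases)
      case (5 k s)
      have "swp normalize_step (\<lambda>s. (env s \<and> arr s ''d'' = d \<and> arr s ''S'' 0 = (\<Sum>i<n. (d i)\<^sup>2) \<and>
        (\<forall>i<Suc k. arr s ''v'' i = normalized d i)) \<and> ireg s ''k'' = k) s"
        unfolding normalize_step_def
      proof (intro steps, goal_cases)
        case (1 s')
        then show ?case using 5 by (auto simp: env_def normalized_def)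
      qed
      then show ?case by (rule swp_wp) (simp add: normalize_step_def)
    qed (use that d in \<open>auto simp: differencing_def env_def tick_def set_ireg_def d_def\<close>)
  qed
  have "wp (direction_prog T) (straight_ops (base_prog T) +
      (n * (straight_ops difference_step + icost (IVar ''n'') + 6) + icost (IVar ''n'') + 4 +
      (n * (straight_ops normalize_step + icost (IVar ''n'') + 6) + icost (IVar ''n'') + 4))) (1 + (n * 1 + n * 0))
    (\<lambda>s. env s \<and> (\<exists>d. good_differences d \<and> (\<forall>k<n. arr s ''v'' k = normalized d k))) s"
    unfolding direction_prog_def by (rule wp_Seq'[OF 1 wp_Seq'[OF 2 3]])
  then show ?thesis
  proof (rule wp_mono)
    have sq: "n \<le> n\<^sup>2" "1 \<le> n\<^sup>2" using n2 by (auto simp: power2_eq_square)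
    note m = mult_le_mono2[OF sq(2), of "straight_ops (base_prog T)"]
      mult_le_mono2[OF sq(1), of "straight_ops difference_step"]
      mult_le_mono2[OF sq(1), of "straight_ops normalize_step"]
    have "straight_ops (base_prog T) +
      (n * (straight_ops difference_step + icost (IVar ''n'') + 6) + icost (IVar ''n'') + 4 +
      (n * (straight_ops normalize_step + icost (IVar ''n'') + 6) + icost (IVar ''n'') + 4))
      = straight_ops (base_prog T) * 1 + straight_ops difference_step * n + straight_ops normalize_step * n + 14 * n + 10"
      by (simp add: algebra_simps)
    also have "\<dots> \<le> straight_ops (base_prog T) * n\<^sup>2 + straight_ops difference_step * n\<^sup>2
        + straight_ops normalize_step * n\<^sup>2 + 30 * n\<^sup>2"
      using m sq by linarith
    also have "\<dots> = direction_cost * n\<^sup>2" by (simp add: direction_cost_def algebra_simps)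
    finally show "straight_ops (base_prog T) +
      (n * (straight_ops difference_step + icost (IVar ''n'') + 6) + icost (IVar ''n'') + 4 +
      (n * (straight_ops normalize_step + icost (IVar ''n'') + 6) + icost (IVar ''n'') + 4)) \<le> direction_cost * n\<^sup>2" .
  qed auto
qed

text \<open>With \<open>c = <a,v>\<close> this is \<open>\<psi>\<close> at
  \<open>c * (2 * i / N - 1)\<close>, where \<open>N = B * n\<close>: along the line of
  \<open>v\<close> the profile appears rescaled by \<open>c\<close>.\<close>

definition profile_value :: "(nat \<Rightarrow> real) \<Rightarrow> nat \<Rightarrow> real" where
  "profile_value v i = \<psi> (\<Sum>k<n. a k * ((2 * real i / real (B * n) - 1) * v k))"

definition profile_cost :: nat where
  "profile_cost = B * (straight_ops point_step + 30) + 10"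

lemma profile_correct:
  assumes "env s" "\<And>k. k < n \<Longrightarrow> arr s ''v'' k = v k" "L2_set v {..<n} \<le> 1"
  shows "wp profile_prog (profile_cost * n\<^sup>2) (B * n)
    (\<lambda>s. env s \<and> (\<forall>k<n. arr s ''v'' k = v k) \<and> (\<forall>i<B * n. \<bar>arr s ''y'' i - profile_value v i\<bar> \<le> \<epsilon>)) s"
proof -
  let ?ps = "straight_ops point_step" and ?V = "\<lambda>s. env s \<and> (\<forall>k<n. arr s ''v'' k = v k)"
  define c where "c i = 2 * real i / real (B * n) - 1" for i
  have "wp profile_prog (B * n * ((n * (?ps + icost (IVar ''n'') + 6) + icost (IVar ''n'') + 4 +
        straight_ops (Query ''y'' (IVar ''i'') ''P'')) + icost (IVar ''N'') + 6) + icost (IVar ''N'') + 4)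
      (B * n * (n * 0 + 1))
    (\<lambda>s. ?V s \<and> (\<forall>i<B * n. \<bar>arr s ''y'' i - profile_value v i\<bar> \<le> \<epsilon>)) s"
    unfolding profile_prog_def
  proof (rule wp_For[where I = "\<lambda>i s. ?V s \<and> (\<forall>i'<i. \<bar>arr s ''y'' i' - profile_value v i'\<bar> \<le> \<epsilon>)"], goal_cases)
    case (5 i s)
    let ?Y = "\<lambda>s. \<forall>i'<i. \<bar>arr s ''y'' i' - profile_value v i'\<bar> \<le> \<epsilon>"
    show ?case
    proof (rule wp_Seq'[of _ _ _ "\<lambda>s. ?V s \<and> ?Y s \<and> ireg s ''i'' = i \<and> (\<forall>k<n. arr s ''P'' k = c i * v k)"])
      show "wp (For ''k'' (IVar ''n'') point_step) (n * (?ps + icost (IVar ''n'') + 6) + icost (IVar ''n'') + 4) (n * 0)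
        (\<lambda>s. ?V s \<and> ?Y s \<and> ireg s ''i'' = i \<and> (\<forall>k<n. arr s ''P'' k = c i * v k)) s"
      proof (rule wp_For[where I = "\<lambda>k s. ?V s \<and> ?Y s \<and> ireg s ''i'' = i \<and> (\<forall>k'<k. arr s ''P'' k' = c i * v k')"], goal_cases)
        case p: (5 k s)
        have "swp point_step (\<lambda>s. (?V s \<and> ?Y s \<and> ireg s ''i'' = i \<and> (\<forall>k'<Suc k. arr s ''P'' k' = c i * v k'))
          \<and> ireg s ''k'' = k) s"
          unfolding point_step_def
        proof (intro steps, goal_cases)
          case (1 s')
          then show ?case using p by (auto simp: env_def c_def less_Suc_eq)
        qed
        then show ?case by (rule swp_wp) (simp add: point_step_def)
      qed (use 5 in \<open>auto simp: env_def tick_def set_ireg_def\<close>)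
      show "wp (Query ''y'' (IVar ''i'') ''P'') (straight_ops (Query ''y'' (IVar ''i'') ''P'')) 1
          (\<lambda>s. (?V s \<and> (\<forall>i'<Suc i. \<bar>arr s ''y'' i' - profile_value v i'\<bar> \<le> \<epsilon>)) \<and> ireg s ''i'' = i) s"
        if s: "?V s \<and> ?Y s \<and> ireg s ''i'' = i \<and> (\<forall>k<n. arr s ''P'' k = c i * v k)" for s
      proof (rule swp_wp[OF step_Query])
        have "real i \<le> real (B * n)" "0 < real (B * n)" using 5 B0 n2 by (simp_all del: of_nat_mult)
        then have "real i / real (B * n) \<le> 1" "0 \<le> real i / real (B * n)" by simp_all
        then have c1: "\<bar>c i\<bar> \<le> 1" unfolding c_def by (simp add: abs_le_iff del: of_nat_mult)
        have "L2_set (\<lambda>k. c i * v k) {..<n} = \<bar>c i\<bar> * L2_set v {..<n}"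
          by (simp add: L2_set_def power_mult_distrib sum_distrib_left[symmetric] real_sqrt_mult)
        also have "\<dots> \<le> 1" using c1 assms(3) by (simp add: mult_le_one)
        finally have L2: "L2_set (\<lambda>k. c i * v k) {..<n} \<le> 1" .
        have P: "restrict (arr s ''P'') {..<n} = restrict (\<lambda>k. c i * v k) {..<n}" using s by auto
        show "restrict (arr s ''P'') {..<n} \<in> unit_ball n" unfolding P by (rule query_point(1)[OF L2])
        fix y :: real and s' :: state
        assume y: "\<bar>y - f (restrict (arr s ''P'') {..<n})\<bar> \<le> \<epsilon>" and s': "ireg s' = ireg s"
          "arr s' = (arr s)(''y'' := (arr s ''y'')(ival (IVar ''i'') s := y))"
        have "f (restrict (arr s ''P'') {..<n}) = profile_value v i"
          unfolding P query_point(2)[OF L2] unfolding profile_value_def c_def ..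
        then show "(?V s' \<and> (\<forall>i'<Suc i. \<bar>arr s' ''y'' i' - profile_value v i'\<bar> \<le> \<epsilon>)) \<and> ireg s' ''i'' = i"
          using s y by (simp add: s' env_def less_Suc_eq)
      qed simp
    qed
  qed (use assms in \<open>auto simp: env_def tick_def set_ireg_def\<close>)
  then show ?thesis
  proof (rule wp_mono)
    have sq: "n \<le> n\<^sup>2" "1 \<le> n\<^sup>2" using n2 by (auto simp: power2_eq_square)
    have "B * n \<le> B * n\<^sup>2" using sq(1) by (rule mult_left_mono) simp
    moreover have "B * n * ((n * (?ps + icost (IVar ''n'') + 6) + icost (IVar ''n'') + 4 +
        straight_ops (Query ''y'' (IVar ''i'') ''P'')) + icost (IVar ''N'') + 6) + icost (IVar ''N'') + 4
      = B * n\<^sup>2 * (?ps + 7) + B * n * 14 + 5" by (simp add: algebra_simps power2_eq_square del: straight_ops.simps(3))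
    moreover have "profile_cost * n\<^sup>2 = B * n\<^sup>2 * (?ps + 7) + 23 * (B * n\<^sup>2) + 10 * n\<^sup>2"
      by (simp add: profile_cost_def algebra_simps)
    ultimately show "B * n * ((n * (?ps + icost (IVar ''n'') + 6) + icost (IVar ''n'') + 4 +
        straight_ops (Query ''y'' (IVar ''i'') ''P'')) + icost (IVar ''N'') + 6) + icost (IVar ''N'') + 4
      \<le> profile_cost * n\<^sup>2" using sq by linarith
  qed auto
qed

end

context ridge_oracle
begin

section \<open>Assembly of the recovery program, and the evaluation program\<close>

definition recovered :: "state \<Rightarrow> bool" where
  "recovered s \<longleftrightarrow> env s \<and> (\<exists>d. good_differences d \<and> (\<forall>k<n. arr s ''v'' k = normalized d k) \<and>
     (\<forall>i<B * n. \<bar>arr s ''y'' i - profile_value (normalized d) i\<bar> \<le> \<epsilon>))"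

definition recovery_cost :: nat where
  "recovery_cost = setup_cost + search_cost + direction_cost + profile_cost + 10"

lemma L2_set_normalized: "L2_set (normalized d) {..<n} \<le> 1"
  using L2_set_normalized_le[of d "{..<n}"] by (simp add: normalized_def[abs_def])

lemma recovery_correct:
  "wp (recovery_prog T K P B) (recovery_cost * n\<^sup>2) (2 * n * (K * l) + (n + 1) + B * n) recovered
    (initial_state n \<sigma> Q \<kappa>)"
proof -
  let ?s = "initial_state n \<sigma> Q \<kappa>"
  let ?c = "Seq (setup_prog K P B) (Seq (search_prog T) (Seq (direction_prog T) profile_prog))"
  let ?t = "setup_cost * n\<^sup>2 + (search_cost * n\<^sup>2 + (direction_cost * n\<^sup>2 + profile_cost * n\<^sup>2))"
  let ?b = "ILess (IVar ''n'') (IConst 2)"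
  have 4: "wp profile_prog (profile_cost * n\<^sup>2) (B * n) recovered s"
    if s: "env s \<and> (\<exists>d. good_differences d \<and> (\<forall>k<n. arr s ''v'' k = normalized d k))" for s
  proof -
    obtain d where d: "good_differences d" "\<forall>k<n. arr s ''v'' k = normalized d k" using s by blast
    show ?thesis
      by (rule wp_mono[OF profile_correct[of s "normalized d"]])
        (use s d L2_set_normalized in \<open>auto simp: recovered_def\<close>)
  qed
  have init: "ireg (tick (bcost ?b) ?s) ''n'' = n" "ireg (tick (bcost ?b) ?s) ''l'' = 0" "blank (tick (bcost ?b) ?s)"
    by (simp_all add: blank_def initial_state_def tick_def)
  have "wp ?c ?t (0 + (2 * n * (K * l) + (n + 1 + B * n))) recovered (tick (bcost ?b) ?s)"
    by (rule wp_Seq'[OF setup_correct[OF init] wp_Seq'[OF search_correct wp_Seq'[OF direction_correct 4]]])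
      auto
  then obtain s' xs where 1: "exec n answer \<omega> ?c (tick (bcost ?b) ?s) s'" "recovered s'"
    "ops s' \<le> ops (tick (bcost ?b) ?s) + ?t" "draws s' = draws (tick (bcost ?b) ?s)"
    "queries s' = queries (tick (bcost ?b) ?s) @ xs"
    "length xs \<le> 0 + (2 * n * (K * l) + (n + 1 + B * n))" "set xs \<subseteq> unit_ball n"
    by (rule wpE)
  have nb: "\<not> bval ?b ?s" using n2 by (simp add: initial_state_def)
  show ?thesis unfolding recovery_prog_def
  proof (rule wpI[OF exec.IfFalse[OF nb 1(1)], where xs = xs])
    have "1 \<le> n\<^sup>2" using n2 by simp
    moreover have "recovery_cost * n\<^sup>2 = ?t + 10 * n\<^sup>2" by (simp add: recovery_cost_def algebra_simps)
    ultimately show "ops s' \<le> ops ?s + recovery_cost * n\<^sup>2" using 1(3) by (simp add: tick_def)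
  qed (use 1 in \<open>simp_all add: tick_def\<close>)
qed

definition newton_step :: "nat \<Rightarrow> com" where
  "newton_step m = RAssign ''out'' (IConst 0) (newton_exp
     (map (\<lambda>j. (of_nat j, RCell ''y'' (IAdd (IVar ''b'') (IConst j)))) [0..<m])
     (RSub (cell ''Y'') (RNat (IVar ''b''))))"

definition evaluation_cost :: "nat \<Rightarrow> nat" where
  "evaluation_cost m = straight_ops (newton_step m) + 40 * B + 100"

lemma evaluation_correct:
  assumes s: "env s" "\<bar>\<Sum>k<n. arr s ''v'' k * x k\<bar> \<le> 1"
  shows "wp (evaluation_prog m) (evaluation_cost m * n\<^sup>2) 0
    (\<lambda>t. arr t ''out'' 0 = piecewise_newton m (B * n) (arr s ''y'') (\<Sum>k<n. arr s ''v'' k * x k))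
    (load_point n x s)"
proof -
  define t where "t = (\<Sum>k<n. arr s ''v'' k * x k)"
  define Y where "Y = (t + 1) * real (B * n) / 2"
  define b where "b = nat \<lceil>Y - real m\<rceil>"
  let ?F = "\<lambda>s'. ireg s' ''n'' = n \<and> ireg s' ''N'' = B * n \<and> arr s' ''y'' = arr s ''y''"
  let ?G = "\<lambda>s'. ?F s' \<and> (\<forall>k<n. arr s' ''v'' k = arr s ''v'' k \<and> arr s' ''x'' k = x k)"
  let ?ts = "RAssign ''t'' (IConst 0) (RAdd (cell ''t'') (RMul (RCell ''v'' (IVar ''k'')) (RCell ''x'' (IVar ''k''))))"
  let ?ys = "RAssign ''Y'' (IConst 0) (RDiv (RMul (RAdd (cell ''t'') (RConst 1)) (RNat (IVar ''N''))) (RConst 2))"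
  let ?ls = "RLess (RNat (IAdd (IVar ''b'') (IConst m))) (cell ''Y'')"
  let ?bs = "IAssign ''b'' (IAdd (IVar ''b'') (IConst 1))"
  let ?b = "ILess (IVar ''n'') (IConst 2)"
  let ?s = "load_point n x s"
  have 1: "wp (RAssign ''t'' (IConst 0) (RConst 0)) 3 0 (\<lambda>s'. ?G s' \<and> arr s' ''t'' 0 = 0) (tick (bcost ?b) ?s)"
    by (rule wp_mono[OF swp_wp[OF step_RAssign]]) (use s in \<open>auto simp: load_point_def tick_def env_def\<close>)
  have 2: "wp (For ''k'' (IVar ''n'') ?ts) (n * (straight_ops ?ts + icost (IVar ''n'') + 6) + icost (IVar ''n'') + 4)
      (n * 0) (\<lambda>s'. ?F s' \<and> arr s' ''t'' 0 = t) s'" if "?G s' \<and> arr s' ''t'' 0 = 0" for s'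
  proof (rule wp_For[where I = "\<lambda>k s'. ?G s' \<and> arr s' ''t'' 0 = (\<Sum>i<k. arr s ''v'' i * x i)"], goal_cases)
    case (5 k s')
    have "swp ?ts (\<lambda>s'. (?G s' \<and> arr s' ''t'' 0 = (\<Sum>i<Suc k. arr s ''v'' i * x i)) \<and> ireg s' ''k'' = k) s'"
      by (rule step_RAssign) (use 5 in simp)
    then show ?case by (rule swp_wp) simp
  qed (use that in \<open>simp_all add: tick_def set_ireg_def t_def\<close>)
  have 3: "wp ?ys (straight_ops ?ys) 0 (\<lambda>s'. ?F s' \<and> arr s' ''Y'' 0 = Y) s'" if "?F s' \<and> arr s' ''t'' 0 = t" for s'
    by (rule swp_wp[OF step_RAssign]) (use that in \<open>simp_all add: Y_def\<close>)
  have 4: "wp (IAssign ''b'' (IConst 0)) 2 0 (\<lambda>s'. ?F s' \<and> arr s' ''Y'' 0 = Y \<and> ireg s' ''b'' = 0) s'"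
    if "?F s' \<and> arr s' ''Y'' 0 = Y" for s'
    by (rule wp_mono[OF swp_wp[OF step_IAssign]]) (use that in auto)
  have 5: "wp (While ?ls ?bs) (b * (straight_ops ?bs + bcost ?ls) + bcost ?ls) (b * 0)
      (\<lambda>s'. ?F s' \<and> arr s' ''Y'' 0 = Y \<and> ireg s' ''b'' = b) s'"
    if "?F s' \<and> arr s' ''Y'' 0 = Y \<and> ireg s' ''b'' = 0" for s'
  proof (rule wp_While[where I = "\<lambda>j s'. ?F s' \<and> arr s' ''Y'' 0 = Y \<and> ireg s' ''b'' = j"], goal_cases)
    case (2 j s')
    \<comment> \<open>For naturals \<open>j < nat \<lceil>Y - real m\<rceil>\<close> means
      \<open>j < Y - m\<close>, so the counting loop stops at \<open>b\<close>.\<close>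
    have "real j < Y - real m" using 2(1) unfolding b_def by (simp add: zless_nat_eq_int_zless less_ceiling_iff)
    moreover have "wp ?bs (straight_ops ?bs) 0 (\<lambda>s'. ?F s' \<and> arr s' ''Y'' 0 = Y \<and> ireg s' ''b'' = Suc j) (tick (bcost ?ls) s')"
      by (rule swp_wp[OF step_IAssign]) (use 2 in \<open>simp_all add: tick_def\<close>)
    ultimately show ?case using 2 by simp
  next
    case (3 s')
    have "Y - real m \<le> real b" unfolding b_def by (rule real_nat_ceiling_ge)
    then show ?case using 3 by (simp add: tick_def)
  qed (use that in auto)
  have pn: "piecewise_newton m (B * n) (arr s ''y'') t
      = newton (map (\<lambda>j. (real j, arr s ''y'' (b + j))) [0..<m]) (Y - real b)"
    by (simp only: piecewise_newton_def Let_def Y_def b_def)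
  have 6: "wp (newton_step m) (straight_ops (newton_step m)) 0
    (\<lambda>s'. arr s' ''out'' 0 = piecewise_newton m (B * n) (arr s ''y'') t) s'"
    if "?F s' \<and> arr s' ''Y'' 0 = Y \<and> ireg s' ''b'' = b" for s'
    unfolding newton_step_def
    by (rule swp_wp[OF step_RAssign])
      (use that in \<open>simp_all add: rval_newton_exp comp_def pn\<close>)
  let ?t = "3 + (n * (straight_ops ?ts + icost (IVar ''n'') + 6) + icost (IVar ''n'') + 4 + (straight_ops ?ys +
    (2 + (b * (straight_ops ?bs + bcost ?ls) + bcost ?ls) + straight_ops (newton_step m))))"
  let ?c = "Seq (RAssign ''t'' (IConst 0) (RConst 0)) (Seq (For ''k'' (IVar ''n'') ?ts)
    (Seq ?ys (Seq (locate_prog m) (newton_step m))))"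
  have "wp ?c ?t (0 + (n * 0 + (0 + (0 + b * 0 + 0)))) (\<lambda>s'. arr s' ''out'' 0 = piecewise_newton m (B * n) (arr s ''y'') t)
      (tick (bcost ?b) ?s)"
    unfolding locate_prog_def
    by (rule wp_Seq'[OF 1 wp_Seq'[OF 2 wp_Seq'[OF 3 wp_Seq'[OF wp_Seq'[OF 4 5] 6]]]])
  then obtain s' xs where e: "exec n answer \<omega> ?c (tick (bcost ?b) ?s) s'"
    "arr s' ''out'' 0 = piecewise_newton m (B * n) (arr s ''y'') t"
    "ops s' \<le> ops (tick (bcost ?b) ?s) + ?t" "draws s' = draws (tick (bcost ?b) ?s)"
    "queries s' = queries (tick (bcost ?b) ?s) @ xs"
    "length xs \<le> 0 + (n * 0 + (0 + (0 + b * 0 + 0)))" "set xs \<subseteq> unit_ball n"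
    by (rule wpE)
  have nb: "\<not> bval ?b ?s" using n2 s by (simp add: load_point_def env_def)
  have c: "evaluation_prog m = If ?b Skip ?c" by (simp add: evaluation_prog_def newton_step_def)
  \<comment> \<open>\<open>t \<le> 1\<close> puts \<open>Y\<close> on the grid, which bounds the
    cost of the counting loop linearly in \<open>n\<close>.\<close>
  have bN: "b \<le> B * n"
  proof -
    have "(t + 1) * real (B * n) \<le> 2 * real (B * n)" using s(2) by (intro mult_right_mono) (auto simp: t_def)
    then have "Y - real m \<le> real (B * n)" by (simp add: Y_def)
    then have "\<lceil>Y - real m\<rceil> \<le> int (B * n)"
      unfolding ceiling_le_iff of_int_of_nat_eq .
    then show ?thesis unfolding b_def nat_le_iff .
  qed
  show ?thesis unfolding c
  proof (rule wpI[OF exec.IfFalse[OF nb e(1)], where xs = xs])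
    have sq: "n \<le> n\<^sup>2" "1 \<le> n\<^sup>2" using n2 by (auto simp: power2_eq_square)
    have "b \<le> B * n\<^sup>2" using bN mult_le_mono2[OF sq(1), of B] by linarith
    moreover have "straight_ops (newton_step m) \<le> straight_ops (newton_step m) * n\<^sup>2"
      using mult_le_mono2[OF sq(2), of "straight_ops (newton_step m)"] by simp
    moreover have "evaluation_cost m * n\<^sup>2 = straight_ops (newton_step m) * n\<^sup>2 + 40 * (B * n\<^sup>2) + 100 * n\<^sup>2"
      by (simp add: evaluation_cost_def algebra_simps)
    moreover have "bcost ?b + ?t \<le> straight_ops (newton_step m) + 40 * b + 20 * n + 60"
      by (simp add: algebra_simps)
    moreover have "ops s' \<le> ops ?s + (bcost ?b + ?t)" using e(3) by (simp add: tick_def)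
    ultimately show "ops s' \<le> ops ?s + evaluation_cost m * n\<^sup>2" using sq by linarith
  qed (use e in \<open>simp_all add: tick_def t_def\<close>)
qed

end

section \<open>The approximation error\<close>

text \<open>The chosen window lies inside the grid and satisfies
  \<open>b \<le> Y \<le> b + m\<close>, so \<open>interpolation_error\<close> applies to it.\<close>

lemma piecewise_newton_error:
  fixes m N :: nat
  assumes \<phi>: "\<phi> \<in> H \<sigma> Q" and "0 < \<sigma>" "0 < m" "\<bar>c\<bar> \<le> 1" "\<bar>t\<bar> \<le> 1" "m \<le> N"
    and N: "5 * real m \<le> \<sigma> * real N / 2"
    and y: "\<And>i. i < N \<Longrightarrow> norm (\<phi> (of_real (c * (-1 + 2 * real i / real N))) - of_real (y i)) \<le> \<epsilon>"
  shows "norm (\<phi> (of_real (c * t)) - of_real (piecewise_newton m N y t))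
    \<le> (4 * real m / (\<sigma> * real N / 2 - real m)) ^ m * Q + 2 * (4 * real m) ^ m * \<epsilon>"
proof -
  define Y where "Y = (t + 1) * real N / 2"
  define b where "b = nat \<lceil>Y - real m\<rceil>"
  have "0 < N" using assms by simp
  then have t: "-1 + 2 * Y / real N = t" by (simp add: Y_def)
  have "(t + 1) * real N \<le> 2 * real N" using assms(5) by (intro mult_right_mono) auto
  then have Y: "0 \<le> Y" "Y \<le> real N" using assms(5) by (auto simp: Y_def)
  have "\<lceil>Y - real m\<rceil> \<le> int (N - m)" using Y(2) assms(6) by (simp add: ceiling_le_iff of_nat_diff)
  then have b1: "b + m \<le> N" using assms(6) by (simp add: b_def)
  have b2: "Y \<le> real (b + m)" using real_nat_ceiling_ge[of "Y - real m"] by (simp add: b_def)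
  \<comment> \<open>If the window does not start at 0, minimality gives
    \<open>b - 1 < Y - m\<close>, and \<open>1 \<le> m\<close> closes the gap.\<close>
  have b3: "real b \<le> Y"
  proof (cases "b = 0")
    case False
    then have "b - 1 < b" by simp
    then have "real (b - 1) < Y - real m"
      unfolding b_def by (metis (no_types) less_ceiling_iff of_int_of_nat_eq zless_nat_eq_int_zless)
    then show ?thesis using False assms(3) by (simp add: of_nat_diff)
  qed (use Y in simp)
  have "norm (\<phi> (of_real (c * (-1 + 2 * Y / real N)))
      - of_real (newton (map (\<lambda>j. (real j, y (b + j))) [0..<m]) (Y - real b)))
    \<le> (4 * real m / (\<sigma> * real N / 2 - real m)) ^ m * Q + 2 * (4 * real m) ^ m * \<epsilon>"
  proof (rule interpolation_error[OF \<phi> assms(2,3,4) b1 b3 b2 _ N])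
    show "norm (\<phi> (of_real (c * (-1 + 2 * real (b + j) / real N))) - of_real (y (b + j))) \<le> \<epsilon>"
      if "j < m" for j
      by (rule y) (use that b1 in simp)
  qed
  then show ?thesis unfolding t by (simp only: piecewise_newton_def Let_def Y_def b_def)
qed

lemma newton_continuous:
  "continuous_on A (\<lambda>w. newton ps w)" for ps :: "('a::real_normed_field \<times> 'a) list"
proof (induction ps rule: length_induct)
  case (1 ps)
  show ?case
  proof (cases ps)
    case (Cons p qs)
    obtain u y where p: "p = (u, y)" by (cases p)
    have "continuous_on A (\<lambda>w. newton (map (\<lambda>(v, z). (v, (z - y) / (v - u))) qs) w)"
      using 1 by (simp add: Cons)
    then show ?thesis unfolding Cons p newton.simps by (intro continuous_intros)
  qed simp
qed

text \<open>Continuous for each fixed window start, and the start is a measurable choice from a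
  countable set. Measurability matters because \<open>esssup\<close> is infinite otherwise.\<close>

lemma piecewise_newton_measurable [measurable]:
  "piecewise_newton m N y \<in> borel_measurable borel"
proof -
  have "(\<lambda>t. newton (map (\<lambda>j. (real j, y (b + j))) [0..<m]) ((t + 1) * real N / 2 - real b))
      \<in> borel_measurable borel" for b
    by (rule borel_measurable_continuous_onI,
        rule continuous_on_compose2[OF newton_continuous[of UNIV]]) (auto intro!: continuous_intros)
  then show ?thesis unfolding piecewise_newton_def[abs_def] Let_def
    by (rule measurable_compose_countable) measurable
qed

lemma inner_measurable [measurable]:
  "(\<lambda>x. \<Sum>k<n. v k * x k) \<in> borel_measurable (Pi\<^sub>M {..<n} (\<lambda>_. lborel))" for v :: "nat \<Rightarrow> real"
  by (intro borel_measurable_sum borel_measurable_times borel_measurable_const)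
    (use measurable_component_singleton[of _ "{..<n}" "\<lambda>_. lborel"] in simp)

lemma Linf_norm_ball_le:
  fixes a v :: "nat \<Rightarrow> real"
  assumes "continuous_on {-1..1} \<psi>" and G: "G \<in> borel_measurable borel"
    and f: "\<And>x. x \<in> unit_ball n \<Longrightarrow> f x = \<psi> (\<Sum>k<n. a k * x k) \<and> \<bar>\<Sum>k<n. a k * x k\<bar> \<le> 1"
    and le: "\<And>x. x \<in> unit_ball n \<Longrightarrow> \<bar>G (\<Sum>k<n. v k * x k) - f x\<bar> \<le> c"
  shows "Linf_norm_ball n (\<lambda>x. G (\<Sum>k<n. v k * x k) - f x) \<le> ereal c"
proof -
  let ?M = "restrict_space (Pi\<^sub>M {..<n} (\<lambda>_. lborel)) (unit_ball n) :: (nat \<Rightarrow> real) measure"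
  \<comment> \<open>Continuity of \<open>\<psi>\<close> is known on \<open>[-1,1]\<close> only;
    clamping the argument yields a measurable function on the line without changing values on the
    ball.\<close>
  let ?\<psi> = "\<lambda>t::real. \<psi> (max (-1) (min 1 t))"
  have sp: "x \<in> unit_ball n" if "x \<in> space ?M" for x using that by (simp add: space_restrict_space)
  have "continuous_on UNIV ?\<psi>"
    by (rule continuous_on_compose2[OF assms(1)]) (auto intro!: continuous_intros)
  then have \<psi>: "?\<psi> \<in> borel_measurable borel" by (rule borel_measurable_continuous_onI)
  have in1: "(\<lambda>x. \<Sum>k<n. u k * x k) \<in> borel_measurable ?M" for u :: "nat \<Rightarrow> real"
    by (rule measurable_restrict_space1[OF inner_measurable])
  have "(\<lambda>x. G (\<Sum>k<n. v k * x k) - ?\<psi> (\<Sum>k<n. a k * x k)) \<in> borel_measurable ?M"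
    by (intro borel_measurable_diff measurable_compose[OF in1 G] measurable_compose[OF in1 \<psi>])
  also have "?this \<longleftrightarrow> (\<lambda>x. G (\<Sum>k<n. v k * x k) - f x) \<in> borel_measurable ?M"
  proof (rule measurable_cong)
    fix x assume "x \<in> space ?M"
    then have *: "f x = \<psi> (\<Sum>k<n. a k * x k)" "\<bar>\<Sum>k<n. a k * x k\<bar> \<le> 1" using f sp by auto
    then have "max (-1) (min 1 (\<Sum>k<n. a k * x k)) = (\<Sum>k<n. a k * x k)" by linarith
    then show "G (\<Sum>k<n. v k * x k) - ?\<psi> (\<Sum>k<n. a k * x k) = G (\<Sum>k<n. v k * x k) - f x"
      by (simp only: *(1))
  qed
  finally have "(\<lambda>x. ereal \<bar>G (\<Sum>k<n. v k * x k) - f x\<bar>) \<in> borel_measurable ?M" by measurable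
  then show ?thesis unfolding Linf_norm_ball_def
    by (rule esssup_I) (use le sp in \<open>auto intro: AE_I2\<close>)
qed

text \<open>Minimality gives \<open>l \<le> 1 + log_2 n \<le> 2 * log_2 n\<close> for
  \<open>2 \<le> n\<close>, and \<open>ln 2 \<ge> 2 / 3\<close> turns the factor 2 into 3.\<close>

lemma level_bounds:
  assumes "2 \<le> n"
  shows "n \<le> 2 ^ level n" "1 \<le> level n" "real (level n) \<le> 3 * ln (real n)"
proof -
  define l where "l = level n"
  have "n \<le> 2 ^ n" by (simp add: less_imp_le)
  then have l1: "n \<le> 2 ^ l" unfolding l_def level_def by (rule LeastI)
  then have "l \<noteq> 0" using assms by (intro notI) simp
  then have l0: "1 \<le> l" by simp
  then have "\<not> n \<le> 2 ^ (l - 1)"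
    using not_less_Least[of "l - 1" "\<lambda>l. n \<le> 2 ^ l"] by (simp add: l_def level_def)
  then have "real (2 ^ (l - 1)) \<le> real n" by (subst of_nat_le_iff) simp
  then have "ln (2 ^ (l - 1)) \<le> ln (real n)" using assms by simp
  then have "real (l - 1) * ln 2 \<le> ln (real n)" by (simp add: ln_realpow)
  moreover have "ln 2 \<le> ln (real n)" using assms by simp
  ultimately have "real l * ln 2 \<le> 2 * ln (real n)" using l0 by (simp add: of_nat_diff algebra_simps)
  moreover have "real l * (2 / 3) \<le> real l * ln 2"
    using ln2_ge_two_thirds by (intro mult_left_mono) auto
  ultimately have "real l \<le> 3 * ln (real n)" by linarith
  then show "n \<le> 2 ^ level n" "1 \<le> level n" "real (level n) \<le> 3 * ln (real n)"
    using l0 l1 unfolding l_def by auto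
qed

lemma ridge_function_profile:
  assumes "f \<in> ridge_functions (H_restricted \<sigma> Q) n" "0 < \<sigma>"
  obtains a \<phi> where "\<phi> \<in> H \<sigma> Q" "L2_set a {..<n} = 1"
    "\<And>x. x \<in> unit_ball n \<Longrightarrow> f x = Re (\<phi> (of_real (\<Sum>k<n. a k * x k))) \<and> \<bar>\<Sum>k<n. a k * x k\<bar> \<le> 1"
proof -
  from assms(1) obtain a \<psi> where a: "L2_set a {..<n} = 1" and \<psi>: "\<psi> \<in> H_restricted \<sigma> Q"
    and f: "\<And>x. x \<in> unit_ball n \<Longrightarrow> f x = \<psi> (scalar_product n a x)"
    unfolding ridge_functions_def by blast
  from \<psi> obtain \<phi> where \<phi>: "\<phi> \<in> H \<sigma> Q" "\<And>t. t \<in> {-1..1} \<Longrightarrow> complex_of_real (\<psi> t) = \<phi> (of_real t)"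
    unfolding H_restricted_def by blast
  have "f x = Re (\<phi> (of_real (\<Sum>k<n. a k * x k))) \<and> \<bar>\<Sum>k<n. a k * x k\<bar> \<le> 1" if "x \<in> unit_ball n" for x
  proof -
    have s: "\<bar>\<Sum>k<n. a k * x k\<bar> \<le> 1"
      using abs_inner_le[of x "{..<n}" a] that a by (simp add: unit_ball_def)
    then have "complex_of_real (\<psi> (\<Sum>k<n. a k * x k)) = \<phi> (of_real (\<Sum>k<n. a k * x k))"
      by (intro \<phi>(2)) (auto simp: abs_le_iff)
    then have "\<psi> (\<Sum>k<n. a k * x k) = Re (\<phi> (of_real (\<Sum>k<n. a k * x k)))"
      by (metis Re_complex_of_real)
    then show ?thesis using s f[OF that] by (simp add: scalar_product_def)
  qed
  then show thesis using that \<phi>(1) a by blast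
qed

lemma H_real_part:
  assumes "\<phi> \<in> H \<sigma> Q" "0 < \<sigma>"
  shows "continuous_on {-1..1} (\<lambda>t. Re (\<phi> (of_real t)))"
    and "\<And>t. \<bar>t\<bar> \<le> 1 \<Longrightarrow> of_real (Re (\<phi> (of_real t))) = \<phi> (of_real t)"
    and "\<And>t. \<bar>t\<bar> \<le> 1 \<Longrightarrow> \<bar>Re (\<phi> (of_real t))\<bar> \<le> Q"
proof -
  have "continuous_on (rectangle \<sigma>) \<phi>"
    using assms(1) by (auto simp: H_def intro: holomorphic_on_imp_continuous_on analytic_imp_holomorphic)
  then have "continuous_on {-1..1} (\<lambda>t::real. \<phi> (of_real t))"
    by (rule continuous_on_compose2) (use assms(2) in \<open>auto simp: rectangle_def intro!: continuous_intros\<close>)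
  then show "continuous_on {-1..1} (\<lambda>t. Re (\<phi> (of_real t)))" by (rule continuous_on_Re)
  fix t :: real assume "\<bar>t\<bar> \<le> 1"
  then have t: "complex_of_real t \<in> rectangle \<sigma>" using assms(2) by (intro of_real_in_rectangle) auto
  show "of_real (Re (\<phi> (of_real t))) = \<phi> (of_real t)" using assms(1) t by (auto simp: H_def)
  have "norm (\<phi> (of_real t)) \<le> Q" using assms(1) t by (simp add: H_def)
  then show "\<bar>Re (\<phi> (of_real t))\<bar> \<le> Q" using abs_Re_le_cmod order_trans by blast
qed

text \<open>Recovery and evaluation each perform just one test of cost 3, and the untouched cell
  \<open>out\<close> holds 0.\<close>

lemma one_dimensional_run:
  assumes "6 \<le> t"
  shows "\<exists>s. outputs_within t \<lparr>recovery = recovery_prog T K P B, evaluation = evaluation_prog m\<rparr> 1 \<sigma> Q \<kappa>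
    answer \<omega> s (\<lambda>_. 0) \<and> queries s = []"
proof -
  let ?b = "ILess (IVar ''n'') (IConst 2)" and ?i = "initial_state 1 \<sigma> Q \<kappa>"
  define s where "s = tick (bcost ?b) ?i"
  have r: "exec 1 answer \<omega> (recovery_prog T K P B) ?i s"
    unfolding recovery_prog_def s_def by (intro exec.IfTrue exec.Skip) (simp add: initial_state_def)
  have e: "exec 1 answer \<omega> (evaluation_prog m) (load_point 1 x s) (tick (bcost ?b) (load_point 1 x s))" for x
    unfolding evaluation_prog_def
    by (intro exec.IfTrue exec.Skip) (simp add: initial_state_def s_def tick_def load_point_def)
  have "outputs_within t \<lparr>recovery = recovery_prog T K P B, evaluation = evaluation_prog m\<rparr> 1 \<sigma> Q \<kappa>
    answer \<omega> s (\<lambda>_. 0)"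
    unfolding outputs_within_def algorithm.simps
  proof (intro conjI ballI exI)
    fix x
    show "exec 1 answer \<omega> (evaluation_prog m) (load_point 1 x s) (tick (bcost ?b) (load_point 1 x s))" by (rule e)
  qed (use assms r in \<open>simp_all add: s_def tick_def load_point_def initial_state_def\<close>)
  then show ?thesis by (auto simp: s_def tick_def initial_state_def)
qed

context ridge_oracle
begin

lemma run:
  assumes "(recovery_cost + evaluation_cost m) * n\<^sup>2 \<le> t"
  shows "\<exists>s d. outputs_within t \<lparr>recovery = recovery_prog T K P B, evaluation = evaluation_prog m\<rparr> n \<sigma> Q \<kappa>
      answer \<omega> s (\<lambda>x. piecewise_newton m (B * n) (arr s ''y'') (\<Sum>k<n. normalized d k * x k)) \<and>
    set (queries s) \<subseteq> unit_ball n \<and> length (queries s) \<le> 2 * n * (K * l) + (n + 1) + B * n \<and>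
    good_differences d \<and> (\<forall>i<B * n. \<bar>arr s ''y'' i - profile_value (normalized d) i\<bar> \<le> \<epsilon>)"
proof -
  obtain s xs where s: "exec n answer \<omega> (recovery_prog T K P B) (initial_state n \<sigma> Q \<kappa>) s" "recovered s"
    "ops s \<le> ops (initial_state n \<sigma> Q \<kappa>) + recovery_cost * n\<^sup>2" "draws s = draws (initial_state n \<sigma> Q \<kappa>)"
    "queries s = queries (initial_state n \<sigma> Q \<kappa>) @ xs"
    "length xs \<le> 2 * n * (K * l) + (n + 1) + B * n" "set xs \<subseteq> unit_ball n"
    using recovery_correct by (rule wpE)
  from s(2) obtain d where d: "env s" "good_differences d" "\<And>k. k < n \<Longrightarrow> arr s ''v'' k = normalized d k"
    "\<forall>i<B * n. \<bar>arr s ''y'' i - profile_value (normalized d) i\<bar> \<le> \<epsilon>"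
    unfolding recovered_def by blast
  have t: "ops s \<le> recovery_cost * n\<^sup>2" using s(3) by (simp add: initial_state_def)
  have ev: "\<exists>s'. exec n answer \<omega> (evaluation_prog m) (load_point n x s) s' \<and> queries s' = queries s \<and>
      draws s' = draws s \<and> ops s' \<le> t \<and>
      arr s' ''out'' 0 = piecewise_newton m (B * n) (arr s ''y'') (\<Sum>k<n. normalized d k * x k)"
    if x: "x \<in> unit_ball n" for x
  proof -
    have e: "(\<Sum>k<n. arr s ''v'' k * x k) = (\<Sum>k<n. normalized d k * x k)" using d(3) by simp
    have "\<bar>\<Sum>k<n. normalized d k * x k\<bar> \<le> 1"
      using abs_inner_le[of x "{..<n}" "normalized d"] x L2_set_normalized[of d] by (simp add: unit_ball_def)
    then have "\<bar>\<Sum>k<n. arr s ''v'' k * x k\<bar> \<le> 1" unfolding e .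
    from evaluation_correct[OF d(1) this, of m]
    obtain s' ys where s': "exec n answer \<omega> (evaluation_prog m) (load_point n x s) s'"
      "arr s' ''out'' 0 = piecewise_newton m (B * n) (arr s ''y'') (\<Sum>k<n. arr s ''v'' k * x k)"
      "ops s' \<le> ops (load_point n x s) + evaluation_cost m * n\<^sup>2" "draws s' = draws (load_point n x s)"
      "queries s' = queries (load_point n x s) @ ys" "length ys \<le> 0" "set ys \<subseteq> unit_ball n"
      by (rule wpE)
    have "ops s' \<le> t" using s'(3) t assms by (simp add: load_point_def algebra_simps)
    then show ?thesis using s' unfolding e by (auto simp: load_point_def)
  qed
  have "outputs_within t \<lparr>recovery = recovery_prog T K P B, evaluation = evaluation_prog m\<rparr> n \<sigma> Q \<kappa>
      answer \<omega> s (\<lambda>x. piecewise_newton m (B * n) (arr s ''y'') (\<Sum>k<n. normalized d k * x k))"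
    unfolding outputs_within_def algorithm.simps
    using s(1) ev t assms by (auto simp: algebra_simps)
  then show ?thesis using s(5,6,7) d(2,4) by (auto simp: initial_state_def)
qed

end

theorem mainTheorem2:
  fixes \<sigma> \<kappa> :: real
  assumes "0 < \<sigma>" and "\<sigma> \<le> 1" and "0 < \<kappa>"
  shows "\<exists>C>0. \<exists>(A :: algorithm) (p :: nat poly).
    \<forall>(n::nat)\<ge>1. \<forall>(Q::real)\<ge>1. \<forall>f\<in>ridge_functions (H_restricted \<sigma> Q) n.
      \<exists>E\<in>sets randomness. measure randomness E \<ge> 1 - 2 * exp (- real n) \<and>
        (\<forall>\<omega>\<in>space randomness. \<forall>err :: nat \<Rightarrow> real.
          (\<forall>i. \<bar>err i\<bar> \<le> Q * exp (- C * (ln (real n))\<^sup>2)) \<longrightarrow>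
          (\<exists>s g. outputs_within (poly p n) A n \<sigma> Q \<kappa> (\<lambda>i x. f x + err i) \<omega> s g \<and>
             set (queries s) \<subseteq> unit_ball n \<and>
             real (length (queries s)) \<le> C * real n * (ln (real n))\<^sup>2 \<and>
             (\<omega> \<in> E \<longrightarrow>
               Linf_norm_ball n (\<lambda>x. g x - f x) \<le> ereal (Q * real n powr (- \<kappa>)))))"
proof -
  define k where "k = nat \<lceil>\<kappa>\<rceil>"
  \<comment> \<open>Two more nodes than the exponent: the factor
    \<open>(1 / (2 * n))\<^sup>2\<close> supplies the \<open>1 / 4\<close> reserved for the
    interpolation error.\<close>
  define m where "m = k + 2"
  have k: "\<kappa> \<le> real k" unfolding k_def by (rule real_nat_ceiling_ge)
  obtain T K P0 where T: "2 \<le> T" and K: "0 < K" and dir: "\<forall>P\<ge>P0. \<forall>l\<ge>1. \<forall>(n::nat)\<le>2 ^ l. \<forall>Q>0. \<forall>\<phi>\<in>H \<sigma> Q.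
      \<forall>a d bi bj h \<epsilon> x V.
      let p = (\<lambda>j. real j / real (T * (K * l))); \<psi> = (\<lambda>t. Re (\<phi> (of_real t)));
          v = (\<lambda>i. d i / sqrt (\<Sum>k<n. (d k)\<^sup>2)) in
      h = (1/2) ^ (P * l\<^sup>2) \<longrightarrow> \<epsilon> \<le> Q * h\<^sup>2 \<longrightarrow> L2_set a {..<n} = 1 \<longrightarrow> bi < n \<longrightarrow> bj < K * l \<longrightarrow>
      (\<forall>i<n. \<forall>j<K * l. \<bar>\<psi> ((p j + h) * a i) - \<psi> (p j * a i)\<bar> \<le> V + 2 * \<epsilon>) \<longrightarrow>
      V \<le> \<bar>\<psi> ((p bj + h) * a bi) - \<psi> (p bj * a bi)\<bar> + 2 * \<epsilon> \<longrightarrow>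
      (\<forall>i<n. \<bar>d i - (\<psi> (p bj * a bi + h * a i) - \<psi> (p bj * a bi))\<bar> \<le> 2 * \<epsilon>) \<longrightarrow>
      L2_set x {..<n} \<le> 1 \<longrightarrow>
      norm (\<phi> (of_real ((\<Sum>i<n. a i * v i) * (\<Sum>i<n. v i * x i))) - \<phi> (of_real (\<Sum>i<n. a i * x i)))
        \<le> (1/2) ^ ((k + 1) * l) * Q"
    using direction_recovery[OF assms(1), of "k + 1"] by blast
  \<comment> \<open>With \<open>18 * m \<le> \<sigma> * B\<close> the denominator
    \<open>\<sigma> * B * n / 2 - m\<close> is at least \<open>8 * m * n\<close>, so every node
    gains a factor \<open>1 / (2 * n)\<close>.\<close>
  obtain B where B: "18 * real m / \<sigma> \<le> real B" using real_arch_simple by blast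
  have m0: "0 < m" by (simp add: m_def)
  have "0 < 18 * real m / \<sigma>" using m0 assms(1) by simp
  then have B0: "0 < B" using B by (metis of_nat_0_less_iff order_less_le_trans)
  have B18: "18 * real m \<le> \<sigma> * real B" using B assms(1) by (simp add: pos_divide_le_eq mult.commute)
  have "0 < 1 / (8 * (4 * real m) ^ m)" using m0 by simp
  then obtain k4 where k4: "(1/2) ^ k4 \<le> 1 / (8 * (4 * real m) ^ m)" using half_power_le by blast
  \<comment> \<open>\<open>P0\<close> serves the direction, \<open>k + k4\<close> the noise
    amplified by \<open>2 * (4 * m) ^ m\<close> in the interpolation, and 1 makes \<open>P\<close>
    positive.\<close>
  define P where "P = P0 + k + k4 + 1"
  \<comment> \<open>\<open>18 * P\<close> forces the noise below \<open>Q * h\<^sup>2\<close>, since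
    \<open>l \<le> 3 * ln n\<close>. The rest pays for the queries:
    \<open>l \<le> 5 * (ln n)\<^sup>2\<close> in the search, and
    \<open>1 \<le> 3 * (ln n)\<^sup>2\<close> for the \<open>(2 + B) * n\<close> others.\<close>
  define C where "C = 18 * real P + 10 * real K + 3 * real B + 6"
  define A where "A = \<lparr>recovery = recovery_prog T K P B, evaluation = evaluation_prog m\<rparr>"
  \<comment> \<open>The locale constants depend only on \<open>T\<close>, \<open>K\<close>,
    \<open>P\<close>, \<open>B\<close> and \<open>m\<close>, so one polynomial serves all
    \<open>n\<close>, \<open>Q\<close> and \<open>f\<close>; the 6 covers
    \<open>n = 1\<close>.\<close>
  define cost where "cost = ridge_oracle.recovery_cost T K P B + ridge_oracle.evaluation_cost B m + 6"
  define p where "p = monom cost 2"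
  have C: "0 < C" by (simp add: C_def add_nonneg_pos)
  have main: "\<exists>s g. outputs_within (poly p n) A n \<sigma> Q \<kappa> (\<lambda>i x. f x + err i) \<omega> s g \<and>
             set (queries s) \<subseteq> unit_ball n \<and>
             real (length (queries s)) \<le> C * real n * (ln (real n))\<^sup>2 \<and>
               Linf_norm_ball n (\<lambda>x. g x - f x) \<le> ereal (Q * real n powr (- \<kappa>))"
    if n: "1 \<le> n" and Q: "1 \<le> Q" and f: "f \<in> ridge_functions (H_restricted \<sigma> Q) n"
      and err: "\<And>i. \<bar>err i\<bar> \<le> Q * exp (- C * (ln (real n))\<^sup>2)" for n Q f err and \<omega> :: "nat \<Rightarrow> real"
  proof -
    obtain a \<phi> where \<phi>: "\<phi> \<in> H \<sigma> Q" and a: "L2_set a {..<n} = 1"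
      and fx: "\<And>x. x \<in> unit_ball n \<Longrightarrow> f x = Re (\<phi> (of_real (\<Sum>k<n. a k * x k))) \<and> \<bar>\<Sum>k<n. a k * x k\<bar> \<le> 1"
      using ridge_function_profile[OF f assms(1)] by blast
    note cont = H_real_part(1)[OF \<phi> assms(1)]
    show ?thesis
    proof (cases "n = 1")
      case True
      have "6 \<le> poly p n"
        unfolding p_def poly_monom cost_def by (simp add: True)
      then obtain s where s: "outputs_within (poly p n) A n \<sigma> Q \<kappa> (\<lambda>i x. f x + err i) \<omega> s (\<lambda>_. 0)" "queries s = []"
        using one_dimensional_run[of "poly p n"] unfolding A_def True by blast
      have "Linf_norm_ball n (\<lambda>x. (\<lambda>_. 0) (\<Sum>k<n. 0 * x k) - f x) \<le> ereal Q"
      proof (rule Linf_norm_ball_le[OF cont _ fx])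
        show "\<bar>(\<lambda>_. 0) (\<Sum>k<n. 0 * x k) - f x\<bar> \<le> Q" if "x \<in> unit_ball n" for x
          using fx[OF that] H_real_part(3)[OF \<phi> assms(1)] by (simp del: of_real_sum)
      qed auto
      then show ?thesis using s True by (intro exI[of _ s] exI[of _ "\<lambda>_. 0"]) simp
    next
      case False
      then have n2: "2 \<le> n" using n by simp
      define l where "l = level n"
      define h where "h = (1/2::real) ^ (P * l\<^sup>2)"
      define \<epsilon> where "\<epsilon> = Q * exp (- C * (ln (real n))\<^sup>2)"
      define \<psi> where "\<psi> = (\<lambda>t::real. Re (\<phi> (of_real t)))"
      note lb = level_bounds[OF n2, folded l_def]
      interpret ridge_oracle n "\<lambda>i x. f x + err i" \<omega> f \<epsilon> a \<psi> T K P B l h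
        by unfold_locales (use err fx n2 T K B0 in \<open>auto simp: \<epsilon>_def \<psi>_def P_def l_def h_def scalar_product_def\<close>)
      obtain s d where s: "outputs_within (poly p n) A n \<sigma> Q \<kappa> (\<lambda>i x. f x + err i) \<omega> s
          (\<lambda>x. piecewise_newton m (B * n) (arr s ''y'') (\<Sum>k<n. normalized d k * x k))"
        "set (queries s) \<subseteq> unit_ball n" "length (queries s) \<le> 2 * n * (K * l) + (n + 1) + B * n"
        "good_differences d" "\<forall>i<B * n. \<bar>arr s ''y'' i - profile_value (normalized d) i\<bar> \<le> \<epsilon>"
      proof -
        have "(recovery_cost + evaluation_cost m) * n\<^sup>2 \<le> poly p n"
          unfolding p_def poly_monom cost_def by (intro mult_right_mono) auto
        from run[OF this, of \<sigma> Q \<kappa>] that show thesis unfolding A_def by blast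
      qed
      define v where "v = normalized d"
      define c where "c = (\<Sum>i<n. a i * v i)"
      have v: "v = (\<lambda>i. d i / sqrt (\<Sum>k<n. (d k)\<^sup>2))" by (simp add: v_def normalized_def fun_eq_iff)
      have ln0: "2 / 3 \<le> ln (real n)"
        using ln2_ge_two_thirds n2 ln_le_cancel_iff[of 2 "real n"] by linarith
      have queries: "real (length (queries s)) \<le> C * real n * (ln (real n))\<^sup>2"
      proof -
        define L where "L = ln (real n)"
        have L: "2 / 3 \<le> L" "real l \<le> 3 * L" using ln0 lb by (auto simp: L_def)
        have "L * (2 / 3) \<le> L * L" using L by (intro mult_left_mono) auto
        then have L2: "L \<le> (3 / 2) * L\<^sup>2" "1 \<le> 3 * L\<^sup>2"
          unfolding power2_eq_square using L by linarith+
        have "real l \<le> 5 * L\<^sup>2" using L L2 zero_le_power2[of L] by linarith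
        then have "(2 * real n * real K) * real l \<le> (2 * real n * real K) * (5 * L\<^sup>2)"
          by (rule mult_left_mono) simp
        moreover have "(2 + real B) * real n * 1 \<le> (2 + real B) * real n * (3 * L\<^sup>2)"
          using L2(2) by (rule mult_left_mono) simp
        moreover have "0 \<le> 18 * real P * real n * L\<^sup>2" by simp
        moreover have "real (length (queries s)) \<le> (2 * real n * real K) * real l + (2 + real B) * real n * 1"
        proof -
          have "real (length (queries s)) \<le> real (2 * n * (K * l) + (n + 1) + B * n)" using s(3) by (simp only: of_nat_le_iff)
          then show ?thesis using n2 by (simp add: algebra_simps)
        qed
        ultimately have "real (length (queries s)) \<le> (2 * real n * real K) * (5 * L\<^sup>2)
            + (2 + real B) * real n * (3 * L\<^sup>2) + 18 * real P * real n * L\<^sup>2" by linarith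
        also have "\<dots> = C * real n * L\<^sup>2" by (simp add: C_def algebra_simps)
        finally show ?thesis unfolding L_def .
      qed
      have \<epsilon>h: "\<epsilon> \<le> Q * h\<^sup>2"
      proof -
        have "(real l)\<^sup>2 \<le> (3 * ln (real n))\<^sup>2" using lb(3) by (intro power_mono) auto
        then have "2 * real P * (real l)\<^sup>2 \<le> 2 * real P * (3 * ln (real n))\<^sup>2" by (rule mult_left_mono) simp
        also have "\<dots> = 18 * real P * (ln (real n))\<^sup>2" by (simp add: power2_eq_square)
        also have "\<dots> \<le> C * (ln (real n))\<^sup>2" by (intro mult_right_mono) (auto simp: C_def)
        finally have "real (2 * (P * l\<^sup>2)) * ln 2 \<le> C * (ln (real n))\<^sup>2 * 1"
          using ln2_le_25_over_36 C by (intro mult_mono) auto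
        then have "exp (- C * (ln (real n))\<^sup>2) \<le> exp (- (real (2 * (P * l\<^sup>2)) * ln 2))" by simp
        also have "\<dots> = h\<^sup>2"
        proof -
          have "exp (real (2 * (P * l\<^sup>2)) * ln 2) = (2::real) ^ (2 * (P * l\<^sup>2))"
            by (subst exp_of_nat_mult) simp
          then show ?thesis
            by (simp add: exp_minus h_def power_one_over power_mult[symmetric] mult.commute inverse_eq_divide)
        qed
        finally show ?thesis using Q by (simp add: \<epsilon>_def)
      qed
      \<comment> \<open>From \<open>n \<le> 2 ^ l\<close>: powers of \<open>(1/2) ^ l\<close> are at
        most the same powers of \<open>1 / n\<close>.\<close>
      have half: "(1/2::real) ^ (j * l) * real n ^ j \<le> 1" for j
      proof -
        have "real n \<le> 2 ^ l" using lb(1) by (metis of_nat_le_iff of_nat_numeral of_nat_power)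
        then have "real n ^ j \<le> (2 ^ l) ^ j" by (rule power_mono) simp
        then have "(1/2::real) ^ (j * l) * real n ^ j \<le> (1/2) ^ (j * l) * (2 ^ l) ^ j" by (rule mult_left_mono) simp
        also have "\<dots> = 1" by (simp add: power_one_over power_mult[symmetric] mult.commute)
        finally show ?thesis .
      qed
      define \<tau> where "\<tau> = 1 / real n ^ k"
      have \<tau>: "(1/2) ^ (k * l) \<le> \<tau>" using half[of k] n2 by (simp add: \<tau>_def pos_le_divide_eq)
      have "2 * (4 * real m) ^ m * \<epsilon> \<le> \<tau> / 4 * Q"
      proof -
        have "h \<le> (1/2) ^ (k * l + k4)"
        proof -
          have "l \<le> l\<^sup>2" "1 \<le> l\<^sup>2" using lb(2) by (auto simp: power2_eq_square)
          then have "k * l + k4 * 1 \<le> k * l\<^sup>2 + k4 * l\<^sup>2" by (intro add_mono mult_left_mono) auto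
          also have "\<dots> \<le> P * l\<^sup>2" by (simp add: P_def algebra_simps)
          finally show ?thesis unfolding h_def by (intro power_decreasing) auto
        qed
        also have "\<dots> \<le> (1/2) ^ (k * l) * (1 / (8 * (4 * real m) ^ m))"
          unfolding power_add by (intro mult_left_mono k4) auto
        also have "\<dots> \<le> \<tau> * (1 / (8 * (4 * real m) ^ m))" using \<tau> by (intro mult_right_mono) auto
        finally have h1: "h \<le> \<tau> * (1 / (8 * (4 * real m) ^ m))" .
        have "h\<^sup>2 \<le> h * 1" unfolding power2_eq_square using h(1,2) by (intro mult_left_mono) auto
        then have "\<epsilon> \<le> Q * (\<tau> * (1 / (8 * (4 * real m) ^ m)))"
          using \<epsilon>h h1 Q mult_left_mono[of "h\<^sup>2" "\<tau> * (1 / (8 * (4 * real m) ^ m))" Q] by linarith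
        then have "2 * (4 * real m) ^ m * \<epsilon> \<le> 2 * (4 * real m) ^ m * (Q * (\<tau> * (1 / (8 * (4 * real m) ^ m))))"
          by (rule mult_left_mono) simp
        also have "\<dots> = \<tau> / 4 * Q" using m0 by simp
        finally show ?thesis .
      qed
      moreover have "(4 * real m / (\<sigma> * real (B * n) / 2 - real m)) ^ m * Q \<le> \<tau> / 4 * Q"
      proof -
        have "18 * real m * real n \<le> \<sigma> * real B * real n" using B18 by (rule mult_right_mono) simp
        moreover have "real m * 1 \<le> real m * real n" using n2 by (intro mult_left_mono) auto
        ultimately have d: "8 * real m * real n \<le> \<sigma> * real (B * n) / 2 - real m" by simp
        have d0: "0 < 8 * real m * real n" using m0 n2 by simp
        have "4 * real m / (\<sigma> * real (B * n) / 2 - real m) \<le> 4 * real m / (8 * real m * real n)"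
          by (rule frac_le[OF _ order_refl d0 d]) simp
        also have "\<dots> = 1 / (2 * real n)" using m0 by simp
        finally have "(4 * real m / (\<sigma> * real (B * n) / 2 - real m)) ^ m \<le> (1 / (2 * real n)) ^ m"
          using less_le_trans[OF d0 d] by (intro power_mono divide_nonneg_pos) auto
        also have "\<dots> = (1 / (2 * real n)) ^ k * (1 / (2 * real n)) ^ 2" by (simp only: m_def power_add)
        also have "\<dots> \<le> (1 / real n) ^ k * (1 / 2) ^ 2"
          using n2 by (intro mult_mono power_mono) (auto simp: divide_simps)
        also have "\<dots> = \<tau> / 4" by (simp add: \<tau>_def power_one_over)
        finally show ?thesis using Q by (intro mult_right_mono) auto
      qed
      ultimately have interp: "(4 * real m / (\<sigma> * real (B * n) / 2 - real m)) ^ m * Q + 2 * (4 * real m) ^ m * \<epsilon>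
          \<le> \<tau> / 2 * Q" by linarith
      have v1: "L2_set v {..<n} \<le> 1" unfolding v_def by (rule L2_set_normalized)
      have c1: "\<bar>c\<bar> \<le> 1" using abs_inner_le[OF v1, of a] a by (simp add: c_def)
      have close: "\<bar>piecewise_newton m (B * n) (arr s ''y'') (\<Sum>k<n. v k * x k) - f x\<bar> \<le> Q * real n powr (- \<kappa>)"
        if x: "x \<in> unit_ball n" for x
      proof -
        define t where "t = (\<Sum>k<n. v k * x k)"
        have xL: "L2_set x {..<n} \<le> 1" using x by (simp add: unit_ball_def)
        have t1: "\<bar>t\<bar> \<le> 1" using abs_inner_le[OF xL, of v] v1 by (simp add: t_def)
        have "norm (\<phi> (of_real (c * t)) - of_real (piecewise_newton m (B * n) (arr s ''y'') t))
          \<le> (4 * real m / (\<sigma> * real (B * n) / 2 - real m)) ^ m * Q + 2 * (4 * real m) ^ m * \<epsilon>"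
        proof (rule piecewise_newton_error[OF \<phi> assms(1) m0 c1 t1])
          have b9: "9 * real m \<le> \<sigma> * real B / 2" using B18 by simp
          have "real B * \<sigma> \<le> real B * 1" using assms(2) by (rule mult_left_mono) simp
          then have "18 * real m \<le> real B" using B18 by (simp add: mult.commute)
          then have "real m \<le> real B" by linarith
          then show "m \<le> B * n" using n2 by (metis of_nat_le_iff le_trans mult_le_mono2 nat_mult_1_right n)
          have "9 * real m * 1 \<le> \<sigma> * real B / 2 * real n" using b9 n2 by (intro mult_mono) auto
          then show "5 * real m \<le> \<sigma> * real (B * n) / 2" by simp
          show "norm (\<phi> (of_real (c * (-1 + 2 * real i / real (B * n)))) - of_real (arr s ''y'' i)) \<le> \<epsilon>"
            if i: "i < B * n" for i
          proof -
            define u where "u = -1 + 2 * real i / real (B * n)"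
            have "real i \<le> real (B * n)" "0 < real (B * n)" using i B0 n2 by (simp_all del: of_nat_mult)
            then have "real i / real (B * n) \<le> 1" "0 \<le> real i / real (B * n)" by simp_all
            then have "\<bar>u\<bar> \<le> 1" by (simp add: u_def abs_le_iff del: of_nat_mult)
            then have cu: "\<bar>c * u\<bar> \<le> 1" using c1 by (simp add: abs_mult mult_le_one)
            have "(\<Sum>k<n. a k * ((2 * real i / real (B * n) - 1) * v k)) = c * u"
              unfolding c_def u_def sum_distrib_right by (intro sum.cong) (simp_all only: ac_simps uminus_add_conv_diff)
            then have "profile_value v i = \<psi> (c * u)" by (simp only: profile_value_def)
            then have "\<bar>arr s ''y'' i - \<psi> (c * u)\<bar> \<le> \<epsilon>" using s(5) i unfolding v_def by metis
            moreover have "\<phi> (of_real (c * u)) = of_real (\<psi> (c * u))"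
              unfolding \<psi>_def by (rule H_real_part(2)[OF \<phi> assms(1) cu, symmetric])
            ultimately show ?thesis unfolding u_def[symmetric]
              by (metis abs_minus_commute norm_of_real of_real_diff)
          qed
        qed
        also note interp
        finally have e1: "norm (\<phi> (of_real (c * t)) - of_real (piecewise_newton m (B * n) (arr s ''y'') t)) \<le> \<tau> / 2 * Q" .
        from s(4) obtain bi bj V where g: "bi < n" "bj < K * l"
          "\<And>i j. i < n \<Longrightarrow> j < K * l \<Longrightarrow> \<bar>increment i j\<bar> \<le> V + 2 * \<epsilon>" "V \<le> \<bar>increment bi bj\<bar> + 2 * \<epsilon>"
          "\<And>i. i < n \<Longrightarrow> \<bar>d i - gradient bi bj i\<bar> \<le> 2 * \<epsilon>"
          unfolding good_differences_def by blast
        note g' = g[unfolded increment_def gradient_def node_def, unfolded \<psi>_def]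
        have P: "P0 \<le> P" "0 < Q" using Q by (auto simp: P_def)
        \<comment> \<open>Half of the error budget is spent here, on the direction; the other half
          went to interpolation. The exponent \<open>k + 1\<close> supplies the factor
          \<open>1 / 2\<close>.\<close>
        have "norm (\<phi> (of_real (c * t)) - \<phi> (of_real (\<Sum>i<n. a i * x i))) \<le> (1/2) ^ ((k + 1) * l) * Q"
          unfolding c_def t_def v
          by (rule dir[unfolded Let_def, rule_format, OF P(1) lb(2) lb(1) P(2) \<phi> h_def \<epsilon>h a g' xL])
        also have "(1/2::real) ^ ((k + 1) * l) \<le> \<tau> / 2"
        proof -
          have "(1/2::real) ^ l \<le> (1/2) ^ 1" using lb(2) by (intro power_decreasing) auto
          then have "(1/2::real) ^ (k * l) * (1/2) ^ l \<le> \<tau> * (1/2)" using \<tau> by (intro mult_mono) (auto simp: \<tau>_def)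
          then show ?thesis by (simp add: power_add algebra_simps)
        qed
        finally have e2: "norm (\<phi> (of_real (c * t)) - \<phi> (of_real (\<Sum>i<n. a i * x i))) \<le> \<tau> / 2 * Q"
          using Q by simp
        have "\<phi> (of_real (\<Sum>i<n. a i * x i)) = of_real (f x)"
          using fx[OF x] H_real_part(2)[OF \<phi> assms(1)] by metis
        then have "\<bar>piecewise_newton m (B * n) (arr s ''y'') t - f x\<bar>
          = norm (of_real (piecewise_newton m (B * n) (arr s ''y'') t) - \<phi> (of_real (\<Sum>i<n. a i * x i)))"
          by (metis norm_of_real of_real_diff)
        also have "\<dots> = norm ((\<phi> (of_real (c * t)) - \<phi> (of_real (\<Sum>i<n. a i * x i)))
            - (\<phi> (of_real (c * t)) - of_real (piecewise_newton m (B * n) (arr s ''y'') t)))"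
          by simp
        also have "\<dots> \<le> \<tau> / 2 * Q + \<tau> / 2 * Q" by (rule order_trans[OF norm_triangle_ineq4 add_mono[OF e2 e1]])
        also have "\<dots> = Q * \<tau>" by simp
        also have "\<dots> \<le> Q * real n powr (- \<kappa>)"
        proof (rule mult_left_mono)
          have "\<tau> = real n powr (- real k)" using n2 by (simp add: \<tau>_def powr_minus powr_realpow inverse_eq_divide)
          also have "\<dots> \<le> real n powr (- \<kappa>)" using k n2 by (intro powr_mono) auto
          finally show "\<tau> \<le> real n powr (- \<kappa>)" .
        qed (use Q in simp)
        finally show ?thesis by (simp only: t_def)
      qed
      have "Linf_norm_ball n (\<lambda>x. piecewise_newton m (B * n) (arr s ''y'') (\<Sum>k<n. v k * x k) - f x)
          \<le> ereal (Q * real n powr (- \<kappa>))"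
        by (rule Linf_norm_ball_le[OF cont piecewise_newton_measurable fx close])
      then show ?thesis using s(1,2) queries unfolding v_def by blast
    qed
  qed
  interpret prob_space randomness by (rule prob_space_randomness)
  show ?thesis
  proof (rule exI[of _ C], intro conjI C exI[of _ A] exI[of _ p] allI impI ballI, goal_cases)
    case (1 n Q f)
    show ?case
    proof (rule bexI[of _ "space randomness"], intro conjI ballI allI impI, goal_cases)
      case 1
      show ?case by (simp add: prob_space)
    next
      case (2 \<omega> err)
      then show ?case using main[OF 1, of err \<omega>] by blast
    qed simp
  qed
qed

end
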